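(* Let $K$ be a field of characteristic zero and let $H\in K[x_1,\dots,x_n]^n$ have degree $d$, such that $H(0)=0$ and $\mathcal{J}H$ is nilpotent. If $\operatorname{rk}\mathcal{J}H=1$, or if $\operatorname{rk}\mathcal{J}H=2$ and $d=2$, then $H$ is of the form $( * )$: for some $N\in\mathbb{N}$ there exist $b_i,c_i\in K^n$ and $d_i\in\{1,\dots,d\}$ ($1\le i\le N$) such that $c_j^{\mathrm t}b_i=0$ for all $1\le j\le i\le N$ and $H=\sum_{i=1}^N(c_i^{\mathrm t}x)^{d_i}b_i$. Furthermore, if the conclusion $( * )$ is replaced by "there exists a $T\in\mathrm{GL}_n(K)$ such that the Jacobian of $T^{-1}H(Tx)$ is lower triangular with zeroes on the diagonal", then the condition $H(0)=0$ is no longer necessary.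
   Context: $x=(x_1,\dots,x_n)$, vectors are column vectors, $M^{\mathrm t}$ is the transpose, $\mathcal{J}H=(\partial H_i/\partial x_j)_{i,j}$ is the Jacobian matrix and $\operatorname{rk}\mathcal{J}H$ its rank over $K(x)$. The degree of a polynomial map is the maximum of the degrees of its components. *)

theory Defs
  imports
    "HOL-Library.Poly_Mapping"
    "HOL-Computational_Algebra.Fraction_Field"
    "Jordan_Normal_Form.Matrix"
    "Jordan_Normal_Form.DL_Rank"
begin

text \<open>
  Polynomials in countably many variables: the exponent vector of a monomial is a finitely
  supported function from variable indices to exponents.  The variables of
  \<open>K[x\<^sub>1, \<dots>, x\<^sub>n]\<close> are indexed by \<open>0, \<dots>, n - 1\<close>, as are the entries of vectors and matrices.
\<close>

type_synonym 'a mpol = "(nat \<Rightarrow>\<^sub>0 nat) \<Rightarrow>\<^sub>0 'a"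

definition mp_const :: "'a::zero \<Rightarrow> 'a mpol" where
  "mp_const a = Poly_Mapping.single 0 a"

definition mp_var :: "nat \<Rightarrow> 'a::zero_neq_one mpol" where
  "mp_var i = Poly_Mapping.single (Poly_Mapping.single i 1) 1"

definition mp_in :: "nat \<Rightarrow> 'a::zero mpol set" where
  "mp_in n = {p. \<forall>m \<in> Poly_Mapping.keys p. Poly_Mapping.keys m \<subseteq> {..<n}}"

definition monom_degree :: "(nat \<Rightarrow>\<^sub>0 nat) \<Rightarrow> nat" where
  "monom_degree m = (\<Sum>i\<in>Poly_Mapping.keys m. Poly_Mapping.lookup m i)"

text \<open>The zero polynomial, and the map with no components, get degree \<open>0\<close>.\<close>

definition mp_degree :: "'a::zero mpol \<Rightarrow> nat" where
  "mp_degree p = Max (insert 0 (monom_degree ` Poly_Mapping.keys p))"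

definition map_degree :: "'a::zero mpol vec \<Rightarrow> nat" where
  "map_degree H = Max (insert 0 ((\<lambda>i. mp_degree (H $ i)) ` {..<dim_vec H}))"

text \<open>
  Evaluation along a coefficient homomorphism \<open>\<phi>\<close>: taking \<open>\<phi>\<close> to be the identity evaluates at a
  point, taking it to be \<^const>\<open>mp_const\<close> substitutes polynomials for the variables.
\<close>

definition mp_eval :: "('a::zero \<Rightarrow> 'b::comm_semiring_1) \<Rightarrow> (nat \<Rightarrow> 'b) \<Rightarrow> 'a mpol \<Rightarrow> 'b" where
  "mp_eval \<phi> \<sigma> p = (\<Sum>m\<in>Poly_Mapping.keys p. \<phi> (Poly_Mapping.lookup p m) *
      (\<Prod>i\<in>Poly_Mapping.keys m. \<sigma> i ^ Poly_Mapping.lookup m i))"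

text \<open>
  The truncated subtraction of exponents is harmless: if \<open>x\<^sub>i\<close> does not occur in the monomial
  \<open>m\<close>, the coefficient vanishes.
\<close>

definition mp_deriv :: "nat \<Rightarrow> 'a::comm_semiring_1 mpol \<Rightarrow> 'a mpol" where
  "mp_deriv i p = (\<Sum>m\<in>Poly_Mapping.keys p.
      Poly_Mapping.single (m - Poly_Mapping.single i 1)
        (of_nat (Poly_Mapping.lookup m i) * Poly_Mapping.lookup p m))"

definition jacobian :: "'a::comm_semiring_1 mpol vec \<Rightarrow> 'a mpol mat" where
  "jacobian H = mat (dim_vec H) (dim_vec H) (\<lambda>(i, j). mp_deriv j (H $ i))"

definition nilpotent_mat :: "'a::semiring_1 mat \<Rightarrow> bool" where
  "nilpotent_mat A \<longleftrightarrow> (\<exists>k. A ^\<^sub>m k = 0\<^sub>m (dim_row A) (dim_row A))"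

text \<open>
  The rank is taken over the fraction field of the polynomial ring in all the variables
  \<open>x\<^sub>0, x\<^sub>1, \<dots>\<close>.  This is an extension field of \<open>K(x\<^sub>0, \<dots>, x\<^sub>n\<^sub>-\<^sub>1)\<close>, and the rank of a matrix does not
  change under field extension.
\<close>

definition rk :: "'a::idom mpol mat \<Rightarrow> nat" where
  "rk A = vec_space.rank (dim_row A) (map_mat (\<lambda>p. Fract p 1) A)"

definition x_vec :: "nat \<Rightarrow> 'a::comm_semiring_1 mpol vec" where
  "x_vec n = vec n mp_var"

definition linear_form :: "'a::comm_semiring_1 vec \<Rightarrow> 'a mpol" where
  "linear_form c = map_vec mp_const c \<bullet> x_vec (dim_vec c)"

definition sum_of_powers_form :: "nat \<Rightarrow> nat \<Rightarrow> 'a::comm_semiring_1 mpol vec \<Rightarrow> bool" where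
  "sum_of_powers_form n d H \<longleftrightarrow>
    (\<exists>(N::nat) (b :: nat \<Rightarrow> 'a vec) (c :: nat \<Rightarrow> 'a vec) (e :: nat \<Rightarrow> nat).
      (\<forall>i\<in>{1..N}. b i \<in> carrier_vec n \<and> c i \<in> carrier_vec n \<and> e i \<in> {1..d}) \<and>
      (\<forall>i\<in>{1..N}. \<forall>j\<in>{1..i}. c j \<bullet> b i = 0) \<and>
      H = vec n (\<lambda>k. \<Sum>i=1..N. linear_form (c i) ^ e i * mp_const (b i $ k)))"

text \<open>The polynomial map \<open>S H(T x)\<close>; it is used with \<open>S = T\<^sup>-\<^sup>1\<close>.\<close>

definition lin_transform ::
    "'a::comm_semiring_1 mat \<Rightarrow> 'a mat \<Rightarrow> 'a mpol vec \<Rightarrow> 'a mpol vec" where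
  "lin_transform S T H = map_mat mp_const S *\<^sub>v
     map_vec (mp_eval mp_const (\<lambda>j. (map_mat mp_const T *\<^sub>v x_vec (dim_col T)) $ j)) H"

definition strictly_lower_triangular :: "'a::zero mat \<Rightarrow> bool" where
  "strictly_lower_triangular A \<longleftrightarrow>
    (\<forall>i < dim_row A. \<forall>j < dim_col A. i \<le> j \<longrightarrow> A $$ (i, j) = 0)"

definition lin_triangularizable :: "nat \<Rightarrow> 'a::comm_ring_1 mpol vec \<Rightarrow> bool" where
  "lin_triangularizable n H \<longleftrightarrow>
    (\<exists>T \<in> carrier_mat n n. \<exists>S \<in> carrier_mat n n. inverts_mat T S \<and> inverts_mat S T \<and>
       strictly_lower_triangular (jacobian (lin_transform S T H)))"

end

theory Submission
  imports Defs "HOL-Library.Function_Algebras"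
begin

text \<open>
  Let \<open>J\<close> be the Jacobian.  A linear change of coordinates makes it strictly lower triangular as soon
  as all products of sufficiently many of its coefficient matrices vanish, and a map with strictly
  lower triangular Jacobian is a sum of powers of linear forms because every monomial is a linear
  combination of such powers.

  If \<open>J\<close> has rank one, then \<open>J\<^sup>2 = 0\<close>, and the gradients of all linear combinations of the components
  are parallel, so their leading exponents are parallel for every monomial order.  One can choose the
  coordinates so that the nonconstant components have different degrees; a suitable weighted order
  then shows that no component depends on a variable whose own component is not constant.

  If \<open>J\<close> has rank two and the map is quadratic, then \<open>J\<^sup>3 = 0\<close>, and \<open>J = L + B x\<close> with a symmetric
  bilinear \<open>B\<close>.  Over the field of rational functions, polarizing \<open>J\<^sup>3 = 0\<close> shows that all \<open>B y\<close> annihilate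
  \<open>J\<^sup>2\<close>, and comparing coefficients shows that all products of four coefficient matrices vanish.
\<close>

text \<open>The identities J^2 = 0 and J^3 = 0 only say that certain sums of products of coefficient
  matrices vanish, one sum for each monomial. Triangularization needs every single product of a
  fixed length to vanish; closing this gap is the main work in both cases.

  In rank one, coordinates close it: each new component is constant or its variable occurs in no
  component, so J(x) J(y) = 0 for independent x and y. The plain degree order does not suffice,
  since the monomials of top degree may avoid the variable x_t whose occurrence is to be excluded;
  hence the adapted weight.

  In the quadratic case J^3 = 0 is an identity in x. It therefore holds at X + s y for the generic
  point X, where the rank hypothesis is available, and for arbitrary y. The values s = 1, -1, 2
  separate the mixed terms, at the price of dividing by 2 and 3. The number four arises because
  products of three coefficient matrices end in their common kernel and one more factor is needed to
  reach zero.

  The condition H(0) = 0 only serves to exclude the exponent 0 from the sum of powers.\<close>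

abbreviation lookup where "lookup \<equiv> Poly_Mapping.lookup"
abbreviation keys where "keys \<equiv> Poly_Mapping.keys"
abbreviation single where "single \<equiv> Poly_Mapping.single"

section \<open>Evaluation and substitution\<close>

lemma sum_single_lookup: "(\<Sum>m\<in>keys p. single m (lookup p m)) = p"
proof (rule poly_mapping_eqI)
  fix k
  show "lookup (\<Sum>m\<in>keys p. single m (lookup p m)) k = lookup p k"
    by (simp add: lookup_sum lookup_single "when_def" in_keys_iff)
qed

lemma mpol_additive_induct [case_names single add]:
  fixes p :: "'b \<Rightarrow>\<^sub>0 'a::comm_monoid_add"
  assumes single: "\<And>m c. P (single m c)" and add: "\<And>p q. P p \<Longrightarrow> P q \<Longrightarrow> P (p + q)"
  shows "P p"
proof -
  have "P (\<Sum>m\<in>A. single m (lookup p m))" if "finite A" for A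
    using that
  proof (induction A rule: finite_induct)
    case empty
    show ?case using single[of undefined 0] by simp
  qed (simp add: single add)
  from this[of "keys p"] show ?thesis by (simp add: sum_single_lookup)
qed

lemma mp_const_mult_single: "mp_const a * single m c = single m (a * c)"
  by (simp add: mp_const_def mult_single)

lemma lookup_mp_const_mult: "lookup (mp_const a * p) m = a * lookup p m"
proof (induction p rule: mpol_additive_induct)
  case (single m' c)
  show ?case by (simp add: mp_const_mult_single lookup_single "when_def")
qed (simp add: algebra_simps lookup_add)

lemma mp_const_hom: "comm_ring_hom (mp_const :: 'a::comm_ring_1 \<Rightarrow> 'a mpol)"
  by unfold_locales (auto simp: mp_const_def single_add mult_single)

interpretation mp_const: comm_ring_hom "mp_const :: 'a::comm_ring_1 \<Rightarrow> 'a mpol"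
  by (rule mp_const_hom)

definition mon_eval :: "(nat \<Rightarrow> 'b::comm_semiring_1) \<Rightarrow> (nat \<Rightarrow>\<^sub>0 nat) \<Rightarrow> 'b" where
  "mon_eval \<sigma> m = (\<Prod>i\<in>keys m. \<sigma> i ^ lookup m i)"

lemma mon_eval_superset:
  "finite A \<Longrightarrow> keys m \<subseteq> A \<Longrightarrow> mon_eval \<sigma> m = (\<Prod>i\<in>A. \<sigma> i ^ lookup m i)"
  unfolding mon_eval_def by (rule prod.mono_neutral_left) (auto simp: in_keys_iff)

lemma mon_eval_0 [simp]: "mon_eval \<sigma> 0 = 1"
  by (simp add: mon_eval_def)

lemma mon_eval_single [simp]: "mon_eval \<sigma> (single i k) = \<sigma> i ^ k"
  by (simp add: mon_eval_def)

lemma mon_eval_add: "mon_eval \<sigma> (m + m') = mon_eval \<sigma> m * mon_eval \<sigma> m'"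
proof -
  let ?A = "keys m \<union> keys m'"
  have "mon_eval \<sigma> (m + m') = (\<Prod>i\<in>?A. \<sigma> i ^ lookup (m + m') i)"
    by (rule mon_eval_superset) (auto simp: in_keys_iff lookup_add)
  also have "\<dots> = mon_eval \<sigma> m * mon_eval \<sigma> m'"
    by (simp add: mon_eval_superset[of ?A] lookup_add power_add prod.distrib)
  finally show ?thesis .
qed

context
  fixes \<phi> :: "'a::comm_ring_1 \<Rightarrow> 'b::comm_ring_1"
  assumes hom: "comm_ring_hom \<phi>"
begin

interpretation comm_ring_hom \<phi> by (rule hom)

lemma mp_eval_superset:
  assumes "finite A" "keys p \<subseteq> A"
  shows "mp_eval \<phi> \<sigma> p = (\<Sum>m\<in>A. \<phi> (lookup p m) * mon_eval \<sigma> m)"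
  unfolding mp_eval_def mon_eval_def[symmetric]
  by (rule sum.mono_neutral_left) (use assms in \<open>auto simp: in_keys_iff\<close>)

lemma mp_eval_single: "mp_eval \<phi> \<sigma> (single m c) = \<phi> c * mon_eval \<sigma> m"
  by (simp add: mp_eval_superset[of "{m}"])

lemma mp_eval_add: "mp_eval \<phi> \<sigma> (p + q) = mp_eval \<phi> \<sigma> p + mp_eval \<phi> \<sigma> q"
proof -
  let ?A = "keys p \<union> keys q"
  have "mp_eval \<phi> \<sigma> (p + q) = (\<Sum>m\<in>?A. \<phi> (lookup (p + q) m) * mon_eval \<sigma> m)"
    using keys_add[of p q] by (intro mp_eval_superset) auto
  then show ?thesis
    by (simp add: mp_eval_superset[of ?A] lookup_add hom_add sum.distrib algebra_simps)
qed

lemma mp_eval_mult: "mp_eval \<phi> \<sigma> (p * q) = mp_eval \<phi> \<sigma> p * mp_eval \<phi> \<sigma> q"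
proof (induction p rule: mpol_additive_induct)
  case (single m c)
  show ?case
  proof (induction q rule: mpol_additive_induct)
    case (single m' c')
    show ?case
      by (simp add: mult_single mp_eval_single mon_eval_add hom_mult algebra_simps)
  qed (simp add: mp_eval_add algebra_simps)
qed (simp add: mp_eval_add algebra_simps)

lemma mp_eval_hom: "comm_ring_hom (mp_eval \<phi> \<sigma>)"
proof -
  have one: "mp_eval \<phi> \<sigma> 1 = 1"
    using mp_eval_single[of \<sigma> 0 1] by simp
  have zero: "mp_eval \<phi> \<sigma> 0 = 0"
    by (simp add: mp_eval_def)
  show ?thesis
    by unfold_locales (simp_all add: mp_eval_add mp_eval_mult one zero)
qed

lemma mp_eval_const [simp]: "mp_eval \<phi> \<sigma> (mp_const c) = \<phi> c"
  by (simp add: mp_const_def mp_eval_single)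

lemma mp_eval_var [simp]: "mp_eval \<phi> \<sigma> (mp_var i) = \<sigma> i"
  by (simp add: mp_var_def mp_eval_single)

end

lemma id_hom: "comm_ring_hom (id :: 'a::comm_ring_1 \<Rightarrow> 'a)"
  by unfold_locales auto

abbreviation mp_subst :: "(nat \<Rightarrow> 'a::comm_ring_1 mpol) \<Rightarrow> 'a mpol \<Rightarrow> 'a mpol" where
  "mp_subst \<equiv> mp_eval mp_const"

interpretation mp_subst: comm_ring_hom "mp_subst \<sigma>" for \<sigma> :: "nat \<Rightarrow> 'a::comm_ring_1 mpol"
  by (rule mp_eval_hom[OF mp_const_hom])

lemmas mp_subst_const [simp] = mp_eval_const[OF mp_const_hom]
lemmas mp_subst_var [simp] = mp_eval_var[OF mp_const_hom]

lemma mon_eval_zero: "mon_eval (\<lambda>_. 0) m = (if m = 0 then 1 else 0 :: 'a::comm_ring_1)"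
proof (cases "m = 0")
  case False
  then obtain i where "i \<in> keys m" using keys_eq_empty[of m] by blast
  then show ?thesis using False
    by (auto simp: mon_eval_def in_keys_iff power_0_left intro!: prod_zero bexI[of _ i])
qed simp

text \<open>Turns the hypothesis H(0) = 0 into a condition on constant terms, and lets the constant
  term inherit the homomorphism laws of an evaluation.\<close>

lemma mp_eval_at_0: "mp_eval id (\<lambda>_. 0) p = lookup (p :: 'a::comm_ring_1 mpol) 0"
proof (induction p rule: mpol_additive_induct)
  case (single m c)
  show ?case
    unfolding mp_eval_single[OF id_hom] mon_eval_zero by (simp add: lookup_single)
qed (simp only: mp_eval_add[OF id_hom] lookup_add)

abbreviation ev0 :: "'a::comm_ring_1 mpol \<Rightarrow> 'a" where
  "ev0 \<equiv> \<lambda>p. lookup p 0"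

interpretation ev0: comm_ring_hom "ev0 :: 'a::comm_ring_1 mpol \<Rightarrow> 'a"
  using mp_eval_hom[OF id_hom, of "\<lambda>_. 0 :: 'a"] unfolding mp_eval_at_0[abs_def] .

section \<open>Derivatives\<close>

lemma lookup_mp_deriv:
  "lookup (mp_deriv i p) m = of_nat (Suc (lookup m i)) * lookup p (m + single i 1)"
proof -
  let ?e = "single i (1::nat)"
  \<comment> \<open>Truncated subtraction of the unit exponent can be undone on exponents that
    contain x_i; all others contribute the coefficient zero.\<close>
  have inv: "k = m + ?e" if "k - ?e = m" "lookup k i \<noteq> 0" for k
  proof (rule poly_mapping_eqI)
    fix j show "lookup k j = lookup (m + ?e) j"
      using that by (auto simp: lookup_add lookup_minus lookup_single "when_def")
  qed
  have "lookup (mp_deriv i p) m =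
      (\<Sum>k\<in>keys p. (of_nat (lookup k i) * lookup p k) when k - ?e = m)"
    by (simp only: mp_deriv_def lookup_sum lookup_single)
  also have "\<dots> = (\<Sum>k\<in>keys p. if k = m + ?e then of_nat (lookup k i) * lookup p k else 0)"
  proof (rule sum.cong)
    fix k assume "k \<in> keys p"
    show "(of_nat (lookup k i) * lookup p k when k - ?e = m) =
        (if k = m + ?e then of_nat (lookup k i) * lookup p k else 0)"
    proof (cases "lookup k i = 0")
      case True
      then have "k \<noteq> m + ?e" by (auto simp: lookup_add)
      with True show ?thesis by simp
    next
      case False
      have "m + ?e - ?e = m" by simp
      with inv[of k] False have "k - ?e = m \<longleftrightarrow> k = m + ?e" by blast
      then show ?thesis by (simp only: when_def)
    qed
  qed simp
  also have "\<dots> = of_nat (Suc (lookup m i)) * lookup p (m + ?e)"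
    by (simp add: lookup_add in_keys_iff)
  finally show ?thesis .
qed

lemma mp_deriv_add: "mp_deriv i (p + q) = mp_deriv i p + mp_deriv i q"
  by (rule poly_mapping_eqI) (simp add: lookup_mp_deriv lookup_add algebra_simps)

lemma mp_deriv_0 [simp]: "mp_deriv i 0 = 0"
  by (simp add: mp_deriv_def)

lemma mp_deriv_sum: "mp_deriv i (\<Sum>x\<in>A. f x) = (\<Sum>x\<in>A. mp_deriv i (f x))"
  by (induction A rule: infinite_finite_induct) (simp_all add: mp_deriv_add)

lemma mp_deriv_const_mult: "mp_deriv i (mp_const c * p) = mp_const c * mp_deriv i p"
  for c :: "'a::comm_ring_1"
  by (rule poly_mapping_eqI) (simp add: lookup_mp_deriv lookup_mp_const_mult mult.left_commute del: of_nat_Suc)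

lemma mp_deriv_commute: "mp_deriv i (mp_deriv j p) = mp_deriv j (mp_deriv i p)"
  by (rule poly_mapping_eqI)
    (cases "i = j", simp_all add: lookup_mp_deriv lookup_add lookup_single "when_def" ac_simps)

lemma mp_deriv_single:
  "mp_deriv i (single m c) = single (m - single i 1) (of_nat (lookup m i) * c)"
  by (cases "c = 0") (simp_all add: mp_deriv_def)

lemma mp_deriv_mult:
  "mp_deriv i (p * q) = mp_deriv i p * q + p * mp_deriv i (q :: 'a::comm_ring_1 mpol)"
proof (induction p rule: mpol_additive_induct)
  case (single m c)
  show ?case
  proof (induction q rule: mpol_additive_induct)
    case (single m' c')
    have *: "m - single i 1 + m' = m + m' - single i 1" if "lookup m i \<noteq> 0" for m m' :: "nat \<Rightarrow>\<^sub>0 nat"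
      using that by (intro poly_mapping_eqI) (auto simp: lookup_add lookup_minus lookup_single "when_def")
    have "mp_deriv i (single m c) * single m' c' =
        single (m + m' - single i 1) (of_nat (lookup m i) * (c * c'))"
      using *[of m m'] by (cases "lookup m i = 0") (simp_all add: mp_deriv_single mult_single ac_simps)
    moreover have "single m c * mp_deriv i (single m' c') =
        single (m + m' - single i 1) (of_nat (lookup m' i) * (c * c'))"
      using *[of m' m] by (cases "lookup m' i = 0") (simp_all add: mp_deriv_single mult_single ac_simps)
    ultimately show ?case
      by (simp only: mult_single mp_deriv_single lookup_add of_nat_add distrib_right single_add)
  qed (simp add: mp_deriv_add algebra_simps)
qed (simp add: mp_deriv_add algebra_simps)

lemma mp_deriv_const [simp]: "mp_deriv i (mp_const c) = 0"
  by (simp add: mp_const_def mp_deriv_single)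

lemma mp_deriv_var: "mp_deriv i (mp_var j) = (if i = j then 1 else 0)"
  by (auto simp: mp_var_def mp_deriv_single lookup_single)

text \<open>The operator x_i d/dx_i is diagonal on monomials, with the exponent of x_i as
  eigenvalue. Unlike the plain derivative it does not move monomials, so supports and leading
  exponents can be compared directly.\<close>

lemma lookup_var_mult_deriv:
  "lookup (mp_var i * mp_deriv i p) m = of_nat (lookup m i) * lookup (p :: 'a::comm_ring_1 mpol) m"
proof (induction p rule: mpol_additive_induct)
  case (single m' c)
  have "single i 1 + (m' - single i 1) = m'" if "lookup m' i \<noteq> 0"
    using that by (intro poly_mapping_eqI) (auto simp: lookup_add lookup_minus lookup_single "when_def")
  then show ?case
    by (cases "lookup m' i = 0") (auto simp: mp_var_def mp_deriv_single mult_single lookup_single "when_def")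
qed (simp add: mp_deriv_add algebra_simps lookup_add)

lemma monom_degree_superset:
  "finite A \<Longrightarrow> keys m \<subseteq> A \<Longrightarrow> monom_degree m = (\<Sum>i\<in>A. lookup m i)"
  unfolding monom_degree_def by (rule sum.mono_neutral_left) (auto simp: in_keys_iff)

lemma monom_degree_add: "monom_degree (m + m') = monom_degree m + monom_degree m'"
proof -
  let ?A = "keys m \<union> keys m'"
  have "monom_degree (m + m') = (\<Sum>i\<in>?A. lookup (m + m') i)"
    by (rule monom_degree_superset) (auto simp: in_keys_iff lookup_add)
  then show ?thesis
    by (simp add: monom_degree_superset[of ?A] lookup_add sum.distrib)
qed

lemma monom_degree_single [simp]: "monom_degree (single i k) = k"
  by (simp add: monom_degree_def)

lemma monom_degree_0 [simp]: "monom_degree 0 = 0"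
  by (simp add: monom_degree_def)

lemma monom_degree_eq_0_iff [simp]: "monom_degree m = 0 \<longleftrightarrow> m = 0"
  by (auto simp: monom_degree_def in_keys_iff intro: poly_mapping_eqI)

lemma lookup_le_monom_degree: "lookup m i \<le> monom_degree m"
  by (cases "i \<in> keys m") (auto simp: monom_degree_def in_keys_iff intro: member_le_sum)

lemma monom_diff_add: "lookup m i \<noteq> 0 \<Longrightarrow> m - single i 1 + single i (1::nat) = m"
  by (intro poly_mapping_eqI) (auto simp: lookup_add lookup_minus lookup_single when_def)

section \<open>Variables\<close>

lemma mp_in_add: "p \<in> mp_in n \<Longrightarrow> q \<in> mp_in n \<Longrightarrow> p + q \<in> mp_in n"
  using keys_add[of p q] by (fastforce simp: mp_in_def)

lemma mp_in_0: "0 \<in> mp_in n"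
  by (simp add: mp_in_def)

lemma mp_in_single: "keys m \<subseteq> {..<n} \<Longrightarrow> single m c \<in> mp_in n"
  by (simp add: mp_in_def)

lemma mp_in_const: "mp_const c \<in> mp_in n"
  by (simp add: mp_const_def mp_in_single)

lemma mp_in_var: "i < n \<Longrightarrow> mp_var i \<in> mp_in n"
  by (simp add: mp_var_def mp_in_single)

lemma mp_in_sum: "(\<And>x. x \<in> A \<Longrightarrow> f x \<in> mp_in n) \<Longrightarrow> (\<Sum>x\<in>A. f x) \<in> mp_in n"
  by (induction A rule: infinite_finite_induct) (auto simp: mp_in_0 mp_in_add)

lemma mp_in_mult:
  fixes p q :: "'a::semiring_0 mpol"
  assumes "p \<in> mp_in n" "q \<in> mp_in n"
  shows "p * q \<in> mp_in n"
  unfolding mp_in_def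
proof (intro CollectI ballI)
  fix m assume "m \<in> keys (p * q)"
  then obtain a b where m: "m = a + b" "a \<in> keys p" "b \<in> keys q"
    using keys_mult[of p q] by auto
  with assms have "keys a \<subseteq> {..<n}" "keys b \<subseteq> {..<n}" by (auto simp: mp_in_def)
  then show "keys m \<subseteq> {..<n}" using keys_add[of a b] m(1) by auto
qed

text \<open>Horner-style induction: identities about substitutions and derivatives reduce to
  constants, sums and multiplication by one variable.\<close>

lemma mp_in_induct [consumes 1, case_names const add var]:
  fixes p :: "'a::comm_ring_1 mpol"
  assumes "p \<in> mp_in n"
    and const: "\<And>c. P (mp_const c)"
    and add: "\<And>p q. P p \<Longrightarrow> P q \<Longrightarrow> P (p + q)"
    and var: "\<And>i p. i < n \<Longrightarrow> P p \<Longrightarrow> P (mp_var i * p)"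
  shows "P p"
proof -
  have single: "P (single m c)" if "keys m \<subseteq> {..<n}" for m c
    using that
  proof (induction "monom_degree m" arbitrary: m)
    case 0
    then show ?case using const[of c] by (simp add: mp_const_def)
  next
    case (Suc d)
    then obtain i where i: "i \<in> keys m" by (metis keys_eq_empty monom_degree_eq_0_iff all_not_in_conv Zero_not_Suc)
    let ?m = "m - single i 1"
    have m: "?m + single i 1 = m" using i by (intro monom_diff_add) (simp add: in_keys_iff)
    then have "d = monom_degree ?m" using Suc(2) monom_degree_add[of ?m "single i 1"] by simp
    moreover have "keys ?m \<subseteq> keys m" by (auto simp: in_keys_iff lookup_minus)
    ultimately have "P (mp_var i * single ?m c)"
      using Suc(1,3) i by (intro var) blast+
    then show ?case using m by (simp add: mp_var_def mult_single add.commute)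
  qed
  have "P (\<Sum>m\<in>A. single m (lookup p m))" if "finite A" "A \<subseteq> keys p" for A
    using that
  proof (induction A rule: finite_induct)
    case empty
    show ?case using const[of 0] by simp
  next
    case (insert m A)
    then show ?case using single[of m] assms(1) by (auto simp: mp_in_def intro!: add)
  qed
  from this[of "keys p"] show ?thesis by (simp add: sum_single_lookup)
qed

lemma mp_in_exists: "\<exists>n. p \<in> mp_in n"
proof -
  have "finite (\<Union> (keys ` keys p))" by auto
  then obtain n where "\<forall>i \<in> \<Union> (keys ` keys p). i < n" using finite_nat_set_iff_bounded by blast
  then show ?thesis by (intro exI[of _ n]) (auto simp: mp_in_def)
qed

lemma mp_in_deriv:
  assumes "p \<in> mp_in n"
  shows "mp_deriv i p \<in> mp_in n"
  unfolding mp_in_def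
proof (intro CollectI ballI)
  fix m assume "m \<in> keys (mp_deriv i p)"
  then have "m + single i 1 \<in> keys p" unfolding in_keys_iff lookup_mp_deriv by auto
  then have "keys (m + single i 1) \<subseteq> {..<n}" using assms by (simp add: mp_in_def)
  moreover have "keys m \<subseteq> keys (m + single i 1)" by (auto simp: in_keys_iff lookup_add)
  ultimately show "keys m \<subseteq> {..<n}" by blast
qed

lemma mp_in_subst:
  assumes "p \<in> mp_in n" "\<And>i. i < n \<Longrightarrow> \<sigma> i \<in> mp_in k"
  shows "mp_subst \<sigma> p \<in> mp_in k"
  using assms(1)
  by (induction rule: mp_in_induct)
    (auto simp: mp_subst.hom_add mp_subst.hom_mult mp_in_const assms(2) intro: mp_in_add mp_in_mult)

lemma mp_subst_cong:
  assumes "p \<in> mp_in n" "\<And>i. i < n \<Longrightarrow> \<sigma> i = \<tau> i"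
  shows "mp_subst \<sigma> p = mp_subst \<tau> p"
  using assms(1)
  by (induction rule: mp_in_induct) (auto simp: mp_subst.hom_add mp_subst.hom_mult assms(2))

lemma mp_subst_id:
  assumes "p \<in> mp_in n" "\<And>i. i < n \<Longrightarrow> \<sigma> i = mp_var i"
  shows "mp_subst \<sigma> p = p"
  using assms(1)
  by (induction rule: mp_in_induct) (auto simp: mp_subst.hom_add mp_subst.hom_mult assms(2))

lemma mp_subst_subst: "mp_subst \<tau> (mp_subst \<sigma> p) = mp_subst (\<lambda>i. mp_subst \<tau> (\<sigma> i)) p"
proof -
  obtain n where "p \<in> mp_in n" using mp_in_exists by blast
  then show ?thesis
    by (induction rule: mp_in_induct) (auto simp: mp_subst.hom_add mp_subst.hom_mult)
qed

text \<open>This is the chain rule; in the induction, the factor \<open>mp_var k\<close> affects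
  only the summand j = k through the product rule.\<close>

lemma mp_deriv_subst:
  assumes "p \<in> mp_in n"
  shows "mp_deriv i (mp_subst \<sigma> p) = (\<Sum>j<n. mp_subst \<sigma> (mp_deriv j p) * mp_deriv i (\<sigma> j))"
  using assms
proof (induction rule: mp_in_induct)
  case (var k p)
  have "(\<Sum>j<n. mp_subst \<sigma> (mp_deriv j (mp_var k * p)) * mp_deriv i (\<sigma> j)) =
      (\<Sum>j<n. (if j = k then mp_subst \<sigma> p * mp_deriv i (\<sigma> j) else 0)
        + \<sigma> k * (mp_subst \<sigma> (mp_deriv j p) * mp_deriv i (\<sigma> j)))"
    by (rule sum.cong) (auto simp: mp_deriv_mult mp_deriv_var mp_subst.hom_add mp_subst.hom_mult algebra_simps)
  also have "\<dots> = mp_subst \<sigma> p * mp_deriv i (\<sigma> k) + \<sigma> k * mp_deriv i (mp_subst \<sigma> p)"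
    using var by (simp add: sum.distrib sum_distrib_left)
  finally show ?case by (simp add: mp_subst.hom_mult mp_deriv_mult algebra_simps)
qed (auto simp: mp_subst.hom_add mp_deriv_add sum.distrib algebra_simps)

lemma mp_in_if_deriv_0:
  fixes p :: "'a::{idom,ring_char_0} mpol"
  assumes "p \<in> mp_in n" "\<And>i. k \<le> i \<Longrightarrow> i < n \<Longrightarrow> mp_deriv i p = 0"
  shows "p \<in> mp_in k"
  unfolding mp_in_def
proof (intro CollectI ballI subsetI, rule ccontr)
  fix m i assume m: "m \<in> keys p" and i: "i \<in> keys m" and "i \<notin> {..<k}"
  moreover have "i < n" using assms(1) m i by (auto simp: mp_in_def)
  ultimately have "mp_var i * mp_deriv i p = 0" using assms(2)[of i] by simp
  then have "of_nat (lookup m i) * lookup p m = 0" by (metis lookup_var_mult_deriv lookup_zero)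
  then show False using m i by (simp add: in_keys_iff)
qed

section \<open>Degrees\<close>

lemma mp_degree_le_iff: "mp_degree p \<le> d \<longleftrightarrow> (\<forall>m\<in>keys p. monom_degree m \<le> d)"
  by (auto simp: mp_degree_def)

lemma mp_degree_leI: "(\<And>m. m \<in> keys p \<Longrightarrow> monom_degree m \<le> d) \<Longrightarrow> mp_degree p \<le> d"
  by (simp add: mp_degree_le_iff)

lemma monom_degree_le: "m \<in> keys p \<Longrightarrow> monom_degree m \<le> mp_degree p"
  using mp_degree_le_iff by blast

lemma mp_degree_0 [simp]: "mp_degree 0 = 0"
  by (simp add: mp_degree_def)

lemma mp_degree_add_le: "mp_degree p \<le> d \<Longrightarrow> mp_degree q \<le> d \<Longrightarrow> mp_degree (p + q) \<le> d"
  using keys_add[of p q] by (fastforce simp: mp_degree_le_iff)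

lemma mp_degree_sum_le: "(\<And>x. x \<in> A \<Longrightarrow> mp_degree (f x) \<le> d) \<Longrightarrow> mp_degree (\<Sum>x\<in>A. f x) \<le> d"
  by (induction A rule: infinite_finite_induct) (auto intro: mp_degree_add_le)

lemma mp_degree_mult_le:
  fixes p q :: "'a::semiring_0 mpol"
  assumes "mp_degree p \<le> d" "mp_degree q \<le> e"
  shows "mp_degree (p * q) \<le> d + e"
proof (rule mp_degree_leI)
  fix m assume "m \<in> keys (p * q)"
  then obtain a b where "m = a + b" "a \<in> keys p" "b \<in> keys q"
    using keys_mult[of p q] by auto
  then show "monom_degree m \<le> d + e"
    using assms by (fastforce simp: monom_degree_add mp_degree_le_iff intro!: add_mono)
qed

lemma mp_degree_const [simp]: "mp_degree (mp_const c) = 0"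
  using mp_degree_le_iff[of "mp_const c" 0] by (simp add: mp_const_def)

lemma mp_degree_const_mult_le:
  fixes p :: "'a::semiring_0 mpol"
  shows "mp_degree p \<le> d \<Longrightarrow> mp_degree (mp_const c * p) \<le> d"
  using mp_degree_mult_le[of "mp_const c" 0 p d] by simp

lemma mp_degree_var_le: "mp_degree (mp_var i) \<le> 1"
  by (simp add: mp_degree_le_iff mp_var_def)

lemma mp_degree_power_le:
  fixes p :: "'a::comm_semiring_1 mpol"
  shows "mp_degree p \<le> d \<Longrightarrow> mp_degree (p ^ k) \<le> k * d"
proof (induction k)
  case 0
  show ?case using mp_degree_const[of "1::'a"] by (simp add: mp_const_def)
qed (auto intro: mp_degree_mult_le)

lemma mp_degree_prod_le:
  fixes f :: "'b \<Rightarrow> 'a::comm_semiring_1 mpol"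
  shows "(\<And>x. x \<in> A \<Longrightarrow> mp_degree (f x) \<le> g x) \<Longrightarrow> mp_degree (\<Prod>x\<in>A. f x) \<le> (\<Sum>x\<in>A. g x)"
proof (induction A rule: infinite_finite_induct)
  case (insert x A)
  then show ?case by (auto intro!: mp_degree_mult_le)
qed (use mp_degree_const[of "1::'a"] in \<open>simp_all add: mp_const_def\<close>)

lemma mp_degree_subst_le:
  assumes "\<And>i. mp_degree (\<sigma> i) \<le> 1"
  shows "mp_degree (mp_subst \<sigma> p) \<le> mp_degree p"
  unfolding mp_eval_def
proof (rule mp_degree_sum_le)
  fix m assume "m \<in> keys p"
  have "mp_degree (\<sigma> i ^ lookup m i) \<le> lookup m i" for i
    using mp_degree_power_le[OF assms, of i "lookup m i"] by simp
  then have "mp_degree (\<Prod>i\<in>keys m. \<sigma> i ^ lookup m i) \<le> monom_degree m"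
    unfolding monom_degree_def by (rule mp_degree_prod_le)
  also have "\<dots> \<le> mp_degree p" by (rule monom_degree_le) fact
  finally show "mp_degree (mp_const (lookup p m) * (\<Prod>i\<in>keys m. \<sigma> i ^ lookup m i)) \<le> mp_degree p"
    by (rule mp_degree_const_mult_le)
qed

lemma mp_deriv_eq_0_if_degree_0: "mp_degree p = 0 \<Longrightarrow> mp_deriv i p = 0"
proof (rule poly_mapping_eqI)
  fix m assume "mp_degree p = 0"
  then have "m + single i 1 \<notin> keys p"
    using monom_degree_le[of "m + single i 1" p] by (auto simp: monom_degree_add)
  then show "lookup (mp_deriv i p) m = lookup 0 m" by (simp add: lookup_mp_deriv in_keys_iff)
qed

section \<open>Linear substitutions\<close>

text \<open>The coefficients form a total function of which only the first \<open>n\<close> values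
  matter, so that a single coefficient can be changed by a function update.\<close>

definition lform :: "nat \<Rightarrow> (nat \<Rightarrow> 'a::comm_ring_1) \<Rightarrow> 'a mpol" where
  "lform n c = (\<Sum>k<n. mp_const (c k) * mp_var k)"

definition lin_sub :: "'a::comm_ring_1 mat \<Rightarrow> nat \<Rightarrow> 'a mpol" where
  "lin_sub T j = lform (dim_col T) (\<lambda>k. T $$ (j, k))"

lemma linear_form_eq_lform: "linear_form c = lform (dim_vec c) (\<lambda>k. c $ k)"
  by (simp add: linear_form_def lform_def scalar_prod_def x_vec_def atLeast0LessThan)

lemma mp_degree_lform: "mp_degree (lform n c) \<le> 1"
  unfolding lform_def by (intro mp_degree_sum_le mp_degree_const_mult_le mp_degree_var_le)

lemma mp_in_lform: "n \<le> k \<Longrightarrow> lform n c \<in> mp_in k"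
  unfolding lform_def by (intro mp_in_sum mp_in_mult mp_in_const mp_in_var) auto

lemma mp_deriv_lform: "j < n \<Longrightarrow> mp_deriv j (lform n c) = mp_const (c j)"
  by (simp add: lform_def mp_deriv_sum mp_deriv_const_mult mp_deriv_var if_distrib sum.delta cong: if_cong)

lemma mp_subst_lin_sub_lform:
  assumes "S \<in> carrier_mat n n"
  shows "mp_subst (lin_sub S) (lform n c) = lform n (\<lambda>l. \<Sum>k<n. c k * S $$ (k, l))"
proof -
  have "mp_subst (lin_sub S) (lform n c)
      = (\<Sum>k<n. \<Sum>l<n. mp_const (c k) * (mp_const (S $$ (k, l)) * mp_var l))"
    using assms by (simp add: lform_def lin_sub_def mp_subst.hom_sum mp_subst.hom_mult sum_distrib_left)
  also have "\<dots> = (\<Sum>l<n. \<Sum>k<n. mp_const (c k) * (mp_const (S $$ (k, l)) * mp_var l))"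
    by (rule sum.swap)
  also have "\<dots> = lform n (\<lambda>l. \<Sum>k<n. c k * S $$ (k, l))"
    by (simp add: lform_def mp_const.hom_sum mp_const.hom_mult sum_distrib_right mult.assoc)
  finally show ?thesis .
qed

lemma index_mult_eq_sum:
  assumes "A \<in> carrier_mat n k" "B \<in> carrier_mat k l" "i < n" "j < l"
  shows "(A * B) $$ (i, j) = (\<Sum>h<k. A $$ (i, h) * B $$ (h, j))"
  using assms by (simp add: scalar_prod_def atLeast0LessThan)

text \<open>Substituting S x into T x gives (T S) x, whence the order of the factors in the
  hypothesis.\<close>

lemma mp_subst_lin_sub_inverse:
  assumes "S \<in> carrier_mat n n" "T \<in> carrier_mat n n" "T * S = 1\<^sub>m n" "p \<in> mp_in n"
  shows "mp_subst (lin_sub S) (mp_subst (lin_sub T) p) = p"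
  unfolding mp_subst_subst
proof (rule mp_subst_id[OF assms(4)])
  fix j assume j: "j < n"
  have "mp_subst (lin_sub S) (lin_sub T j) = lform n (\<lambda>l. \<Sum>h<n. T $$ (j, h) * S $$ (h, l))"
    using assms(1,2) by (simp add: lin_sub_def[of T] mp_subst_lin_sub_lform)
  also have "\<dots> = lform n (\<lambda>l. (T * S) $$ (j, l))"
    unfolding lform_def
    by (rule sum.cong) (simp_all add: index_mult_eq_sum[OF assms(2,1) j] del: index_mult_mat)
  also have "\<dots> = (\<Sum>l<n. if l = j then mp_var l else 0)"
    unfolding lform_def by (rule sum.cong) (auto simp: assms(3) j)
  also have "\<dots> = mp_var j" using j by simp
  finally show "mp_subst (lin_sub S) (lin_sub T j) = mp_var j" .
qed

lemma lin_transform_index: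
  assumes "S \<in> carrier_mat n n" "T \<in> carrier_mat n n" "H \<in> carrier_vec n"
    "\<forall>k<n. H $ k \<in> mp_in n" "i < n"
  shows "lin_transform S T H $ i = mp_subst (lin_sub T) (\<Sum>k<n. mp_const (S $$ (i, k)) * H $ k)"
proof -
  let ?\<sigma> = "\<lambda>j. (map_mat mp_const T *\<^sub>v x_vec (dim_col T)) $ j"
  have \<sigma>: "?\<sigma> j = lin_sub T j" if "j < n" for j
    using that assms(2)
    by (simp add: lin_sub_def lform_def x_vec_def scalar_prod_def atLeast0LessThan)
  have "mp_subst ?\<sigma> (H $ k) = mp_subst (lin_sub T) (H $ k)" if "k < n" for k
    using assms(4) that \<sigma> by (intro mp_subst_cong) auto
  then show ?thesis
    using assms
    by (simp add: lin_transform_def scalar_prod_def atLeast0LessThan mp_subst.hom_sum mp_subst.hom_mult)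
qed

text \<open>The Jacobian of S H(T x) is S J T evaluated at T x. As a substitution maps zero to zero,
  it is enough to demand the zeroes in S J T itself, which is linear in the coefficients of
  J.\<close>

definition triangularizing :: "nat \<Rightarrow> 'a::comm_ring_1 mat \<Rightarrow> 'a mat \<Rightarrow> 'a mpol vec \<Rightarrow> bool" where
  "triangularizing n S T H \<longleftrightarrow> S \<in> carrier_mat n n \<and> T \<in> carrier_mat n n \<and>
    S * T = 1\<^sub>m n \<and> T * S = 1\<^sub>m n \<and>
    (\<forall>j<n. \<forall>i\<le>j. (\<Sum>k<n. \<Sum>l<n. mp_const (S $$ (i, k) * T $$ (l, j)) * mp_deriv l (H $ k)) = 0)"

lemma mp_deriv_subst_lin_sub:
  assumes "T \<in> carrier_mat n n" "p \<in> mp_in n" "j < n"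
  shows "mp_deriv j (mp_subst (lin_sub T) p)
    = mp_subst (lin_sub T) (\<Sum>l<n. mp_const (T $$ (l, j)) * mp_deriv l p)"
  using assms
  by (simp add: mp_deriv_subst lin_sub_def mp_deriv_lform mp_subst.hom_sum mp_subst.hom_mult mult.commute)

lemma mp_in_row:
  assumes "\<forall>k<n. H $ k \<in> mp_in n"
  shows "(\<Sum>k<n. mp_const (c k) * H $ k) \<in> mp_in n"
  using assms by (intro mp_in_sum mp_in_mult mp_in_const) auto

lemma row_combinations_inverse:
  fixes H :: "'a::comm_ring_1 mpol vec"
  assumes "S \<in> carrier_mat n n" "T \<in> carrier_mat n n" "T * S = 1\<^sub>m n" "k < n"
  shows "(\<Sum>i<n. mp_const (T $$ (k, i)) * (\<Sum>l<n. mp_const (S $$ (i, l)) * H $ l)) = H $ k"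
proof -
  have "(\<Sum>i<n. mp_const (T $$ (k, i)) * (\<Sum>l<n. mp_const (S $$ (i, l)) * H $ l))
      = (\<Sum>i<n. \<Sum>l<n. mp_const (T $$ (k, i) * S $$ (i, l)) * H $ l)"
    by (simp add: sum_distrib_left mp_const.hom_mult mult.assoc)
  also have "\<dots> = (\<Sum>l<n. mp_const ((T * S) $$ (k, l)) * H $ l)"
    by (subst sum.swap, rule sum.cong)
      (simp_all add: index_mult_eq_sum[OF assms(2,1,4)] mp_const.hom_sum sum_distrib_right del: index_mult_mat)
  also have "\<dots> = (\<Sum>l<n. if l = k then H $ l else 0)"
    using assms(4) by (intro sum.cong) (auto simp: assms(3))
  finally show ?thesis using assms(4) by simp
qed

lemma row_combinations_parallel:
  fixes H :: "'a::comm_ring_1 mpol vec"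
  assumes "\<And>a b. a < n \<Longrightarrow> b < n \<Longrightarrow> mp_deriv i (H $ a) * mp_deriv j (H $ b) = mp_deriv j (H $ a) * mp_deriv i (H $ b)"
  shows "mp_deriv i (\<Sum>k<n. mp_const (c k) * H $ k) * mp_deriv j (\<Sum>k<n. mp_const (c' k) * H $ k)
    = mp_deriv j (\<Sum>k<n. mp_const (c k) * H $ k) * mp_deriv i (\<Sum>k<n. mp_const (c' k) * H $ k)"
  unfolding mp_deriv_sum mp_deriv_const_mult sum_product
  using assms by (intro sum.cong) (auto simp: mult.left_commute mult.assoc)

lemma mp_deriv_row_subst:
  assumes "T \<in> carrier_mat n n" "\<forall>k<n. H $ k \<in> mp_in n" "j < n"
  shows "mp_deriv j (mp_subst (lin_sub T) (\<Sum>k<n. mp_const (c k) * H $ k))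
    = mp_subst (lin_sub T) (\<Sum>k<n. \<Sum>l<n. mp_const (c k * T $$ (l, j)) * mp_deriv l (H $ k))"
proof -
  have "(\<Sum>l<n. mp_const (T $$ (l, j)) * mp_deriv l (\<Sum>k<n. mp_const (c k) * H $ k))
      = (\<Sum>l<n. \<Sum>k<n. mp_const (c k * T $$ (l, j)) * mp_deriv l (H $ k))"
    by (simp add: mp_deriv_sum mp_deriv_const_mult sum_distrib_left mp_const.hom_mult ac_simps)
  also have "\<dots> = (\<Sum>k<n. \<Sum>l<n. mp_const (c k * T $$ (l, j)) * mp_deriv l (H $ k))"
    by (rule sum.swap)
  finally show ?thesis
    by (simp only: mp_deriv_subst_lin_sub[OF assms(1) mp_in_row[OF assms(2)] assms(3)])
qed

lemma lin_triangularizable_if_triangularizing: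
  assumes H: "H \<in> carrier_vec n" "\<forall>k<n. H $ k \<in> mp_in n" and ST: "triangularizing n S T H"
  shows "lin_triangularizable n H"
proof -
  from ST have c: "S \<in> carrier_mat n n" "T \<in> carrier_mat n n" "S * T = 1\<^sub>m n" "T * S = 1\<^sub>m n"
    by (auto simp: triangularizing_def)
  have dim: "dim_vec (lin_transform S T H) = n"
    using c by (simp add: lin_transform_def)
  have "mp_deriv j (lin_transform S T H $ i) = 0" if "i \<le> j" "j < n" for i j
    using that ST c H
    by (simp add: lin_transform_index mp_deriv_row_subst triangularizing_def)
  then have "strictly_lower_triangular (jacobian (lin_transform S T H))"
    by (auto simp: strictly_lower_triangular_def jacobian_def dim)
  then show ?thesis
    using c unfolding lin_triangularizable_def inverts_mat_def
    by (intro bexI[of _ T] bexI[of _ S]) auto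
qed

section \<open>Sums of powers of linear forms\<close>

text \<open>The two sets record what the final form has to obey: \<open>C\<close> restricts the
  coefficient vectors, which will yield the orthogonality relations, and \<open>E\<close> restricts
  the exponents.\<close>

inductive_set power_sums :: "nat \<Rightarrow> (nat \<Rightarrow> 'a::comm_ring_1) set \<Rightarrow> nat set \<Rightarrow> 'a mpol set"
  for n C E where
  zero: "0 \<in> power_sums n C E"
| step: "p \<in> power_sums n C E \<Longrightarrow> c \<in> C \<Longrightarrow> e \<in> E \<Longrightarrow> mp_const b * lform n c ^ e + p \<in> power_sums n C E"

lemma power_sums_power: "c \<in> C \<Longrightarrow> e \<in> E \<Longrightarrow> mp_const b * lform n c ^ e \<in> power_sums n C E"
  using power_sums.step[OF power_sums.zero, of c C e E b n] by simp

lemma power_sums_add: "p \<in> power_sums n C E \<Longrightarrow> q \<in> power_sums n C E \<Longrightarrow> p + q \<in> power_sums n C E"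
  by (induction rule: power_sums.induct) (auto simp: add.assoc intro: power_sums.step)

lemma power_sums_scale: "p \<in> power_sums n C E \<Longrightarrow> mp_const a * p \<in> power_sums n C E"
proof (induction rule: power_sums.induct)
  case (step p c e b)
  then have "mp_const (a * b) * lform n c ^ e + mp_const a * p \<in> power_sums n C E"
    by (intro power_sums.step)
  then show ?case by (simp add: mp_const.hom_mult algebra_simps)
qed (simp add: power_sums.zero)

lemma power_sums_sum:
  "(\<And>x. x \<in> A \<Longrightarrow> f x \<in> power_sums n C E) \<Longrightarrow> (\<Sum>x\<in>A. f x) \<in> power_sums n C E"
  by (induction A rule: infinite_finite_induct) (auto intro: power_sums.zero power_sums_add)

lemma power_sums_mono: "p \<in> power_sums n C E \<Longrightarrow> E \<subseteq> E' \<Longrightarrow> p \<in> power_sums n C E'"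
  by (induction rule: power_sums.induct) (auto intro: power_sums.intros)

lemma power_sums_list:
  "p \<in> power_sums n C E \<Longrightarrow> \<exists>xs. p = (\<Sum>(b, c, e)\<leftarrow>xs. mp_const b * lform n c ^ e) \<and>
     (\<forall>(b, c, e)\<in>set xs. c \<in> C \<and> e \<in> E)"
proof (induction rule: power_sums.induct)
  case zero
  show ?case by (intro exI[of _ "[]"]) simp
next
  case (step p c e b)
  then obtain xs where "p = (\<Sum>(b, c, e)\<leftarrow>xs. mp_const b * lform n c ^ e)"
    "\<forall>(b, c, e)\<in>set xs. c \<in> C \<and> e \<in> E" by blast
  with step.hyps show ?case by (intro exI[of _ "(b, c, e) # xs"]) simp
qed

text \<open>The differences \<open>f(2s) - 2\<^sup>N f(s)\<close> eliminate the top coefficient of \<open>f\<close>.\<close>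

lemma coefficients_in_subspace:
  fixes a :: "nat \<Rightarrow> 'a::field_char_0 mpol"
  assumes add: "\<And>p q. p \<in> W \<Longrightarrow> q \<in> W \<Longrightarrow> p + q \<in> W"
    and scale: "\<And>c p. p \<in> W \<Longrightarrow> mp_const c * p \<in> W"
    and f: "\<And>s. (\<Sum>k\<le>N. mp_const (of_nat s ^ k) * a k) \<in> W"
  shows "k \<le> N \<Longrightarrow> a k \<in> W"
  using f
proof (induction N arbitrary: a k)
  case 0
  then show ?case using "0.prems"(2)[of 1] by simp
next
  case (Suc N)
  let ?f = "\<lambda>s. \<Sum>k\<le>Suc N. mp_const (of_nat s ^ k) * a k"
  let ?r = "\<lambda>k. 2 ^ k - 2 ^ Suc N :: 'a"
  have lower: "a k \<in> W" if "k \<le> N" for k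
  proof -
    have "(\<Sum>k\<le>N. mp_const (of_nat s ^ k) * (mp_const (?r k) * a k)) \<in> W" for s
    proof -
      have "?f (2 * s) + mp_const (- (2 ^ Suc N)) * ?f s \<in> W"
        by (intro add scale Suc.prems)
      also have "?f (2 * s) + mp_const (- (2 ^ Suc N)) * ?f s
          = (\<Sum>k\<le>Suc N. mp_const (of_nat s ^ k) * (mp_const (?r k) * a k))"
        unfolding sum_distrib_left sum.distrib[symmetric]
        by (rule sum.cong) (simp_all add: power_mult_distrib mp_const.hom_mult mp_const.hom_minus
            mp_const.hom_uminus algebra_simps)
      finally show ?thesis by simp
    qed
    then have "mp_const (?r k) * a k \<in> W" by (rule Suc.IH[OF that])
    then have "mp_const (inverse (?r k)) * (mp_const (?r k) * a k) \<in> W" by (rule scale)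
    moreover have "?r k \<noteq> 0"
      using that power_inject_exp[of "2::nat" k "Suc N"] of_nat_eq_iff[of "2 ^ k" "2 ^ Suc N", where ?'a='a]
      by simp
    ultimately show ?thesis by (simp add: mult.assoc[symmetric] mp_const.hom_mult[symmetric])
  qed
  show ?case
  proof (cases "k \<le> N")
    case False
    then have k: "k = Suc N" using Suc.prems(1) by simp
    have "(\<Sum>k\<in>A. mp_const (- 1) * a k) \<in> W" if "A \<subseteq> {..N}" "finite A" for A
      using that(2,1)
    proof (induction A rule: finite_induct)
      case empty
      show ?case using scale[OF lower[of 0], of 0] by simp
    qed (auto intro!: add scale lower)
    from this[of "{..N}"] have "?f 1 + (\<Sum>k\<le>N. mp_const (- 1) * a k) \<in> W"
      by (intro add Suc.prems(2)) auto
    also have "?f 1 + (\<Sum>k\<le>N. mp_const (- 1) * a k) = a k"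
      by (simp add: k sum_negf mp_const.hom_uminus)
    finally show ?thesis .
  qed (rule lower)
qed

text \<open>The powers (l + s x_j)^(e+1) belong to the span for all s, hence so does the coefficient
  of s in their binomial expansion, which is (e+1) x_j l^e. The closure condition on
  \<open>C\<close> admits the shifted forms.\<close>

lemma var_mult_power_sums:
  fixes p :: "'a::field_char_0 mpol"
  assumes "p \<in> power_sums n C {e}" "j < n"
    and C: "\<And>c s. c \<in> C \<Longrightarrow> c(j := c j + s) \<in> C"
  shows "mp_var j * p \<in> power_sums n C {Suc e}"
  using assms(1)
proof (induction rule: power_sums.induct)
  case (step p c e' b)
  let ?W = "power_sums n C {Suc e}"
  let ?l = "lform n c"
  let ?a = "\<lambda>k. of_nat (binomial (Suc e) k) * mp_var j ^ k * ?l ^ (Suc e - k)"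
  have "?a 1 \<in> ?W"
  proof (rule coefficients_in_subspace[where W = ?W and N = "Suc e" and a = ?a])
    fix s
    have "lform n (c(j := c j + of_nat s)) = (\<Sum>k<n. mp_const (c k) * mp_var k + (if k = j then mp_const (of_nat s) * mp_var k else 0))"
      unfolding lform_def by (rule sum.cong) (auto simp: mp_const.hom_add algebra_simps)
    also have "\<dots> = mp_const (of_nat s) * mp_var j + ?l"
      using \<open>j < n\<close> by (simp add: sum.distrib lform_def add.commute)
    finally have *: "lform n (c(j := c j + of_nat s)) = mp_const (of_nat s) * mp_var j + ?l" .
    have "lform n (c(j := c j + of_nat s)) ^ Suc e
        = (\<Sum>k\<le>Suc e. mp_const (of_nat s ^ k) * ?a k)"
      unfolding * binomial_ring
      by (rule sum.cong) (simp_all add: mp_const.hom_power power_mult_distrib ac_simps)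
    moreover have "mp_const 1 * lform n (c(j := c j + of_nat s)) ^ Suc e \<in> ?W"
      using step C by (intro power_sums_power) auto
    ultimately show "(\<Sum>k\<le>Suc e. mp_const (of_nat s ^ k) * ?a k) \<in> ?W" by simp
  qed (auto intro: power_sums_add power_sums_scale)
  then have "mp_const (b * inverse (of_nat (Suc e))) * ?a 1 \<in> ?W" by (rule power_sums_scale)
  moreover have "?a 1 = mp_const (of_nat (Suc e)) * (mp_var j * ?l ^ e)"
    by (simp add: mp_const.hom_of_nat ac_simps del: of_nat_Suc)
  moreover have "mp_const (b * inverse (of_nat (Suc e))) * (mp_const (of_nat (Suc e)) * q) = mp_const b * q" for q
  proof -
    have "b * inverse (of_nat (Suc e)) * of_nat (Suc e) = b"
      using of_nat_neq_0[of e, where ?'a='a] by (simp add: mult.assoc del: of_nat_Suc)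
    then show ?thesis by (simp only: mult.assoc[symmetric] mp_const.hom_mult[symmetric])
  qed
  ultimately have "mp_const b * (mp_var j * ?l ^ e) \<in> ?W" by (simp only:)
  moreover have "e' = e" using step by simp
  ultimately show ?case using step.IH
    by (auto simp: algebra_simps intro: power_sums_add)
qed (simp add: power_sums.zero)

text \<open>Each monomial is built up from a constant by one variable at a time, with forms confined
  to the first \<open>i\<close> variables. A monomial of degree e needs only e-th powers, and degree
  0 is excluded by the vanishing constant term.\<close>

lemma mpol_in_power_sums:
  fixes p :: "'a::field_char_0 mpol"
  assumes "p \<in> mp_in i" "i \<le> n" "mp_degree p \<le> d" "lookup p 0 = 0"
  shows "p \<in> power_sums n {c. \<forall>k\<ge>i. c k = 0} {1..d}"
proof -
  let ?C = "{c. \<forall>k\<ge>i. c k = (0::'a)}"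
  have single: "single m b \<in> power_sums n ?C {monom_degree m}" if "keys m \<subseteq> {..<i}" for m b
    using that
  proof (induction "monom_degree m" arbitrary: m)
    case 0
    \<comment> \<open>A constant is a multiple of the zeroth power of the zero form.\<close>
    then show ?case using power_sums_power[of "\<lambda>_. 0" ?C 0 "{0}" b n] by (simp add: mp_const_def)
  next
    case (Suc e)
    then obtain j where j: "j \<in> keys m"
      by (metis keys_eq_empty monom_degree_eq_0_iff all_not_in_conv Zero_not_Suc)
    let ?m = "m - single j 1"
    have m: "?m + single j 1 = m" using j by (intro monom_diff_add) (simp add: in_keys_iff)
    then have e: "e = monom_degree ?m" using Suc(2) monom_degree_add[of ?m "single j 1"] by simp
    have "keys ?m \<subseteq> keys m" by (auto simp: in_keys_iff lookup_minus)
    then have "single ?m b \<in> power_sums n ?C {e}" using Suc(1)[of ?m] Suc(3) e by auto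
    then have "mp_var j * single ?m b \<in> power_sums n ?C {Suc e}"
      using j Suc(3) assms(2) by (intro var_mult_power_sums) auto
    then show ?case using m Suc(2) by (simp add: mp_var_def mult_single add.commute)
  qed
  have "(\<Sum>m\<in>keys p. single m (lookup p m)) \<in> power_sums n ?C {1..d}"
  proof (rule power_sums_sum)
    fix m assume m: "m \<in> keys p"
    then have "m \<noteq> 0" using assms(4) by (auto simp: in_keys_iff)
    then have "monom_degree m \<in> {1..d}"
      using m assms(3) mp_degree_le_iff[of p d] monom_degree_eq_0_iff[of m] by (auto simp: Suc_le_eq simp del: monom_degree_eq_0_iff)
    then show "single m (lookup p m) \<in> power_sums n ?C {1..d}"
      using m assms(1) by (intro power_sums_mono[OF single]) (auto simp: mp_in_def)
  qed
  then show ?thesis by (simp add: sum_single_lookup)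
qed

section \<open>Simultaneous triangularization\<close>

context vec_space
begin

lemma span_orthogonal:
  assumes "v \<in> span U" "U \<subseteq> carrier_vec n" "w \<in> carrier_vec n" "\<And>u. u \<in> U \<Longrightarrow> w \<bullet> u = 0"
  shows "w \<bullet> v = 0"
proof -
  obtain a A where v: "v = lincomb a A" "finite A" "A \<subseteq> U" using in_spanE[OF assms(1)] by blast
  have "(\<lambda>x. a x \<cdot>\<^sub>v x) \<in> A \<rightarrow> carrier_vec n" using v assms(2) by auto
  then have "v \<bullet> w = (\<Sum>x\<in>A. (a x \<cdot>\<^sub>v x) \<bullet> w)"
    unfolding v(1) lincomb_def using assms(3) by (intro finsum_scalar_prod_sum)
  also have "\<dots> = 0"
  proof (rule sum.neutral, rule ballI)
    fix x assume "x \<in> A"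
    then have "x \<in> carrier_vec n" "w \<bullet> x = 0" using v assms(2,4) by auto
    then show "(a x \<cdot>\<^sub>v x) \<bullet> w = 0" using assms(3) comm_scalar_prod[of x n w] by simp
  qed
  moreover have "v \<in> carrier_vec n" using assms(1,2) span_is_subset2 by auto
  ultimately show ?thesis using assms(3) comm_scalar_prod[of v n w] by simp
qed

text \<open>
  A longest independent list in which every matrix sends each vector into the span of the later
  ones is a basis: otherwise products of the matrices could be applied to a vector outside its
  span for ever.
\<close>

lemma nilpotent_flag:
  fixes Ms :: "'a mat set"
  assumes Ms: "Ms \<subseteq> carrier_mat n n"
    and nil: "\<And>ms v. set ms \<subseteq> Ms \<Longrightarrow> length ms = N \<Longrightarrow> v \<in> carrier_vec n \<Longrightarrow>
      foldr (*\<^sub>v) ms v = 0\<^sub>v n"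
  obtains S T where "S \<in> carrier_mat n n" "T \<in> carrier_mat n n" "S * T = 1\<^sub>m n" "T * S = 1\<^sub>m n"
    "\<And>m i j. m \<in> Ms \<Longrightarrow> i \<le> j \<Longrightarrow> j < n \<Longrightarrow> (S * (m * T)) $$ (i, j) = 0"
proof -
  define P where "P bs \<longleftrightarrow> set bs \<subseteq> carrier_vec n \<and> distinct bs \<and> lin_indpt (set bs) \<and>
    (\<forall>j<length bs. \<forall>m\<in>Ms. m *\<^sub>v bs ! j \<in> span (set (drop (Suc j) bs)))" for bs
  have "P []" by (simp add: P_def lin_dep_def)
  moreover have "length bs < Suc n" if "P bs" for bs
    using that li_le_dim(2)[OF fin_dim, of "set bs"] by (simp add: P_def dim_is_n distinct_card)
  ultimately obtain bs where bs: "P bs" and max: "\<And>cs. P cs \<Longrightarrow> length cs \<le> length bs"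
    using ex_has_greatest_nat[of P "[]" length "Suc n"] by blast
  let ?W = "span (set bs)"
  have carr: "set bs \<subseteq> carrier_vec n" and li: "lin_indpt (set bs)" and dist: "distinct bs"
    using bs by (auto simp: P_def)
  have "carrier_vec n \<subseteq> ?W"
  proof (rule ccontr)
    assume "\<not> carrier_vec n \<subseteq> ?W"
    then obtain x where x: "x \<in> carrier_vec n" "x \<notin> ?W" by blast
    have leave: "\<exists>m\<in>Ms. m *\<^sub>v y \<notin> ?W" if y: "y \<in> carrier_vec n" "y \<notin> ?W" for y
    proof (rule ccontr)
      assume "\<not> (\<exists>m\<in>Ms. m *\<^sub>v y \<notin> ?W)"
      moreover have "y \<notin> set bs" using y(2) in_own_span[OF carr] by blast
      moreover from this have "lin_indpt (set bs \<union> {y})"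
        using lin_dep_iff_in_span[OF _ li, of y] carr y by auto
      \<comment> \<open>All matrices map y into the span of \<open>bs\<close>, so y may be put in
        front, against the maximality of \<open>bs\<close>.\<close>
      ultimately have "P (y # bs)"
        using bs y(1) by (auto simp: P_def less_Suc_eq_0_disj)
      from max[OF this] show False by simp
    qed
    have "\<exists>ms. set ms \<subseteq> Ms \<and> length ms = k \<and> foldr (*\<^sub>v) ms x \<in> carrier_vec n \<and> foldr (*\<^sub>v) ms x \<notin> ?W" for k
    proof (induction k)
      case 0
      show ?case using x by (intro exI[of _ "[]"]) simp
    next
      case (Suc k)
      then obtain ms where ms: "set ms \<subseteq> Ms" "length ms = k" "foldr (*\<^sub>v) ms x \<in> carrier_vec n"
        "foldr (*\<^sub>v) ms x \<notin> ?W" by blast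
      then obtain m where m: "m \<in> Ms" "m *\<^sub>v foldr (*\<^sub>v) ms x \<notin> ?W" using leave by blast
      then have "m *\<^sub>v foldr (*\<^sub>v) ms x \<in> carrier_vec n" using ms Ms by (intro mult_mat_vec_carrier) auto
      then show ?case using ms m by (intro exI[of _ "m # ms"]) simp
    qed
    then obtain ms where "set ms \<subseteq> Ms" "length ms = N" "foldr (*\<^sub>v) ms x \<notin> ?W" by blast
    moreover have "0\<^sub>v n \<in> ?W" using span_is_submodule carr
      by (metis submodule.zero_closed module_vec_simps(2))
    ultimately show False using nil[of ms x] x by simp
  qed
  then have "basis (set bs)" using carr li span_is_subset2[OF carr] by (auto simp: basis_def)
  then have len: "length bs = n" using dim_basis[of "set bs"] dist by (simp add: dim_is_n distinct_card)
  define T where "T = mat_of_cols n bs"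
  have T: "T \<in> carrier_mat n n" using len by (auto simp: T_def)
  have cols: "cols T = bs" using carr by (simp add: T_def)
  have col: "col T j = bs ! j" if "j < n" for j using that cols T cols_nth[of j T] by simp
  have "rank T = n" using T li dist by (intro lin_indpt_full_rank) (simp_all add: cols)
  then have "det T \<noteq> 0" using det_rank_iff[OF T] by simp
  from det_non_zero_imp_unit[OF T this] obtain S where S: "S \<in> carrier_mat n n" "S * T = 1\<^sub>m n" "T * S = 1\<^sub>m n"
    by (auto simp: Units_def ring_mat_def)
  show thesis
  proof (rule that[OF S(1) T S(2,3)])
    fix m i j assume m: "m \<in> Ms" and ij: "i \<le> j" "j < n"
    have mc: "m \<in> carrier_mat n n" using m Ms by auto
    \<comment> \<open>Row i of S annihilates every column of T except the i-th, and the image of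
      column j lies in the span of columns with index greater than j, hence different from
      i.\<close>
    have "(S * (m * T)) $$ (i, j) = row S i \<bullet> (m *\<^sub>v bs ! j)"
      using ij S(1) T mc by (simp add: col[symmetric] mult_mat_vec_def)
    also have "\<dots> = 0"
    proof (rule span_orthogonal)
      show "m *\<^sub>v bs ! j \<in> span (set (drop (Suc j) bs))" using bs m ij len by (simp add: P_def)
      show "set (drop (Suc j) bs) \<subseteq> carrier_vec n" using carr set_drop_subset[of "Suc j" bs] by blast
      show "row S i \<in> carrier_vec n" using S(1) by auto
      fix u assume "u \<in> set (drop (Suc j) bs)"
      then obtain l where l: "u = bs ! l" "j < l" "l < n"
        using len by (auto simp: in_set_conv_nth less_diff_conv intro: that[of "Suc j + _"])
      then have "row S i \<bullet> u = (S * T) $$ (i, l)" using S(1) T ij by (simp add: col)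
      then show "row S i \<bullet> u = 0" using S(2) l ij by simp
    qed
    finally show "(S * (m * T)) $$ (i, j) = 0" .
  qed
qed

end

section \<open>From a triangular Jacobian to a sum of powers\<close>

lemma lookup_subst_lin_sub_0: "lookup (mp_subst (lin_sub T) p) 0 = lookup p 0"
proof -
  have var: "lookup (mp_var i :: 'a mpol) 0 = 0" for i
    by (metis mp_var_def lookup_single_not_eq lookup_single_eq lookup_zero zero_neq_one)
  then have lin: "lookup (lin_sub T j) 0 = 0" for j
    by (simp add: lin_sub_def lform_def ev0.hom_sum ev0.hom_mult)
  obtain n where "p \<in> mp_in n" using mp_in_exists by blast
  then show ?thesis
  proof (induction rule: mp_in_induct)
    case (var i p)
    show ?case
      unfolding mp_subst.hom_mult ev0.hom_mult mp_subst_var lin \<open>\<And>i. lookup (mp_var i) 0 = 0\<close> by simp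
  qed (simp_all add: mp_subst.hom_add lookup_add)
qed

lemma mp_degree_le_map_degree: "i < dim_vec H \<Longrightarrow> mp_degree (H $ i) \<le> map_degree H"
  unfolding map_degree_def by (intro Max_ge) auto

text \<open>Listing the summands block by block turns the condition \<open>j \<le> i\<close> on
  their positions into an inequality between block numbers.\<close>

lemma sorted_concat_blocks:
  "sorted (map fst (concat (map (\<lambda>i. map (Pair i) (xs i)) [0..<n])))"
proof (induction n)
  case (Suc n)
  then show ?case by (auto simp: sorted_append o_def map_replicate_const)
qed simp

lemma sum_list_concat_blocks:
  fixes F :: "nat \<times> 'b \<Rightarrow> 'c::comm_monoid_add"
  shows "sum_list (map F (concat (map (\<lambda>i. map (Pair i) (xs i)) [0..<n])))
    = (\<Sum>i<n. \<Sum>x\<leftarrow>xs i. F (i, x))"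
  by (induction n) (auto simp: o_def add.commute)

text \<open>With G = S H, the polynomial G_i(T x) involves only variables of index below i, so it is
  a sum of powers of forms c with c_k = 0 for \<open>k \<ge> i\<close>. Undoing the change of
  coordinates turns c into the row c S and attaches the i-th column of T. For a form c from the same
  or an earlier block, c S times column i of T is the entry c_i, which vanishes.\<close>

lemma sum_of_powers_if_triangularizing:
  fixes H :: "'a::field_char_0 mpol vec"
  assumes H: "H \<in> carrier_vec n" "\<forall>k<n. H $ k \<in> mp_in n" and d: "map_degree H \<le> d"
    and ST: "triangularizing n S T H" and H0: "\<forall>k<n. lookup (H $ k) 0 = 0"
  shows "sum_of_powers_form n d H"
proof -
  from ST have S: "S \<in> carrier_mat n n" and T: "T \<in> carrier_mat n n"
    and inv: "S * T = 1\<^sub>m n" "T * S = 1\<^sub>m n"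
    by (auto simp: triangularizing_def)
  define G where "G i = (\<Sum>k<n. mp_const (S $$ (i, k)) * H $ k)" for i
  define C where "C i = {c :: nat \<Rightarrow> 'a. \<forall>k\<ge>i. c k = 0}" for i :: nat
  define c' where "c' c l = (\<Sum>k<n. c k * S $$ (k, l))" for c l
  have G_in: "G i \<in> mp_in n" for i unfolding G_def by (rule mp_in_row) (rule H)
  have "\<exists>xs. mp_subst (lin_sub T) (G i) = (\<Sum>(b, c, e)\<leftarrow>xs. mp_const b * lform n c ^ e) \<and>
      (\<forall>(b, c, e)\<in>set xs. c \<in> C i \<and> e \<in> {1..d})" if i: "i < n" for i
    unfolding C_def
  proof (intro power_sums_list mpol_in_power_sums)
    have "mp_subst (lin_sub T) (G i) \<in> mp_in n"
      using T by (intro mp_in_subst[OF G_in]) (simp add: lin_sub_def mp_in_lform)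
    moreover have "mp_deriv j (mp_subst (lin_sub T) (G i)) = 0" if "i \<le> j" "j < n" for j
      using ST that unfolding G_def by (simp add: mp_deriv_row_subst[OF T H(2)] triangularizing_def)
    ultimately show "mp_subst (lin_sub T) (G i) \<in> mp_in i"
      by (rule mp_in_if_deriv_0)
    have "mp_degree (mp_subst (lin_sub T) (G i)) \<le> mp_degree (G i)"
      by (intro mp_degree_subst_le) (simp only: lin_sub_def mp_degree_lform)
    also have "\<dots> \<le> d"
      unfolding G_def
    proof (intro mp_degree_sum_le mp_degree_const_mult_le)
      fix k assume "k \<in> {..<n}"
      then show "mp_degree (H $ k) \<le> d"
        using H d mp_degree_le_map_degree[of k H] by auto
    qed
    finally show "mp_degree (mp_subst (lin_sub T) (G i)) \<le> d" .
    show "lookup (mp_subst (lin_sub T) (G i)) 0 = 0"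
      unfolding lookup_subst_lin_sub_0 G_def by (simp add: ev0.hom_sum ev0.hom_mult H0)
  qed (use i in simp)
  then obtain xs where xs: "\<And>i. i < n \<Longrightarrow>
      mp_subst (lin_sub T) (G i) = (\<Sum>(b, c, e)\<leftarrow>xs i. mp_const b * lform n c ^ e)"
    and xs_in: "\<And>i b c e. i < n \<Longrightarrow> (b, c, e) \<in> set (xs i) \<Longrightarrow> c \<in> C i \<and> e \<in> {1..d}"
    by (metis (mono_tags, lifting) case_prodD)
  have G: "G i = (\<Sum>(b, c, e)\<leftarrow>xs i. mp_const b * lform n (c' c) ^ e)" if "i < n" for i
  proof -
    have "G i = mp_subst (lin_sub S) (mp_subst (lin_sub T) (G i))"
      by (rule mp_subst_lin_sub_inverse[OF S T inv(2) G_in, symmetric])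
    then show ?thesis
      by (simp add: xs[OF that] mp_subst.hom_sum_list o_def case_prod_unfold mp_subst.hom_mult
          mp_subst.hom_power mp_subst_lin_sub_lform[OF S] c'_def[abs_def])
  qed
  have HG: "H $ k = (\<Sum>i<n. mp_const (T $$ (k, i)) * G i)" if "k < n" for k
    unfolding G_def by (rule row_combinations_inverse[OF S T inv(2) that, symmetric])
  define L where "L = concat (map (\<lambda>i. map (Pair i) (xs i)) [0..<n])"
  \<comment> \<open>The list is indexed from 0, the required family from 1.\<close>
  define b where "b p = (case L ! (p - 1) of (i, b, c, e) \<Rightarrow> vec n (\<lambda>k. b * T $$ (k, i)))" for p
  define c where "c p = (case L ! (p - 1) of (i, b, c, e) \<Rightarrow> vec n (c' c))" for p
  define e where "e p = (case L ! (p - 1) of (i, b, c, e) \<Rightarrow> e)" for p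
  have L_in: "i < n \<and> cc \<in> C i \<and> ee \<in> {1..d}"
    if "p \<in> {1..length L}" "L ! (p - 1) = (i, bb, cc, ee)" for p i bb cc ee
  proof -
    have "(i, bb, cc, ee) \<in> set L" using that nth_mem[of "p - 1" L] by auto
    then show ?thesis using xs_in by (auto simp: L_def)
  qed
  show ?thesis
    unfolding sum_of_powers_form_def
  proof (intro exI conjI ballI)
    fix p assume p: "p \<in> {1..length L}"
    obtain i bb cc ee where Lp: "L ! (p - 1) = (i, bb, cc, ee)" by (metis prod.exhaust)
    have bp: "b p = vec n (\<lambda>k. bb * T $$ (k, i))" by (simp only: b_def Lp prod.case)
    show "b p \<in> carrier_vec n" "c p \<in> carrier_vec n" by (simp_all only: b_def c_def Lp prod.case vec_carrier)
    show "e p \<in> {1..d}" using L_in[OF p Lp] by (simp only: e_def Lp prod.case)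
    fix q assume q: "q \<in> {1..p}"
    obtain i' b2 cc' ee' where Lq: "L ! (q - 1) = (i', b2, cc', ee')" by (metis prod.exhaust)
    have i: "i < n" using L_in[OF p Lp] by simp
    have "i' \<le> i"
      using sorted_nth_mono[OF sorted_concat_blocks[of xs n, folded L_def], of "q - 1" "p - 1"] p q Lp Lq
      by auto
    moreover have "cc' \<in> C i'" using L_in[of q i' b2 cc' ee'] p q Lq by auto
    ultimately have "cc' i = 0" by (simp add: C_def)
    have "c q \<bullet> b p = (\<Sum>l<n. c' cc' l * (bb * T $$ (l, i)))"
      by (simp only: bp c_def Lq prod.case) (simp add: scalar_prod_def atLeast0LessThan)
    also have "\<dots> = (\<Sum>l<n. \<Sum>k<n. bb * (cc' k * (S $$ (k, l) * T $$ (l, i))))"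
      by (simp add: c'_def sum_distrib_left sum_distrib_right ac_simps)
    also have "\<dots> = (\<Sum>k<n. bb * (cc' k * (S * T) $$ (k, i)))"
      by (subst sum.swap, rule sum.cong)
        (simp_all add: index_mult_eq_sum[OF S T _ i] sum_distrib_left del: index_mult_mat)
    also have "\<dots> = 0"
    proof (rule sum.neutral, rule ballI)
      fix k assume "k \<in> {..<n}"
      then show "bb * (cc' k * (S * T) $$ (k, i)) = 0"
        using i \<open>cc' i = 0\<close> by (cases "k = i") (auto simp: inv)
    qed
    finally show "c q \<bullet> b p = 0" .
  next
    show "H = vec n (\<lambda>k. \<Sum>p = 1..length L. linear_form (c p) ^ e p * mp_const (b p $ k))"
    proof (rule eq_vecI)
      fix k assume "k < dim_vec (vec n (\<lambda>k. \<Sum>p = 1..length L. linear_form (c p) ^ e p * mp_const (b p $ k)))"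
      then have k: "k < n" by simp
      define F where "F = (\<lambda>(i, b, c, e). mp_const (T $$ (k, i)) * (mp_const b * lform n (c' c) ^ e))"
      have lin: "lform n (\<lambda>k. vec n (c' cc) $ k) = lform n (c' cc)" for cc
        unfolding lform_def by (rule sum.cong) auto
      have "(\<Sum>p = 1..length L. linear_form (c p) ^ e p * mp_const (b p $ k)) = (\<Sum>p = 1..length L. F (L ! (p - 1)))"
        using k lin by (intro sum.cong)
          (auto simp: F_def b_def c_def e_def linear_form_eq_lform mp_const.hom_mult split: prod.split)
      also have "\<dots> = (\<Sum>p<length L. F (L ! p))"
        by (rule sum.reindex_bij_witness[of _ Suc "\<lambda>p. p - 1"]) auto
      also have "\<dots> = sum_list (map F L)"
        by (simp add: sum_list_sum_nth atLeast0LessThan)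
      also have "\<dots> = (\<Sum>i<n. \<Sum>x\<leftarrow>xs i. F (i, x))"
        unfolding L_def by (rule sum_list_concat_blocks)
      also have "\<dots> = (\<Sum>i<n. mp_const (T $$ (k, i)) * G i)"
        by (rule sum.cong) (simp_all add: F_def G case_prod_unfold sum_list_const_mult)
      finally show "H $ k = vec n (\<lambda>k. \<Sum>p = 1..length L. linear_form (c p) ^ e p * mp_const (b p $ k)) $ k"
        using k HG by simp
    qed (use H in simp)
  qed
qed

section \<open>Linear systems of nilpotent operators\<close>

context vector_space
begin

text \<open>
  With \<open>u = L\<^sup>2 a\<close> and \<open>e = L a\<close>, write \<open>L\<^sup>2 y = w(y) u\<close> and \<open>B y u = \<alpha>(y) u + \<beta>(y) e\<close>.  The
  polarized identity \<open>(L + s B y)\<^sup>3 = 0\<close> yields \<open>w(B y e) = -\<beta>(y)\<close> and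
  \<open>\<beta>(y) (w(B y a) - \<alpha>(y)) = 0\<close>.  If \<open>\<beta> \<noteq> 0\<close>, the symmetry of \<open>B\<close> forces \<open>B u y = w(y) B u a\<close>, and the
  coefficient of \<open>s\<close> in \<open>(B u + s B a)\<^sup>3 = 0\<close> gives \<open>\<beta>(a)\<^sup>2 = 0\<close>, hence \<open>\<beta> = 0\<close>.  So \<open>u\<close> is an
  eigenvector of the nilpotent operator \<open>B y\<close>.
\<close>


lemma square_annihilated:
  fixes L :: "'b \<Rightarrow> 'b" and B :: "'b \<Rightarrow> 'b \<Rightarrow> 'b"
  assumes L_add: "\<And>x y. L (x + y) = L x + L y" and L_scale: "\<And>c x. L (c *s x) = c *s L x"
    and B_sym: "\<And>x y. B x y = B y x"
    and B_add: "\<And>x y z. B x (y + z) = B x y + B x z"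
    and B_scale: "\<And>c x y. B x (c *s y) = c *s B x y"
    and L3: "\<And>v. L (L (L v)) = 0"
    and LLB: "\<And>y v. L (L (B y v)) + L (B y (L v)) + B y (L (L v)) = 0"
    and LBB: "\<And>y v. L (B y (B y v)) + B y (L (B y v)) + B y (B y (L v)) = 0"
    and BBB: "\<And>x y v. B x (B x (B y v)) + B x (B y (B x v)) + B y (B x (B x v)) = 0"
    and B3: "\<And>y v. B y (B y (B y v)) = 0"
    and range: "\<And>y. \<exists>c d. L y = c *s L (L a) + d *s L a"
  shows "B y (L (L v)) = 0"
proof (cases "L (L a) = 0")
  case True
  have "L (L v) = 0"
  proof -
    obtain c d where "L v = c *s L (L a) + d *s L a" using range by blast
    then show ?thesis using True scale_zero_right by (simp add: L_scale)
  qed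
  then show ?thesis using B_scale[of y 0 0] by simp
next
  case False
  define u where "u = L (L a)"
  define e where "e = L a"
  have Le: "L e = u" and Lu: "L u = 0" and u0: "u \<noteq> 0"
    using False by (simp_all add: u_def e_def L3)
  have L0: "L 0 = 0" and B0: "B x 0 = 0" for x
    using L_scale[of 0 0] B_scale[of x 0 0] by simp_all
  have indep: "c = 0 \<and> d = 0" if "c *s u + d *s e = 0" for c d
  proof -
    have "L (c *s u + d *s e) = d *s u" by (simp add: L_add L_scale Le Lu)
    with that have "d = 0" using u0 L0 by simp
    with that show ?thesis using u0 by simp
  qed
  have uniq: "c = c' \<and> d = d'" if "c *s u + d *s e = c' *s u + d' *s e" for c d c' d'
    using indep[of "c - c'" "d - d'"] that by (simp add: scale_left_diff_distrib algebra_simps)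
  obtain p w where Lpw: "\<And>y. L y = p y *s u + w y *s e"
    using range unfolding u_def[symmetric] unfolding e_def[symmetric] by metis
  have LL: "L (L y) = w y *s u" for y
    unfolding Lpw[of y] by (simp add: L_add L_scale Le Lu)
  have w_add: "w (x + y) = w x + w y" for x y
    using uniq[of "p (x + y)" "w (x + y)" "p x + p y" "w x + w y"]
    by (simp add: Lpw[symmetric] L_add scale_left_distrib) (simp add: Lpw algebra_simps)
  have w_scale: "w (c *s y) = c * w y" for c y
    using uniq[of "p (c *s y)" "w (c *s y)" "c * p y" "c * w y"]
    by (simp add: Lpw[symmetric] L_scale flip: scale_scale) (simp add: Lpw scale_right_distrib)
  have w_eqI: "w y = c" if "L (L y) = c *s u" for y c
    using that u0 by (simp add: LL)
  have wu: "w u = 0" and we: "w e = 0" and wa: "w a = 1"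
    by (rule w_eqI; simp add: Lu Le L0; simp add: u_def)+
  have "\<exists>c d. B y u = c *s u + d *s e" for y
  proof -
    \<comment> \<open>The relation linear in B, taken at \<open>a\<close>, exhibits
      \<open>B y u\<close> as a value of L, hence as a combination of u and e.\<close>
    have "B y u = - (L (L (B y a)) + L (B y e))"
      unfolding eq_neg_iff_add_eq_0 u_def e_def using LLB[of y a] by (simp add: add.commute)
    also have "\<dots> = - (L (L (B y a) + B y e))" by (simp add: L_add)
    also have "\<dots> = (- p (L (B y a) + B y e)) *s u + (- w (L (B y a) + B y e)) *s e"
      by (simp add: Lpw[of "L (B y a) + B y e"])
    finally show ?thesis by blast
  qed
  then obtain \<alpha> \<beta> where Bu: "\<And>y. B y u = \<alpha> y *s u + \<beta> y *s e" by metis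
  have Bl_add: "B (x + y) z = B x z + B y z" and Bl_scale: "B (c *s x) z = c *s B x z" for x y z c
    using B_add B_scale B_sym by metis+
  have "\<alpha> (x + y) = \<alpha> x + \<alpha> y \<and> \<beta> (x + y) = \<beta> x + \<beta> y" for x y
    using Bl_add[of x y u] by (intro uniq) (simp add: Bu scale_left_distrib algebra_simps)
  then have \<alpha>_add: "\<alpha> (x + y) = \<alpha> x + \<alpha> y" and \<beta>_add: "\<beta> (x + y) = \<beta> x + \<beta> y" for x y
    by blast+
  have "\<alpha> (c *s x) = c * \<alpha> x \<and> \<beta> (c *s x) = c * \<beta> x" for x c
    using Bl_scale[of c x u] by (intro uniq) (simp add: Bu scale_right_distrib)
  then have \<alpha>_scale: "\<alpha> (c *s x) = c * \<alpha> x" and \<beta>_scale: "\<beta> (c *s x) = c * \<beta> x" for x c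
    by blast+
  have LBu: "L (B y u) = \<beta> y *s u" for y by (simp add: Bu L_add L_scale Le Lu)
  have wBe: "w (B y e) = - \<beta> y" for y
  proof (rule w_eqI)
    show "L (L (B y e)) = - \<beta> y *s u"
      using LLB[of y e] by (simp add: Le Lu B0 LBu eq_neg_iff_add_eq_0)
  qed
  \<comment> \<open>The relation quadratic in B at u, after division by \<open>\<beta> y\<close>,
    and the relation linear in B at \<open>a\<close> both express \<open>L (B y e)\<close>;
    subtracting them leaves the second factor times u.\<close>
  have prod: "\<beta> y * (w (B y a) - \<alpha> y) = 0" for y
  proof (cases "\<beta> y = 0")
    case False
    have "\<beta> y *s L (B y e) + ((\<alpha> y * \<beta> y) *s u + ((\<alpha> y * \<beta> y) *s u + (\<beta> y * \<beta> y) *s e)) = 0"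
      using LBB[of y u]
      by (simp add: Lu B0 LBu B_scale) (simp add: Bu B_add B_scale L_add L_scale Lu Le scale_right_distrib
          mult.commute algebra_simps)
    then have "\<beta> y *s (L (B y e) + (\<alpha> y *s u + (\<alpha> y *s u + \<beta> y *s e))) = 0"
      by (simp only: scale_right_distrib scale_scale mult.commute)
    with False have 1: "L (B y e) + (\<alpha> y *s u + (\<alpha> y *s u + \<beta> y *s e)) = 0" by simp
    have 2: "w (B y a) *s u + L (B y e) + (\<alpha> y *s u + \<beta> y *s e) = 0"
      using LLB[of y a] unfolding u_def[symmetric] unfolding e_def[symmetric] by (simp add: LL Bu)
    have "w (B y a) *s u - \<alpha> y *s u = (w (B y a) *s u + L (B y e) + (\<alpha> y *s u + \<beta> y *s e))
        - (L (B y e) + (\<alpha> y *s u + (\<alpha> y *s u + \<beta> y *s e)))"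
      by simp
    also have "\<dots> = 0" unfolding 1 2 by simp
    finally show ?thesis using u0 by (simp flip: scale_left_diff_distrib)
  qed simp
  have \<beta>: "\<beta> y = 0" for y
  proof (rule ccontr)
    assume y0: "\<beta> y \<noteq> 0"
    have wBa: "w (B x a) = \<alpha> x" for x
    proof -
      \<comment> \<open>Both factors are additive, and the first is nonzero at y. As their product
        vanishes at y, x and y + x, the second factor vanishes at every x.\<close>
      let ?g = "\<lambda>x. w (B x a) - \<alpha> x"
      have "?g y = 0" using prod[of y] y0 by simp
      then have "?g (y + x) = ?g x" by (simp add: Bl_add w_add \<alpha>_add)
      moreover have "(\<beta> y + \<beta> x) * ?g (y + x) = 0" using prod[of "y + x"] by (simp add: \<beta>_add)
      ultimately have "\<beta> y * ?g x + \<beta> x * ?g x = 0" by (simp only: distrib_right)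
      then have "\<beta> y * ?g x = 0" using prod[of x] by simp
      then show ?thesis using y0 by simp
    qed
    \<comment> \<open>For z in the kernel of L the linear relation reduces to
      \<open>L (L (B x z)) = 0\<close>, which by symmetry is a statement about the operator
      \<open>B z\<close>.\<close>
    have ker: "\<alpha> z = 0" "\<beta> z = 0" if z: "L z = 0" for z
    proof -
      have "w (B z x) = 0" for x
      proof (rule w_eqI)
        show "L (L (B z x)) = 0 *s u"
          using LLB[of x z] z by (simp add: L0 B0 B_sym[of z x])
      qed
      then show "\<alpha> z = 0" "\<beta> z = 0" using wBa[of z] wBe[of z] by simp_all
    qed
    have Buy: "B u x = \<alpha> x *s u + \<beta> x *s e" for x using Bu B_sym by metis
    have Buu: "B u u = 0" using Buy[of u] ker[OF Lu] by simp
    have \<beta>e: "\<beta> e = 0"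
    proof (rule ccontr)
      assume ne: "\<beta> e \<noteq> 0"
      \<comment> \<open>Because \<open>B u u = 0\<close>, the vector \<open>B u e\<close> is scaled
        by \<open>\<beta> e\<close> under \<open>B u\<close>; nilpotency then makes it zero.\<close>
      have "B u (B u e) = \<beta> e *s B u e"
        by (subst (2) Buy) (simp add: B_add B_scale Buu)
      then have "B u (B u (B u e)) = (\<beta> e * \<beta> e) *s B u e" by (simp add: B_scale)
      then have "B u e = 0" using B3[of u e] ne by simp
      then show False using indep[of "\<alpha> e" "\<beta> e"] ne by (simp add: Buy)
    qed
    have "B e u = \<alpha> e *s u" by (simp add: Bu \<beta>e)
    then have "B e (B e (B e u)) = (\<alpha> e * (\<alpha> e * \<alpha> e)) *s u" by (simp add: B_scale)
    then have \<alpha>e: "\<alpha> e = 0" using B3[of e u] u0 by simp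
    define k where "k = B u a"
    have split: "\<alpha> x = w x * \<alpha> a \<and> \<beta> x = w x * \<beta> a" for x
    proof -
      \<comment> \<open>Here x is reduced by a preimage of \<open>L x\<close>: L sends e to u and
        \<open>a\<close> to e.\<close>
      let ?z = "x + ((- p x) *s e + (- w x) *s a)"
      have "L ?z = 0"
        by (simp only: L_add L_scale Le e_def[symmetric]) (simp add: Lpw[of x])
      from ker[OF this] show ?thesis
        unfolding \<alpha>_add \<beta>_add \<alpha>_scale \<beta>_scale \<alpha>e \<beta>e by simp
    qed
    have Buw: "B u x = w x *s k" for x
      unfolding k_def Buy[of x] Buy[of a] using split[of x] by (simp add: scale_right_distrib)
    have k: "k = \<alpha> a *s u + \<beta> a *s e" by (simp add: k_def Buy)
    have wk: "w k = 0" by (simp add: k w_add w_scale wu we)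
    \<comment> \<open>As the values of \<open>B u\<close> are multiples of k and
      \<open>w k = 0\<close>, only the term \<open>B u (B a (B u a))\<close> survives.\<close>
    have "w (B a k) *s k = 0"
      using BBB[of u a a] by (simp add: Buw wk wa B_scale B0)
    moreover have "w (B a k) = - (\<beta> a * \<beta> a)"
      by (simp add: k B_add B_scale w_add w_scale wBe Bu wu we)
    ultimately have "\<beta> a = 0 \<or> k = 0" by auto
    then have "\<beta> a = 0" using indep[of "\<alpha> a" "\<beta> a"] k by auto
    then show False using split[of y] y0 by simp
  qed
  have "B y u = \<alpha> y *s u" using Bu[of y] \<beta>[of y] by simp
  then have "B y (B y (B y u)) = (\<alpha> y * (\<alpha> y * \<alpha> y)) *s u" by (simp add: B_scale)
  then have "\<alpha> y = 0" using B3[of y u] u0 by simp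
  then have "B y u = 0" using \<open>B y u = \<alpha> y *s u\<close> by simp
  then show ?thesis by (simp add: LL B_scale)
qed

end

section \<open>Leading exponents of polynomials with parallel gradients\<close>

lemma lookup_mult_eq_sum:
  fixes f g :: "'a::comm_ring_1 mpol"
  shows "lookup (f * g) k = (\<Sum>m\<in>keys f. \<Sum>m'\<in>keys g. if m + m' = k then lookup f m * lookup g m' else 0)"
proof -
  have "f * g = (\<Sum>m\<in>keys f. \<Sum>m'\<in>keys g. single (m + m') (lookup f m * lookup g m'))"
    by (subst sum_single_lookup[symmetric, of f], subst sum_single_lookup[symmetric, of g])
      (simp only: sum_product mult_single)
  then show ?thesis by (simp only: lookup_sum lookup_single when_def)
qed

text \<open>If a + b arises from the two supports in only one way, no other product contributes to
  its coefficient. This replaces the multiplicativity of leading coefficients and also applies to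
  polynomials with smaller support.\<close>

lemma lookup_mult_vertex:
  fixes f g :: "'a::comm_ring_1 mpol"
  assumes "\<And>m m'. m \<in> keys f \<Longrightarrow> m' \<in> keys g \<Longrightarrow> m + m' = a + b \<Longrightarrow> m = a \<and> m' = b"
  shows "lookup (f * g) (a + b) = lookup f a * lookup g b"
proof -
  have "lookup (f * g) (a + b) = (\<Sum>m\<in>keys f. \<Sum>m'\<in>keys g.
      if m = a then (if m' = b then lookup f a * lookup g b else 0) else 0)"
    unfolding lookup_mult_eq_sum using assms by (intro sum.cong) auto
  also have "\<dots> = (\<Sum>m\<in>keys f. if m = a then (\<Sum>m'\<in>keys g. if m' = b then lookup f a * lookup g b else 0) else 0)"
    by (intro sum.cong) auto
  also have "\<dots> = lookup f a * lookup g b"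
    by (simp add: in_keys_iff)
  finally show ?thesis .
qed

text \<open>The comparison is lexicographic: first \<open>w\<close>, then \<open>\<psi>\<close>,
  then the total order on exponents. Integer values of \<open>\<psi>\<close> allow ties to be broken
  for or against a variable.\<close>

definition leading :: "((nat \<Rightarrow>\<^sub>0 nat) \<Rightarrow> nat) \<Rightarrow> ((nat \<Rightarrow>\<^sub>0 nat) \<Rightarrow> int) \<Rightarrow> 'a::zero mpol \<Rightarrow> (nat \<Rightarrow>\<^sub>0 nat) \<Rightarrow> bool" where
  "leading w \<psi> f a \<longleftrightarrow> a \<in> keys f \<and>
    (\<forall>m\<in>keys f. w m < w a \<or> w m = w a \<and> (\<psi> m < \<psi> a \<or> \<psi> m = \<psi> a \<and> m \<le> a))"

lemma leading_exists:
  assumes "f \<noteq> 0"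
  obtains a where "leading w \<psi> f a"
proof -
  define A1 where "A1 = {m \<in> keys f. w m = Max (w ` keys f)}"
  define A2 where "A2 = {m \<in> A1. \<psi> m = Max (\<psi> ` A1)}"
  have fin: "finite (keys f)" "finite A1" "finite A2" by (auto simp: A1_def A2_def)
  have "keys f \<noteq> {}" using assms by simp
  then have "Max (w ` keys f) \<in> w ` keys f" by (intro Max_in) auto
  then have "A1 \<noteq> {}" by (auto simp: A1_def)
  then have "Max (\<psi> ` A1) \<in> \<psi> ` A1" using fin by (intro Max_in) auto
  then have "A2 \<noteq> {}" by (auto simp: A2_def)
  then have mem: "Max A2 \<in> A2" using fin by simp
  have "leading w \<psi> f (Max A2)"
    unfolding leading_def
  proof (intro conjI ballI)
    show "Max A2 \<in> keys f" using mem by (auto simp: A1_def A2_def)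
    fix m assume m: "m \<in> keys f"
    have w: "w (Max A2) = Max (w ` keys f)" and \<psi>: "\<psi> (Max A2) = Max (\<psi> ` A1)"
      using mem by (auto simp: A1_def A2_def)
    have "w m \<le> w (Max A2)" unfolding w using m fin by simp
    moreover have "\<psi> m \<le> \<psi> (Max A2)" if "w m = w (Max A2)"
      unfolding \<psi> using m fin that w by (intro Max_ge) (auto simp: A1_def)
    moreover have "m \<le> Max A2" if "w m = w (Max A2)" "\<psi> m = \<psi> (Max A2)"
      using m fin that w \<psi> by (intro Max_ge) (auto simp: A1_def A2_def)
    ultimately show "w m < w (Max A2) \<or> w m = w (Max A2) \<and>
        (\<psi> m < \<psi> (Max A2) \<or> \<psi> m = \<psi> (Max A2) \<and> m \<le> Max A2)"
      by linarith
  qed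
  then show thesis by (rule that)
qed

locale additive_weights =
  fixes w :: "(nat \<Rightarrow>\<^sub>0 nat) \<Rightarrow> nat" and \<psi> :: "(nat \<Rightarrow>\<^sub>0 nat) \<Rightarrow> int"
  assumes w_add: "w (m + m') = w m + w m'" and \<psi>_add: "\<psi> (m + m') = \<psi> m + \<psi> m'"
begin

text \<open>Each of the three comparisons is compatible with addition, so equality of the sums
  forces equality in both summands.\<close>

lemma leading_vertex:
  assumes "leading w \<psi> f a" "leading w \<psi> g b" "m \<in> keys f" "m' \<in> keys g" "m + m' = a + b"
  shows "m = a \<and> m' = b"
proof -
  have f: "w m < w a \<or> w m = w a \<and> (\<psi> m < \<psi> a \<or> \<psi> m = \<psi> a \<and> m \<le> a)"
    and g: "w m' < w b \<or> w m' = w b \<and> (\<psi> m' < \<psi> b \<or> \<psi> m' = \<psi> b \<and> m' \<le> b)"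
    using assms by (auto simp: leading_def)
  have "w m + w m' = w a + w b" using assms(5) by (metis w_add)
  then have w: "w m = w a" "w m' = w b" using f g by linarith+
  have "\<psi> m + \<psi> m' = \<psi> a + \<psi> b" using assms(5) by (metis \<psi>_add)
  then have "\<psi> m = \<psi> a" "\<psi> m' = \<psi> b" using f g w by linarith+
  then have le: "m \<le> a" "m' \<le> b" using f g w by auto
  have "m = a"
  proof (rule ccontr)
    assume "m \<noteq> a"
    then have "m < a" using le(1) by (rule le_neq_trans[rotated])
    from add_less_le_mono[OF this le(2)] show False using assms(5) by (metis less_irrefl)
  qed
  then show ?thesis using assms(5) by simp
qed

text \<open>Compare the leading coefficients in \<open>x\<^sub>i \<partial>\<^sub>i f \<cdot> x\<^sub>j \<partial>\<^sub>j g = x\<^sub>j \<partial>\<^sub>j f \<cdot> x\<^sub>i \<partial>\<^sub>i g\<close>.\<close>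

lemma leading_parallel:
  fixes f g :: "'a::{idom,ring_char_0} mpol"
  assumes "leading w \<psi> f a" "leading w \<psi> g b"
    and par: "mp_deriv i f * mp_deriv j g = mp_deriv j f * mp_deriv i g"
  shows "lookup a i * lookup b j = lookup a j * lookup b i"
proof -
  have coeff: "lookup ((mp_var i * mp_deriv i f) * (mp_var j * mp_deriv j g)) (a + b)
      = of_nat (lookup a i) * lookup f a * (of_nat (lookup b j) * lookup g b)" for i j
  proof -
    have "lookup ((mp_var i * mp_deriv i f) * (mp_var j * mp_deriv j g)) (a + b)
        = lookup (mp_var i * mp_deriv i f) a * lookup (mp_var j * mp_deriv j g) b"
    proof (rule lookup_mult_vertex, rule leading_vertex[OF assms(1,2)])
      fix m m' assume "m \<in> keys (mp_var i * mp_deriv i f)" "m' \<in> keys (mp_var j * mp_deriv j g)"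
      then show "m \<in> keys f" "m' \<in> keys g" by (auto simp: in_keys_iff lookup_var_mult_deriv)
    qed
    then show ?thesis by (simp only: lookup_var_mult_deriv)
  qed
  have "(mp_var i * mp_deriv i f) * (mp_var j * mp_deriv j g)
      = (mp_var i * mp_var j) * (mp_deriv i f * mp_deriv j g)"
    by (simp only: ac_simps)
  also have "\<dots> = (mp_var j * mp_deriv j f) * (mp_var i * mp_deriv i g)"
    unfolding par by (simp only: ac_simps)
  finally have "of_nat (lookup a i) * lookup f a * (of_nat (lookup b j) * lookup g b)
      = of_nat (lookup a j) * lookup f a * (of_nat (lookup b i) * lookup g b)"
    using coeff[of i j] coeff[of j i] by (metis (no_types))
  moreover have "lookup f a \<noteq> 0" "lookup g b \<noteq> 0" using assms by (auto simp: leading_def in_keys_iff)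
  ultimately have "of_nat (lookup a i) * of_nat (lookup b j) = (of_nat (lookup a j) * of_nat (lookup b i) :: 'a)"
    by (simp add: ac_simps)
  then show ?thesis by (metis of_nat_mult of_nat_eq_iff)
qed

lemma lookup_mult_eq_0_if_weight:
  fixes f g :: "'a::comm_ring_1 mpol"
  assumes "\<And>m. m \<in> keys f \<Longrightarrow> w m \<le> A" "\<And>m. m \<in> keys g \<Longrightarrow> w m \<le> B" "A + B < w k"
  shows "lookup (f * g) k = 0"
proof (rule ccontr)
  assume "lookup (f * g) k \<noteq> 0"
  then obtain m m' where "k = m + m'" "m \<in> keys f" "m' \<in> keys g"
    using keys_mult[of f g] by (auto simp: in_keys_iff)
  then show False using assms(1)[of m] assms(2)[of m'] assms(3) by (simp add: w_add)
qed

end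

lemma mp_degree_attained:
  assumes "mp_degree p > 0"
  obtains m where "m \<in> keys p" "monom_degree m = mp_degree p"
proof -
  have "mp_degree p \<in> insert 0 (monom_degree ` keys p)"
    unfolding mp_degree_def by (rule Max_in) auto
  then show thesis using assms that by auto
qed

text \<open>
  Give \<open>x\<^sub>t\<close> the weight \<open>Q + R\<close> and the other variables the weight \<open>Q\<close>, where the quotient \<open>R / Q \<ge> 0\<close> is
  the least for which some monomial of top weight of \<open>h t\<close> contains \<open>x\<^sub>t\<close>.  If \<open>R > 0\<close>, then \<open>h t\<close>
  also has a monomial of top weight without \<open>x\<^sub>t\<close>, so for the competing \<open>h i\<close> of smaller degree the
  weight is \<open>Q\<close> times the degree of a monomial.  Parallelism of the leading exponents then bounds the
  weight of \<open>h i\<close> by that of \<open>h t\<close> minus the weight of \<open>x\<^sub>t\<close>, and \<open>(\<partial>\<^sub>t h\<^sub>t)\<^sup>2\<close> cannot be cancelled in the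
  sum of the \<open>\<partial>\<^sub>t h\<^sub>i \<cdot> \<partial>\<^sub>i h\<^sub>t\<close>.
\<close>

lemma deriv_eq_0_of_square_zero:
  fixes h :: "nat \<Rightarrow> 'a::{idom,ring_char_0} mpol"
  assumes h: "\<And>a. a < n \<Longrightarrow> h a \<in> mp_in n"
    and par: "\<And>a b i j. a < n \<Longrightarrow> b < n \<Longrightarrow> i < n \<Longrightarrow> j < n \<Longrightarrow>
      mp_deriv i (h a) * mp_deriv j (h b) = mp_deriv j (h a) * mp_deriv i (h b)"
    and t: "t < n"
    and sq: "(\<Sum>i<n. mp_deriv t (h i) * mp_deriv i (h t)) = 0"
    and deg: "\<And>i. i < n \<Longrightarrow> i \<noteq> t \<Longrightarrow>
      mp_degree (h i) = 0 \<or> mp_degree (h i) < mp_degree (h t) \<or> mp_deriv i (h t) = 0"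
  shows "mp_deriv t (h t) = 0"
proof (rule ccontr)
  assume nz: "mp_deriv t (h t) \<noteq> 0"
  define f where "f = h t"
  define D where "D = mp_degree f"
  have D: "D > 0" using nz mp_deriv_eq_0_if_degree_0[of f t] by (auto simp: D_def f_def)
  let ?X = "{m \<in> keys f. lookup m t \<noteq> 0}"
  have "?X \<noteq> {}"
  proof -
    from nz obtain m where "m \<in> keys (mp_deriv t f)" by (metis f_def keys_eq_empty all_not_in_conv)
    then have "m + single t 1 \<in> ?X" by (auto simp: in_keys_iff lookup_mp_deriv lookup_add)
    then show ?thesis by blast
  qed
  moreover have "finite ?X" by simp
  ultimately obtain m0 where m0: "m0 \<in> ?X"
    and min: "\<And>m. m \<in> ?X \<Longrightarrow> (real D - monom_degree m0) / lookup m0 t \<le> (real D - monom_degree m) / lookup m t"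
    using arg_min_if_finite(1)[of ?X "\<lambda>m. (real D - monom_degree m) / lookup m t"]
      arg_min_least[of ?X _ "\<lambda>m. (real D - monom_degree m) / lookup m t"] by blast
  \<comment> \<open>R / Q is the minimum just chosen; keeping numerator and denominator apart makes
    all weights natural numbers.\<close>
  define Q where "Q = lookup m0 t"
  define R where "R = D - monom_degree m0"
  define w where "w m = Q * monom_degree m + R * lookup m t" for m
  have deg_le: "monom_degree m \<le> D" if "m \<in> keys f" for m
    using that by (simp add: D_def monom_degree_le)
  have Q: "Q > 0" using m0 by (simp add: Q_def)
  have R: "real R = real D - monom_degree m0" using deg_le[of m0] m0 by (simp add: R_def)
  have w_le: "w m \<le> Q * D" if m: "m \<in> keys f" for m
  proof (cases "lookup m t = 0")
    case True
    then show ?thesis using deg_le[OF m] by (simp add: w_def)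
  next
    case False
    then have "real R / Q \<le> (real D - monom_degree m) / lookup m t"
      using min[of m] m by (simp add: R Q_def)
    then have "real R * lookup m t \<le> (real D - monom_degree m) * Q"
      using False Q by (simp add: divide_simps split: if_splits)
    then have "real (w m) \<le> real (Q * D)" by (simp add: w_def algebra_simps)
    then show ?thesis by (simp only: of_nat_le_iff)
  qed
  have w_m0: "w m0 = Q * D"
  proof -
    have "w m0 = Q * (monom_degree m0 + R)" by (simp add: w_def Q_def algebra_simps)
    then show ?thesis using deg_le[of m0] m0 by (simp add: R_def)
  qed
  have w_add: "w (m + m') = w m + w m'" for m m'
    by (simp add: w_def monom_degree_add lookup_add algebra_simps)
  \<comment> \<open>Two tie-breaks for the same weight: the first prefers many factors x_t, the
    second few.\<close>
  interpret hi: additive_weights w "\<lambda>m. int (lookup m t)"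
    by unfold_locales (simp_all add: w_add lookup_add)
  interpret lo: additive_weights w "\<lambda>m. - int (lookup m t)"
    by unfold_locales (simp_all add: w_add lookup_add)
  have f0: "f \<noteq> 0" using m0 by auto
  obtain a where a: "leading w (\<lambda>m. int (lookup m t)) f a" using leading_exists[OF f0] by blast
  have aw: "w a = Q * D"
    using a m0 w_m0 w_le[of a] by (auto simp: leading_def)
  have at: "lookup a t > 0"
    using a m0 w_m0 aw Q by (force simp: leading_def)
  \<comment> \<open>The weight is linear in the exponent vector, so parallel exponents have weights
    in the ratio of their entries.\<close>
  have par_w: "lookup b i * w c = lookup c i * w b"
    if "\<And>j. j < n \<Longrightarrow> lookup b i * lookup c j = lookup b j * lookup c i"
      "keys b \<subseteq> {..<n}" "keys c \<subseteq> {..<n}" for b c i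
  proof -
    have md: "monom_degree b = (\<Sum>j<n. lookup b j)" "monom_degree c = (\<Sum>j<n. lookup c j)"
      using that by (simp_all add: monom_degree_superset)
    have "lookup b i * monom_degree c = lookup c i * monom_degree b"
      unfolding md sum_distrib_left using that(1) by (intro sum.cong) (auto simp: mult.commute)
    moreover have "lookup b i * lookup c t = lookup b t * lookup c i" using that(1) t by blast
    ultimately show ?thesis unfolding w_def by (simp add: algebra_simps)
  qed
  have keys_n: "keys m \<subseteq> {..<n}" if "m \<in> keys (h i)" "i < n" for m i
    using h[OF that(2)] that(1) by (simp add: mp_in_def)
  have bound: "w m + (Q + R) \<le> Q * D"
    if i: "i < n" "mp_degree (h i) < D" "mp_degree (h i) \<noteq> 0" and m: "m \<in> keys (h i)" for i m
  proof -
    have hi0: "h i \<noteq> 0" using i by auto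
    obtain b where b: "leading w (\<lambda>m. int (lookup m t)) (h i) b" using leading_exists[OF hi0] by blast
    have "w b < Q * D"
    proof (cases "R = 0")
      case True
      have "b \<in> keys (h i)" using b by (simp add: leading_def)
      then have "monom_degree b < D" using monom_degree_le i(2) le_less_trans by blast
      then show ?thesis using True Q by (simp add: w_def)
    next
      case False
      \<comment> \<open>For R > 0 a monomial of full degree D cannot contain x_t, since its weight
        would exceed Q D. So the leading exponent of f with the fewest factors x_t has none, and
        parallelism passes this on to \<open>h i\<close>.\<close>
      obtain c where c: "leading w (\<lambda>m. - int (lookup m t)) f c" using leading_exists[OF f0] by blast
      obtain b' where b': "leading w (\<lambda>m. - int (lookup m t)) (h i) b'" using leading_exists[OF hi0] by blast
      obtain mD where mD: "mD \<in> keys f" "monom_degree mD = D"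
        using mp_degree_attained[of f] D by (auto simp: D_def)
      have mDt: "lookup mD t = 0" using w_le[OF mD(1)] mD(2) False by (simp add: w_def)
      then have "w mD = Q * D" by (simp add: w_def mD)
      then have ct: "lookup c t = 0" "w c = Q * D"
        using c mD(1) mDt w_le[of c] by (auto simp: leading_def)
      have b'k: "b' \<in> keys (h i)" "c \<in> keys (h t)" using b' c by (simp_all add: leading_def f_def)
      have "lookup b' t * w c = lookup c t * w b'"
        using lo.leading_parallel[OF b' c] par i t keys_n b'k by (intro par_w) (auto simp: f_def)
      then have "lookup b' t = 0" using ct Q D by simp
      then have "w b' = Q * monom_degree b'" by (simp add: w_def)
      also have "monom_degree b' < D" using monom_degree_le[OF b'k(1)] i(2) by simp
      finally have "w b' < Q * D" using Q by simp
      moreover have "w b = w b'" using b b' unfolding leading_def by (metis less_asym less_irrefl)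
      ultimately show ?thesis by simp
    qed
    moreover have "lookup a t * w b = lookup b t * w a"
    proof (rule par_w)
      show "lookup a t * lookup b j = lookup a j * lookup b t" if "j < n" for j
        using hi.leading_parallel[OF a b] par i t that by (auto simp: f_def)
      show "keys a \<subseteq> {..<n}" "keys b \<subseteq> {..<n}"
        using a b keys_n i(1) t by (auto simp: leading_def f_def)
    qed
    then have eq: "lookup a t * w b = lookup b t * (Q * D)" by (simp add: aw)
    ultimately have "lookup b t * (Q * D) < lookup a t * (Q * D)" using at by (metis mult_less_mono2)
    \<comment> \<open>Strictness between integers gains a whole unit, worth Q D, which is at least
      \<open>lookup a t\<close> times the weight Q + R of x_t.\<close>
    then have "Suc (lookup b t) \<le> lookup a t" by simp
    then have "Suc (lookup b t) * (Q * D) \<le> lookup a t * (Q * D)" by (rule mult_le_mono1)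
    then have 1: "lookup a t * w b + Q * D \<le> lookup a t * (Q * D)" using eq by simp
    have "lookup a t * (Q + R) \<le> w a"
      using lookup_le_monom_degree[of a t] by (simp add: w_def algebra_simps)
    with 1 have "lookup a t * (w b + (Q + R)) \<le> lookup a t * (Q * D)" by (simp add: aw algebra_simps)
    then have "w b + (Q + R) \<le> Q * D" using at by simp
    moreover have "w m \<le> w b" using b m by (auto simp: leading_def)
    ultimately show ?thesis by simp
  qed
  \<comment> \<open>Multiplying by x_t^2 turns the diagonal term into the square of x_t d/dx_t f,
    with a nonzero coefficient at a + a. Every other term is zero or has weight at most Q D + (Q D -
    Q), below the weight 2 Q D of a + a.\<close>
  have "0 = lookup (mp_var t * mp_var t * (\<Sum>i<n. mp_deriv t (h i) * mp_deriv i (h t))) (a + a)"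
    by (simp add: sq)
  also have "\<dots> = (\<Sum>i<n. lookup ((mp_var t * (mp_var t * mp_deriv t (h i))) * mp_deriv i (h t)) (a + a))"
    by (simp only: sum_distrib_left lookup_sum mult.assoc)
  also have "\<dots> = (\<Sum>i<n. if i = t then (of_nat (lookup a t) * lookup f a) * (of_nat (lookup a t) * lookup f a) else 0)"
  proof (rule sum.cong)
    fix i assume "i \<in> {..<n}"
    then have i: "i < n" by simp
    show "lookup ((mp_var t * (mp_var t * mp_deriv t (h i))) * mp_deriv i (h t)) (a + a)
        = (if i = t then (of_nat (lookup a t) * lookup f a) * (of_nat (lookup a t) * lookup f a) else 0)"
    proof (cases "i = t")
      case True
      have "(mp_var t * (mp_var t * mp_deriv t f)) * mp_deriv t f
          = (mp_var t * mp_deriv t f) * (mp_var t * mp_deriv t f)"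
        by (simp only: ac_simps)
      moreover have "lookup ((mp_var t * mp_deriv t f) * (mp_var t * mp_deriv t f)) (a + a)
          = lookup (mp_var t * mp_deriv t f) a * lookup (mp_var t * mp_deriv t f) a"
      proof (rule lookup_mult_vertex, rule hi.leading_vertex[OF a a])
        fix m m' assume "m \<in> keys (mp_var t * mp_deriv t f)" "m' \<in> keys (mp_var t * mp_deriv t f)"
        then show "m \<in> keys f" "m' \<in> keys f" by (auto simp: in_keys_iff lookup_var_mult_deriv)
      qed
      ultimately show ?thesis using True by (simp only: lookup_var_mult_deriv f_def simp_thms if_True)
    next
      case False
      consider "mp_degree (h i) = 0" | "mp_deriv i (h t) = 0" | "mp_degree (h i) \<noteq> 0" "mp_degree (h i) < D"
        using deg[OF i False] by (auto simp: D_def f_def)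
      then have "lookup ((mp_var t * (mp_var t * mp_deriv t (h i))) * mp_deriv i (h t)) (a + a) = 0"
      proof cases
        case 3
        show ?thesis
        proof (rule hi.lookup_mult_eq_0_if_weight)
          fix m assume "m \<in> keys (mp_var t * (mp_var t * mp_deriv t (h i)))"
          then obtain m1 m2 where m: "m = m1 + m2" "m1 \<in> keys (mp_var t :: 'a mpol)"
            "m2 \<in> keys (mp_var t * mp_deriv t (h i))"
            using keys_mult[of "mp_var t :: 'a mpol" "mp_var t * mp_deriv t (h i)"] by auto
          have "m1 = single t 1" using m(2) by (auto simp: mp_var_def split: if_splits)
          then have "w m1 = Q + R" by (simp add: w_def)
          moreover have "m2 \<in> keys (h i)" using m(3) by (auto simp: in_keys_iff lookup_var_mult_deriv)
          ultimately show "w m \<le> Q * D" using bound[OF i 3(2,1), of m2] by (simp add: m w_add)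
        next
          fix m assume "m \<in> keys (mp_deriv i (h t))"
          then have "m + single i 1 \<in> keys f" by (auto simp: in_keys_iff lookup_mp_deriv f_def)
          from w_le[OF this] have "w m + Q \<le> Q * D"
            using False by (simp add: w_add) (simp add: w_def lookup_single)
          then show "w m \<le> Q * D - Q" by simp
        next
          show "Q * D + (Q * D - Q) < w (a + a)" using Q D by (simp add: w_add aw)
        qed
      qed (simp_all add: mp_deriv_eq_0_if_degree_0)
      then show ?thesis using False by simp
    qed
  qed simp
  also have "\<dots> = (of_nat (lookup a t) * lookup f a) * (of_nat (lookup a t) * lookup f a)"
    using t by simp
  finally have "of_nat (lookup a t) * lookup f a = 0" by simp
  then show False using at a by (auto simp: leading_def in_keys_iff)
qed

text \<open>The components are treated by decreasing degree: those of larger degree are already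
  settled, those of smaller degree are covered by the weight argument. Once
  \<open>mp_deriv t (h t)\<close> vanishes, parallelism with some nonzero partial derivative of
  \<open>h t\<close> extends this to every \<open>h a\<close>.\<close>

lemma deriv_eq_0_of_distinct_degrees:
  fixes h :: "nat \<Rightarrow> 'a::{idom,ring_char_0} mpol"
  assumes h: "\<And>a. a < n \<Longrightarrow> h a \<in> mp_in n"
    and par: "\<And>a b i j. a < n \<Longrightarrow> b < n \<Longrightarrow> i < n \<Longrightarrow> j < n \<Longrightarrow>
      mp_deriv i (h a) * mp_deriv j (h b) = mp_deriv j (h a) * mp_deriv i (h b)"
    and sq: "\<And>t. t < n \<Longrightarrow> (\<Sum>i<n. mp_deriv t (h i) * mp_deriv i (h t)) = 0"
    and deg: "\<And>i j. i < n \<Longrightarrow> j < n \<Longrightarrow> i \<noteq> j \<Longrightarrow> mp_degree (h i) = mp_degree (h j) \<Longrightarrow> mp_degree (h i) = 0"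
    and "t < n" "mp_degree (h t) \<noteq> 0" "a < n"
  shows "mp_deriv t (h a) = 0"
proof -
  define M where "M = Max ((\<lambda>i. mp_degree (h i)) ` {..<n})"
  have M: "mp_degree (h i) \<le> M" if "i < n" for i using that by (simp add: M_def)
  show ?thesis
    using assms(5-7)
  proof (induction "M - mp_degree (h t)" arbitrary: t a rule: less_induct)
    case less
    have "mp_deriv t (h t) = 0"
    proof (rule deriv_eq_0_of_square_zero[OF h par less.prems(1) sq])
      fix i assume i: "i < n" "i \<noteq> t"
      show "mp_degree (h i) = 0 \<or> mp_degree (h i) < mp_degree (h t) \<or> mp_deriv i (h t) = 0"
      proof (cases "mp_degree (h i) > mp_degree (h t)")
        case True
        then show ?thesis using less.hyps[of i t] less.prems M[OF i(1)] i(1) by auto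
      next
        case False
        then show ?thesis using deg[OF i(1) less.prems(1) i(2)] by linarith
      qed
    qed (use less.prems in auto)
    moreover obtain j where "j < n" "mp_deriv j (h t) \<noteq> 0"
    proof (rule ccontr)
      assume "\<not> thesis"
      then have "h t \<in> mp_in 0" using that h[OF less.prems(1)] by (intro mp_in_if_deriv_0[of _ n 0]) auto
      then have "mp_degree (h t) \<le> 0" by (intro mp_degree_leI) (auto simp: mp_in_def)
      then show False using less.prems by simp
    qed
    ultimately show ?case
      using par[of t a t j] less.prems by simp
  qed
qed

section \<open>Nilpotent operators of rank one and two\<close>

context vector_space
begin

text \<open>Iterating the relation makes x a multiple of \<open>(L ^^ j) x\<close> for every j, in
  particular for j = k.\<close>

lemma nilpotent_no_eigenvector:
  assumes L_scale: "\<And>c x. L (c *s x) = c *s L x"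
    and nil: "\<And>v. (L ^^ k) v = 0" and "x = c *s L x"
  shows "x = 0"
proof -
  have "\<exists>d. x = d *s (L ^^ j) x" for j
  proof (induction j)
    case 0
    show ?case by (intro exI[of _ 1]) simp
  next
    case (Suc j)
    then obtain d where d: "x = d *s (L ^^ j) x" by blast
    have "x = c *s L (d *s (L ^^ j) x)" using assms(3) d by simp
    then show ?case by (intro exI[of _ "c * d"]) (simp add: L_scale)
  qed
  from this[of k] show ?thesis by (auto simp: nil)
qed

text \<open>If \<open>L (L v)\<close> were nonzero, then \<open>L v\<close>, lying on the same line,
  would be a multiple of it, that is, an eigenvector with nonzero eigenvalue.\<close>

lemma nilpotent_rank_1:
  assumes L_scale: "\<And>c x. L (c *s x) = c *s L x"
    and nil: "\<And>v. (L ^^ k) v = 0" and range: "\<And>y. \<exists>c. L y = c *s U"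
  shows "L (L v) = 0"
proof (rule ccontr)
  assume nz: "L (L v) \<noteq> 0"
  obtain c d where c: "L v = c *s U" and d: "L (L v) = d *s U" using range by metis
  from nz d have "d \<noteq> 0" by auto
  then have "L v = (c / d) *s L (L v)" by (simp add: c[symmetric] d)
  from nilpotent_no_eigenvector[OF L_scale nil this] nz show False using L_scale[of 0 0] by simp
qed

text \<open>The vectors \<open>L a\<close> and \<open>L (L a)\<close> are independent, since
  otherwise \<open>L a\<close> would be an eigenvector or zero. Lying in the span of U and U', they
  generate every value of L.\<close>

lemma nilpotent_rank_2_range:
  assumes L_scale: "\<And>c x. L (c *s x) = c *s L x"
    and nil: "\<And>v. (L ^^ k) v = 0" and range: "\<And>y. \<exists>c d. L y = c *s U + d *s U'"
    and nz: "L (L a) \<noteq> 0"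
  shows "\<exists>c d. L y = c *s L (L a) + d *s L a"
proof -
  have indep: "c = 0 \<and> d = 0" if "c *s L a = d *s L (L a)" for c d
  proof (cases "c = 0")
    case True
    then show ?thesis using that nz by auto
  next
    case False
    have "L a = (1 / c) *s (c *s L a)" using False by simp
    also have "\<dots> = (d / c) *s L (L a)" unfolding that by simp
    finally have "L a = 0" using nilpotent_no_eigenvector[OF L_scale nil] by blast
    then show ?thesis using nz L_scale[of 0 0] by simp
  qed
  define p where "p = L a"
  define q where "q = L p"
  have q0: "q \<noteq> 0" and L0: "L 0 = 0" using nz L_scale[of 0 0] by (simp_all add: p_def q_def)
  have indep: "c = 0 \<and> d = 0" if "c *s p = d *s q" for c d
    using indep[of c d] that unfolding p_def q_def by blast
  obtain x1 x2 y1 y2 z1 z2 where x: "p = x1 *s U + x2 *s U'" and y: "q = y1 *s U + y2 *s U'"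
    and z: "L y = z1 *s U + z2 *s U'"
    using range unfolding p_def q_def by metis
  define D where "D = x1 * y2 - x2 * y1"
  have D: "D \<noteq> 0"
  proof
    assume "D = 0"
    then have "y2 *s p = x2 *s q" "y1 *s p = x1 *s q"
      by (simp_all add: x y D_def scale_right_distrib mult.commute)
    then have "x1 = 0" "x2 = 0" using indep by blast+
    then have "p = 0" by (simp add: x)
    then show False using q0 L0 by (simp add: q_def)
  qed
  \<comment> \<open>Cramer's rule in the coordinates with respect to U and U'.\<close>
  have "D *s L y = (z2 * x1 - z1 * x2) *s q + (z1 * y2 - z2 * y1) *s p"
    unfolding x y z by (simp add: D_def scale_right_distrib scale_left_diff_distrib algebra_simps)
  then have "(1 / D) *s (D *s L y) = (1 / D) *s ((z2 * x1 - z1 * x2) *s q + (z1 * y2 - z2 * y1) *s p)"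
    by simp
  then have "L y = (1 / D * (z2 * x1 - z1 * x2)) *s q + (1 / D * (z1 * y2 - z2 * y1)) *s p"
    using D by (simp only: scale_scale scale_right_distrib) simp
  then show ?thesis unfolding q_def p_def by blast
qed

text \<open>Otherwise \<open>nilpotent_rank_2_range\<close> at \<open>L a\<close> writes x = L a as
  a combination of \<open>L x\<close> and \<open>L (L x)\<close>. The last iterate of L that does
  not kill x kills this combination, a contradiction.\<close>

lemma nilpotent_rank_2_cube:
  assumes L_add: "\<And>x y. L (x + y) = L x + L y" and L_scale: "\<And>c x. L (c *s x) = c *s L x"
    and nil: "\<And>v. (L ^^ k) v = 0" and range: "\<And>y. \<exists>c d. L y = c *s U + d *s U'"
  shows "L (L (L a)) = 0"
proof (rule ccontr)
  assume nz: "L (L (L a)) \<noteq> 0"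
  define x where "x = L a"
  have L0: "L 0 = 0" using L_scale[of 0 0] by simp
  have pow0: "(L ^^ j) 0 = 0" for j by (induction j) (simp_all add: L0)
  obtain c d where x: "x = c *s L (L x) + d *s L x"
    using nilpotent_rank_2_range[OF L_scale nil range, of "L a" a] nz by (auto simp: x_def)
  define j where "j = (LEAST j. (L ^^ j) x = 0)"
  have j: "(L ^^ j) x = 0" using LeastI[of "\<lambda>j. (L ^^ j) x = 0" k] nil by (simp add: j_def)
  have "j \<noteq> 0" using j nz by (intro notI) (simp add: x_def L0)
  then obtain i where i: "j = Suc i" by (cases j) auto
  have add: "(L ^^ i) (x + y) = (L ^^ i) x + (L ^^ i) y" and scale: "(L ^^ i) (c *s x) = c *s (L ^^ i) x" for x y c
    by (induction i) (simp_all add: L_add L_scale)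
  have i1: "(L ^^ i) (L x) = 0" using j by (simp add: i funpow_swap1)
  have "(L ^^ i) (L (L x)) = L ((L ^^ i) (L x))" by (simp add: funpow_swap1)
  then have "(L ^^ i) x = 0"
    by (subst x) (simp only: add scale i1 L0 scale_zero_right add_0)
  then have "j \<le> i" unfolding j_def by (rule Least_le)
  then show False using i by simp
qed

end

text \<open>
  If every operator of the linear system \<open>L + B y\<close> annihilates all squares of operators of the
  system, then modulo the common kernel the bilinear map \<open>(x, y, v) \<mapsto> B x (B y v)\<close> is
  antisymmetric in the first two and symmetric in the last two arguments, hence zero.
\<close>

lemma fourfold_products_zero:
  fixes L :: "'v::ab_group_add \<Rightarrow> 'v" and B :: "'v \<Rightarrow> 'v \<Rightarrow> 'v"
  assumes tors: "\<And>x :: 'v. x + x = 0 \<Longrightarrow> x = 0"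
    and L_add: "\<And>x y. L (x + y) = L x + L y"
    and B_add: "\<And>x y z. B x (y + z) = B x y + B x z" and B_sym: "\<And>x y. B x y = B y x"
    and sq: "\<And>P \<xi> v. P \<in> insert L (range B) \<Longrightarrow> P (L (L v + B \<xi> v) + B \<xi> (L v + B \<xi> v)) = 0"
    and P: "P \<in> insert L (range B)" "Q \<in> insert L (range B)" "R \<in> insert L (range B)" "S \<in> insert L (range B)"
  shows "P (Q (R (S v))) = 0"
proof -
  have add: "P (x + y) = P x + P y" if "P \<in> insert L (range B)" for P x y
    using that L_add B_add by auto
  have Bl: "B (x + y) z = B x z + B y z" for x y z using B_add B_sym by metis
  have B0: "B x 0 = 0" for x using B_add[of x 0 0] by simp
  have Bm: "B x (- y) = - B x y" for x y using B_add[of x y "- y"] by (simp add: B0 eq_neg_iff_add_eq_0 add.commute)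
  have Bml: "B (- x) y = - B x y" for x y using Bm B_sym by metis
  have min: "P (- x) = - P x" if "P \<in> insert L (range B)" for P x
    using add[OF that, of x "- x"] add[OF that, of 0 0] by (simp add: eq_neg_iff_add_eq_0 add.commute)
  define Z where "Z = {z. \<forall>P \<in> insert L (range B). P z = 0}"
  have Z0: "P z = 0" if "z \<in> Z" "P \<in> insert L (range B)" for P z using that by (auto simp: Z_def)
  have Z_add: "x + y \<in> Z" if "x \<in> Z" "y \<in> Z" for x y using that by (auto simp: Z_def L_add B_add)
  have Z_min: "- x \<in> Z" if "x \<in> Z" for x
    unfolding Z_def
  proof (rule CollectI, rule ballI)
    fix P assume P: "P \<in> insert L (range B)"
    show "P (- x) = 0" using min[OF P, of x] Z0[OF that P] by simp
  qed
  have Z_diff: "x - y \<in> Z" if "x \<in> Z" "y \<in> Z" for x y using Z_add[OF that(1) Z_min[OF that(2)]] by simp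
  have Z_half: "x \<in> Z" if "x + x \<in> Z" for x
    unfolding Z_def
  proof (rule CollectI, rule ballI)
    fix P assume P: "P \<in> insert L (range B)"
    show "P x = 0" using Z0[OF that P] by (subst (asm) add[OF P]) (rule tors)
  qed
  have Z_sq: "L (L v) + L (B \<xi> v) + (B \<xi> (L v) + B \<xi> (B \<xi> v)) \<in> Z" for \<xi> v
    unfolding Z_def using sq[of _ v \<xi>] unfolding L_add[of "L v"] B_add[of \<xi> "L v"] by blast
  have LL: "L (L v) \<in> Z" for v
    using Z_sq[of v 0] B_sym[of 0] by (simp add: B0 L_add[of 0 0, simplified])
  \<comment> \<open>Replacing \<open>\<xi>\<close> by its negative separates the parts of degree one
    and two in \<open>\<xi>\<close>.\<close>
  have mixed: "L (B \<xi> v) + B \<xi> (L v) \<in> Z" and BB: "B \<xi> (B \<xi> v) \<in> Z" for \<xi> v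
  proof -
    let ?p = "L (L v) + L (B \<xi> v) + (B \<xi> (L v) + B \<xi> (B \<xi> v))"
    let ?m = "L (L v) + L (B (- \<xi>) v) + (B (- \<xi>) (L v) + B (- \<xi>) (B (- \<xi>) v))"
    have m: "?m = L (L v) - L (B \<xi> v) + (- B \<xi> (L v) + B \<xi> (B \<xi> v))"
      by (simp add: Bml Bm min)
    have "?p + ?m - L (L v) - L (L v) \<in> Z"
      by (rule Z_diff[OF Z_diff[OF Z_add[OF Z_sq Z_sq] LL] LL])
    then show "B \<xi> (B \<xi> v) \<in> Z" unfolding m by - (rule Z_half, simp add: algebra_simps)
    have "?p - ?m \<in> Z" by (rule Z_diff[OF Z_sq Z_sq])
    then show "L (B \<xi> v) + B \<xi> (L v) \<in> Z" unfolding m by - (rule Z_half, simp add: algebra_simps)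
  qed
  have BB': "B x (B y v) \<in> Z" for x y v
  proof -
    have anti: "P (B x (B y v)) = - P (B y (B x v))" if "P \<in> insert L (range B)" for P x y v
    proof -
      have "B (x + y) (B (x + y) v) - B x (B x v) - B y (B y v) \<in> Z"
        by (rule Z_diff[OF Z_diff[OF BB BB] BB])
      then have "B x (B y v) + B y (B x v) \<in> Z" by (simp add: Bl B_add algebra_simps)
      from Z0[OF this that] show ?thesis by (simp add: add[OF that] eq_neg_iff_add_eq_0)
    qed
    have "P (B x (B y v)) = 0" if P: "P \<in> insert L (range B)" for P
    proof (rule tors)
      \<comment> \<open>Three antisymmetric swaps, alternating with the symmetry of B, lead back to
        the same expression with the opposite sign.\<close>
      have "P (B x (B y v)) = - P (B y (B v x))" using anti[OF P, of x y v] by (simp add: B_sym[of x v])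
      also have "\<dots> = P (B v (B x y))" using anti[OF P, of y v x] by (simp add: B_sym[of y x])
      also have "\<dots> = - P (B x (B y v))" using anti[OF P, of v x y] by (simp add: B_sym[of v y])
      finally show "P (B x (B y v)) + P (B x (B y v)) = 0" by (simp only: eq_neg_iff_add_eq_0)
    qed
    then show ?thesis by (simp add: Z_def)
  qed
  have zero: "P z = 0" if "z \<in> Z" "P \<in> insert L (range B)" for z P using that by (simp add: Z0)
  have zero_in: "(0::'v) \<in> Z" using LL[of 0] L_add[of 0 0] by simp
  \<comment> \<open>Two adjacent factors of the same kind have values in the common kernel Z. In the
    alternating products, \<open>mixed\<close> swaps two factors modulo Z and creates such a
    pair.\<close>
  have "Q (R (S v)) \<in> Z"
  proof -
    consider x y where "Q = B x" "R = B y" | "Q = L" "R = L"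
      | x where "Q = B x" "R = L" "S = L" | x y where "Q = B x" "R = L" "S = B y"
      | x y where "Q = L" "R = B x" "S = B y" | x where "Q = L" "R = B x" "S = L"
      using P by blast
    then show ?thesis
    proof cases
      case 3
      then show ?thesis using zero[OF LL[of v], of "B x"] zero_in by simp
    next
      case (4 x y)
      have "B x (L (B y v)) = B x ((L (B y v) + B y (L v)) + - B y (L v))" by simp
      also have "\<dots> = - B x (B y (L v))"
        using zero[OF mixed[of y v], of "B x"] by (simp only: B_add Bm) simp
      finally show ?thesis using 4 BB' Z_min by simp
    next
      case (5 x y)
      then show ?thesis using zero[OF BB'[of x y v], of L] zero_in by simp
    next
      case (6 x)
      have "L (B x (L v)) = L ((L (B x v) + B x (L v)) + - L (B x v))" by simp
      also have "\<dots> = - L (L (B x v))"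
        using zero[OF mixed[of x v], of L] min[of L] by (simp only: L_add) simp
      finally show ?thesis using 6 LL Z_min by simp
    qed (simp_all add: BB' LL)
  qed
  then show ?thesis using P(1) by (simp add: Z0)
qed

section \<open>Generators of the column space\<close>

context vec_space
begin

text \<open>A maximal independent set of columns spans the column space and has as many elements as
  the rank.\<close>

lemma rank_generators:
  assumes "A \<in> carrier_mat n nc"
  obtains S where "finite S" "card S = rank A" "S \<subseteq> carrier_vec n"
    "\<And>v. v \<in> carrier_vec nc \<Longrightarrow> A *\<^sub>v v \<in> span S"
proof -
  have cols: "set (cols A) \<subseteq> carrier_vec n" using assms cols_dim[of A] by auto
  let ?P = "\<lambda>T. T \<subseteq> set (cols A) \<and> lin_indpt T"
  have "\<exists>S. finite S \<and> maximal S ?P \<and> {} \<subseteq> S"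
  proof (rule maximal_exists_superset)
    show "finite (set (cols A))" by (rule finite_set)
    show "{} \<subseteq> set (cols A) \<and> lin_indpt {}" by (simp add: lin_dep_def)
  qed (rule conjunct1)
  then obtain S where S: "finite S" "maximal S ?P" by (elim exE conjE)
  have sub: "S \<subseteq> set (cols A)" and li: "lin_indpt S" using S(2) by (auto simp: maximal_def)
  have Sc: "S \<subseteq> carrier_vec n" using sub cols by blast
  have "set (cols A) \<subseteq> span S"
  proof
    fix v assume v: "v \<in> set (cols A)"
    show "v \<in> span S"
    proof (cases "v \<in> S")
      case True
      then show ?thesis using in_own_span[OF Sc] by blast
    next
      case False
      have "lin_dep (S \<union> {v})"
      proof (rule ccontr)
        assume "lin_indpt (S \<union> {v})"
        moreover have "S \<subseteq> S \<union> {v}" "S \<union> {v} \<subseteq> set (cols A)" using v sub by auto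
        ultimately have "S \<union> {v} = S" using S(2)[unfolded maximal_def, THEN conjunct2, THEN spec, of "S \<union> {v}"] \<open>lin_indpt (S \<union> {v})\<close> by blast
        with False show False by blast
      qed
      moreover have "v \<in> span S \<longleftrightarrow> lin_dep (S \<union> {v})"
        by (rule lin_dep_iff_in_span[OF _ li _ False]) (use Sc v cols in \<open>simp_all add: subset_iff\<close>)
      ultimately show ?thesis by (simp only:)
    qed
  qed
  then have sub_span: "span (set (cols A)) \<subseteq> span S" by (rule span_subsetI[OF Sc])
  have mem: "A *\<^sub>v v \<in> span (set (cols A))" if "v \<in> carrier_vec nc" for v
  proof -
    have "A *\<^sub>v v \<in> col_space A"
      unfolding col_space_eq[OF assms] using that assms by (intro CollectI conjI bexI[of _ v]) auto
    then show ?thesis by (simp only: col_space_def)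
  qed
  show thesis
  proof (rule that[of S])
    show "card S = rank A" using rank_card_indpt[OF assms S(2)] by simp
    show "A *\<^sub>v v \<in> span S" if "v \<in> carrier_vec nc" for v using mem[OF that] sub_span by (rule subsetD[rotated])
  qed (use S Sc in simp_all)
qed

lemma span_index:
  assumes "v \<in> span S" "S \<subseteq> carrier_vec n" "finite S"
  obtains c where "\<And>i. i < n \<Longrightarrow> v $ i = (\<Sum>u\<in>S. c u * u $ i)"
proof -
  obtain c where v: "v = lincomb c S" using assms(1) unfolding finite_span[OF assms(3), simplified, OF assms(2)] by blast
  show thesis
  proof (rule that)
    fix i assume "i < n"
    then show "v $ i = (\<Sum>u\<in>S. c u * u $ i)" unfolding v using assms(2) by (rule lincomb_index)
  qed
qed

end

section \<open>Jacobians of rank one\<close>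

definition coeff_mat :: "nat \<Rightarrow> 'a::comm_ring_1 mpol vec \<Rightarrow> (nat \<Rightarrow>\<^sub>0 nat) \<Rightarrow> 'a mat" where
  "coeff_mat n H m = mat n n (\<lambda>(i, j). lookup (mp_deriv j (H $ i)) m)"

text \<open>The coefficient of a monomial in S J T is S M T, where M is its coefficient matrix in J;
  so one flag adapted to all coefficient matrices triangularizes J.\<close>

lemma triangularizing_if_products_zero:
  fixes H :: "'a::field mpol vec"
  assumes nil: "\<And>ms v. length ms = N \<Longrightarrow> v \<in> carrier_vec n \<Longrightarrow>
      foldr (\<lambda>m. (*\<^sub>v) (coeff_mat n H m)) ms v = 0\<^sub>v n"
  obtains S T where "triangularizing n S T H"
proof -
  interpret vec_space "TYPE('a)" n .
  have "foldr (*\<^sub>v) As v = 0\<^sub>v n"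
    if As: "set As \<subseteq> range (coeff_mat n H)" "length As = N" and v: "v \<in> carrier_vec n" for As v
  proof -
    have "\<exists>ms. As = map (coeff_mat n H) ms" unfolding ex_map_conv using As(1) by blast
    then obtain ms where "As = map (coeff_mat n H) ms" by blast
    then show ?thesis using nil[of ms v] As(2) v by (simp add: foldr_map o_def)
  qed
  moreover have "range (coeff_mat n H) \<subseteq> carrier_mat n n" by (auto simp: coeff_mat_def)
  ultimately obtain S T where ST: "S \<in> carrier_mat n n" "T \<in> carrier_mat n n" "S * T = 1\<^sub>m n" "T * S = 1\<^sub>m n"
    and tri: "\<And>m i j. m \<in> range (coeff_mat n H) \<Longrightarrow> i \<le> j \<Longrightarrow> j < n \<Longrightarrow> (S * (m * T)) $$ (i, j) = 0"
    by (elim nilpotent_flag[of "range (coeff_mat n H)" N, rotated -1])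
  have "(\<Sum>k<n. \<Sum>l<n. mp_const (S $$ (i, k) * T $$ (l, j)) * mp_deriv l (H $ k)) = 0"
    if "i \<le> j" "j < n" for i j
  proof (rule poly_mapping_eqI)
    fix m
    let ?M = "coeff_mat n H m"
    have M: "?M \<in> carrier_mat n n" by (simp add: coeff_mat_def)
    have MT: "?M * T \<in> carrier_mat n n" using M ST(2) by (rule mult_carrier_mat)
    have "i < n" using that by simp
    have "lookup (\<Sum>k<n. \<Sum>l<n. mp_const (S $$ (i, k) * T $$ (l, j)) * mp_deriv l (H $ k)) m
        = (\<Sum>k<n. S $$ (i, k) * (\<Sum>l<n. ?M $$ (k, l) * T $$ (l, j)))"
      by (simp add: lookup_sum lookup_mp_const_mult sum_distrib_left coeff_mat_def) (simp add: ac_simps)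
    also have "\<dots> = (S * (?M * T)) $$ (i, j)"
      by (simp add: index_mult_eq_sum[OF ST(1) MT \<open>i < n\<close> that(2)] index_mult_eq_sum[OF M ST(2) _ that(2)]
          del: index_mult_mat)
    also have "\<dots> = 0" using tri that by blast
    finally show "lookup (\<Sum>k<n. \<Sum>l<n. mp_const (S $$ (i, k) * T $$ (l, j)) * mp_deriv l (H $ k)) m = lookup 0 m"
      by simp
  qed
  then have "triangularizing n S T H" using ST unfolding triangularizing_def by simp
  then show thesis by (rule that)
qed

text \<open>Choose c to cancel the coefficient of f at the leading exponent b of g. If the degree
  did not drop, the leading exponent of the sum would be parallel to b and of the same degree, hence
  equal to b, where the coefficient is now zero.\<close>

lemma same_degree_cancel:
  fixes f g :: "'a::field_char_0 mpol"
  assumes f: "f \<in> mp_in n" and g: "g \<in> mp_in n"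
    and par: "\<And>i j. i < n \<Longrightarrow> j < n \<Longrightarrow> mp_deriv i f * mp_deriv j g = mp_deriv j f * mp_deriv i g"
    and deg: "mp_degree f = mp_degree g" "mp_degree f \<noteq> 0"
  obtains c where "mp_degree (f + mp_const c * g) < mp_degree f"
proof -
  interpret additive_weights monom_degree "\<lambda>_. 0"
    by unfold_locales (simp_all add: monom_degree_add)
  have lead_deg: "monom_degree a = mp_degree p" if a: "leading monom_degree (\<lambda>_. 0) p a" and nz: "mp_degree p \<noteq> 0" for p :: "'a mpol" and a
  proof -
    obtain m where "m \<in> keys p" "monom_degree m = mp_degree p" using mp_degree_attained[of p] nz by auto
    then show ?thesis using a monom_degree_le[of a p] by (fastforce simp: leading_def)
  qed
  have "g \<noteq> 0" using deg by auto
  then obtain b where b: "leading monom_degree (\<lambda>_. 0) g b" using leading_exists by blast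
  define c where "c = - (lookup f b / lookup g b)"
  define p where "p = f + mp_const c * g"
  have "lookup g b \<noteq> 0" using b by (simp add: leading_def in_keys_iff)
  then have pb: "lookup p b = 0" by (simp add: p_def c_def lookup_add lookup_mp_const_mult)
  have p_in: "p \<in> mp_in n" unfolding p_def using f g by (intro mp_in_add mp_in_mult mp_in_const)
  have par_p: "mp_deriv i p * mp_deriv j g = mp_deriv j p * mp_deriv i g" if "i < n" "j < n" for i j
    unfolding p_def mp_deriv_add mp_deriv_const_mult distrib_right par[OF that] by (simp add: ac_simps)
  have "mp_degree p \<le> mp_degree f"
    unfolding p_def using deg by (intro mp_degree_add_le mp_degree_const_mult_le) simp_all
  moreover have "mp_degree p \<noteq> mp_degree f"
  proof
    assume eq: "mp_degree p = mp_degree f"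
    then have "p \<noteq> 0" using deg by auto
    then obtain a where a: "leading monom_degree (\<lambda>_. 0) p a" using leading_exists by blast
    have da: "monom_degree a = mp_degree f" and db: "monom_degree b = mp_degree f"
      using lead_deg[OF a] lead_deg[OF b] eq deg by simp_all
    have ka: "keys a \<subseteq> {..<n}" using a p_in by (auto simp: leading_def mp_in_def)
    have kb: "keys b \<subseteq> {..<n}" using b g by (auto simp: leading_def mp_in_def)
    have "a = b"
    proof (rule poly_mapping_eqI)
      fix i
      show "lookup a i = lookup b i"
      proof (cases "i < n")
        case True
        have "lookup a i * monom_degree b = monom_degree a * lookup b i"
          unfolding monom_degree_superset[OF finite_lessThan ka] monom_degree_superset[OF finite_lessThan kb]
            sum_distrib_left sum_distrib_right
          using leading_parallel[OF a b] par_p True by (intro sum.cong) auto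
        then show ?thesis using da db deg(2) by simp
      next
        case False
        then have "i \<notin> keys a" "i \<notin> keys b" using ka kb by auto
        then show ?thesis by (simp add: in_keys_iff)
      qed
    qed
    then show False using a pb by (simp add: leading_def in_keys_iff)
  qed
  ultimately show thesis using that[of c] by (simp add: p_def)
qed

text \<open>Take an invertible S for which the total degree of the components of S H is least: two
  components of equal positive degree could be combined by an elementary row operation that lowers
  the total.\<close>

lemma distinct_degree_combinations:
  fixes H :: "'a::field_char_0 mpol vec"
  assumes H: "\<forall>k<n. H $ k \<in> mp_in n"
    and minors: "\<And>a b i j. a < n \<Longrightarrow> b < n \<Longrightarrow> i < n \<Longrightarrow> j < n \<Longrightarrow>
      mp_deriv i (H $ a) * mp_deriv j (H $ b) = mp_deriv j (H $ a) * mp_deriv i (H $ b)"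
  obtains S T where "S \<in> carrier_mat n n" "T \<in> carrier_mat n n" "S * T = 1\<^sub>m n" "T * S = 1\<^sub>m n"
    "\<And>a b. a < n \<Longrightarrow> b < n \<Longrightarrow> a \<noteq> b \<Longrightarrow>
      mp_degree (\<Sum>k<n. mp_const (S $$ (a, k)) * H $ k) = mp_degree (\<Sum>k<n. mp_const (S $$ (b, k)) * H $ k) \<Longrightarrow>
      mp_degree (\<Sum>k<n. mp_const (S $$ (a, k)) * H $ k) = 0"
proof -
  define G where "G S a = (\<Sum>k<n. mp_const (S $$ (a, k)) * H $ k)" for S :: "'a mat" and a
  define P where "P S \<longleftrightarrow> (\<exists>T. S \<in> carrier_mat n n \<and> T \<in> carrier_mat n n \<and> S * T = 1\<^sub>m n \<and> T * S = 1\<^sub>m n)" for S :: "'a mat"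
  have "P (1\<^sub>m n)" unfolding P_def by (intro exI[of _ "1\<^sub>m n"]) simp
  then obtain S where "P S" and min: "\<And>S'. P S' \<Longrightarrow> (\<Sum>a<n. mp_degree (G S a)) \<le> (\<Sum>a<n. mp_degree (G S' a))"
    using ex_has_least_nat[of P "1\<^sub>m n" "\<lambda>S. \<Sum>a<n. mp_degree (G S a)"] by blast
  then obtain T where ST: "S \<in> carrier_mat n n" "T \<in> carrier_mat n n" "S * T = 1\<^sub>m n" "T * S = 1\<^sub>m n"
    unfolding P_def by blast
  have par: "mp_deriv i (G S a) * mp_deriv j (G S b) = mp_deriv j (G S a) * mp_deriv i (G S b)"
    if "i < n" "j < n" for a b i j
    unfolding G_def using minors that by (intro row_combinations_parallel)
  have "mp_degree (G S a) = 0" if ab: "a < n" "b < n" "a \<noteq> b" and eq: "mp_degree (G S a) = mp_degree (G S b)" for a b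
  proof (rule ccontr)
    assume nz: "mp_degree (G S a) \<noteq> 0"
    have in_n: "G S a \<in> mp_in n" for a unfolding G_def by (rule mp_in_row) (rule H)
    obtain c where c: "mp_degree (G S a + mp_const c * G S b) < mp_degree (G S a)"
      using same_degree_cancel[OF in_n in_n par eq nz] by blast
    let ?E = "addrow_mat n c a b"
    let ?S = "?E * S" and ?T = "T * addrow_mat n (- c) a b"
    have E: "?E \<in> carrier_mat n n" "addrow_mat n (- c) a b \<in> carrier_mat n n" by simp_all
    have EE: "?E * addrow_mat n (- c) a b = 1\<^sub>m n" "addrow_mat n (- c) a b * ?E = 1\<^sub>m n"
      using addrow_mat_inv[OF ab, of c] addrow_mat_inv[OF ab, of "- c"] by simp_all
    have carr: "?S \<in> carrier_mat n n" "?T \<in> carrier_mat n n"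
      using E ST(1,2) by (simp_all add: mult_carrier_mat[of _ n n _ n])
    have "?S * ?T = ?E * (S * ?T)" by (rule assoc_mult_mat[OF E(1) ST(1) carr(2)])
    also have "S * ?T = (S * T) * addrow_mat n (- c) a b"
      by (rule assoc_mult_mat[OF ST(1,2) E(2), symmetric])
    finally have 1: "?S * ?T = 1\<^sub>m n" using ST EE by simp
    have "?T * ?S = T * (addrow_mat n (- c) a b * ?S)" by (rule assoc_mult_mat[OF ST(2) E(2) carr(1)])
    also have "addrow_mat n (- c) a b * ?S = (addrow_mat n (- c) a b * ?E) * S"
      by (rule assoc_mult_mat[OF E(2,1) ST(1), symmetric])
    finally have 2: "?T * ?S = 1\<^sub>m n" using ST EE by simp
    have "P ?S" unfolding P_def using carr 1 2 by blast
    have row: "G ?S a' = (if a' = a then G S a + mp_const c * G S b else G S a')" if "a' < n" for a'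
    proof -
      have "?S $$ (a', k) = (if a' = a then c * S $$ (b, k) + S $$ (a, k) else S $$ (a', k))" if "k < n" for k
        using \<open>a' < n\<close> that ab ST(1) by (simp add: addrow_mat[OF ST(1) ab(2), symmetric])
      then show ?thesis
        by (auto simp: G_def mp_const.hom_add mp_const.hom_mult sum_distrib_left sum.distrib algebra_simps
            simp del: index_mult_mat)
    qed
    have "(\<Sum>a<n. mp_degree (G ?S a)) < (\<Sum>a<n. mp_degree (G S a))"
      using ab c by (intro sum_strict_mono_ex1) (auto simp: row intro!: bexI[of _ a])
    then show False using min[OF \<open>P ?S\<close>] by simp
  qed
  then show thesis by (intro that[OF ST]) (simp only: G_def)
qed

text \<open>For each t, either the t-th component of S H is constant or the t-th column of J T
  vanishes. Inserting T S = 1 between two coefficient matrices of J, every term has a zero factor,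
  so all products of two coefficient matrices vanish.\<close>

lemma triangularizing_rank_1:
  fixes H :: "'a::field_char_0 mpol vec"
  assumes H: "\<forall>k<n. H $ k \<in> mp_in n"
    and minors: "\<And>a b i j. a < n \<Longrightarrow> b < n \<Longrightarrow> i < n \<Longrightarrow> j < n \<Longrightarrow>
      mp_deriv i (H $ a) * mp_deriv j (H $ b) = mp_deriv j (H $ a) * mp_deriv i (H $ b)"
    and sq: "\<And>a k. a < n \<Longrightarrow> k < n \<Longrightarrow> (\<Sum>j<n. mp_deriv j (H $ a) * mp_deriv k (H $ j)) = 0"
  obtains S T where "triangularizing n S T H"
proof -
  obtain S T where S: "S \<in> carrier_mat n n" and T: "T \<in> carrier_mat n n" and inv: "S * T = 1\<^sub>m n" "T * S = 1\<^sub>m n"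
    and dist: "\<And>a b. a < n \<Longrightarrow> b < n \<Longrightarrow> a \<noteq> b \<Longrightarrow>
      mp_degree (\<Sum>k<n. mp_const (S $$ (a, k)) * H $ k) = mp_degree (\<Sum>k<n. mp_const (S $$ (b, k)) * H $ k) \<Longrightarrow>
      mp_degree (\<Sum>k<n. mp_const (S $$ (a, k)) * H $ k) = 0"
  proof (rule distinct_degree_combinations[OF H])
    fix a b i j assume "a < n" "b < n" "i < n" "j < n"
    then show "mp_deriv i (H $ a) * mp_deriv j (H $ b) = mp_deriv j (H $ a) * mp_deriv i (H $ b)"
      by (rule minors)
  next
    fix S T
    assume "S \<in> carrier_mat n n" "T \<in> carrier_mat n n" "S * T = 1\<^sub>m n" "T * S = 1\<^sub>m n"
      and "\<And>a b. a < n \<Longrightarrow> b < n \<Longrightarrow> a \<noteq> b \<Longrightarrow>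
        mp_degree (\<Sum>k<n. mp_const (S $$ (a, k)) * H $ k) = mp_degree (\<Sum>k<n. mp_const (S $$ (b, k)) * H $ k) \<Longrightarrow>
        mp_degree (\<Sum>k<n. mp_const (S $$ (a, k)) * H $ k) = 0"
    then show thesis by (rule that)
  qed
  define G where "G a = (\<Sum>k<n. mp_const (S $$ (a, k)) * H $ k)" for a
  define h where "h a = mp_subst (lin_sub T) (G a)" for a
  \<comment> \<open>The matrix S J T; after the substitution of T x it is the Jacobian of h.\<close>
  define W where "W a i = (\<Sum>l<n. mp_const (T $$ (l, i)) * mp_deriv l (G a))" for a i
  have G_in: "G a \<in> mp_in n" for a unfolding G_def by (rule mp_in_row) (rule H)
  have h_in: "h a \<in> mp_in n" for a
    unfolding h_def using T by (intro mp_in_subst[OF G_in]) (simp add: lin_sub_def mp_in_lform)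
  have deriv_h: "mp_deriv i (h a) = mp_subst (lin_sub T) (W a i)" if "i < n" for a i
    unfolding h_def W_def by (rule mp_deriv_subst_lin_sub[OF T G_in that])
  have deg_sub: "mp_degree (mp_subst (lin_sub A) p) \<le> mp_degree p" for A :: "'a mat" and p
    by (intro mp_degree_subst_le) (simp only: lin_sub_def mp_degree_lform)
  have Gh: "mp_subst (lin_sub S) (h a) = G a" for a
    unfolding h_def by (rule mp_subst_lin_sub_inverse[OF S T inv(2) G_in])
  have deg_h: "mp_degree (h a) = mp_degree (G a)" for a
    using deg_sub[of T "G a", folded h_def] deg_sub[of S "h a", unfolded Gh] by simp
  have HG: "H $ k = (\<Sum>i<n. mp_const (T $$ (k, i)) * G i)" if "k < n" for k
    unfolding G_def by (rule row_combinations_inverse[OF S T inv(2) that, symmetric])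
  have parG: "mp_deriv i (G a) * mp_deriv j (G b) = mp_deriv j (G a) * mp_deriv i (G b)"
    if "i < n" "j < n" for a b i j
    unfolding G_def using minors that by (intro row_combinations_parallel)
  have parW: "W a i * W b j = W a j * W b i" for a b i j
  proof -
    have "W a i * W b j = (\<Sum>l<n. \<Sum>l'<n. mp_const (T $$ (l, i) * T $$ (l', j)) * (mp_deriv l (G a) * mp_deriv l' (G b)))"
      unfolding W_def sum_product by (simp add: mp_const.hom_mult ac_simps)
    also have "\<dots> = (\<Sum>l<n. \<Sum>l'<n. mp_const (T $$ (l, i) * T $$ (l', j)) * (mp_deriv l' (G a) * mp_deriv l (G b)))"
      using parG by (intro sum.cong) auto
    also have "\<dots> = (\<Sum>l'<n. \<Sum>l<n. mp_const (T $$ (l, i) * T $$ (l', j)) * (mp_deriv l' (G a) * mp_deriv l (G b)))"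
      by (rule sum.swap)
    also have "\<dots> = W a j * W b i"
      unfolding W_def sum_product by (simp add: mp_const.hom_mult ac_simps)
    finally show ?thesis .
  qed
  \<comment> \<open>A diagonal entry of (S J T)^2 = S J^2 T.\<close>
  have sqW: "(\<Sum>i<n. W i t * W t i) = 0" for t
  proof -
    have GH: "(\<Sum>l'<n. mp_deriv l' (G t) * mp_deriv l (H $ l')) = 0" if "l < n" for l
    proof -
      have "(\<Sum>l'<n. mp_deriv l' (G t) * mp_deriv l (H $ l'))
          = (\<Sum>l'<n. \<Sum>k<n. mp_const (S $$ (t, k)) * (mp_deriv l' (H $ k) * mp_deriv l (H $ l')))"
        by (simp add: G_def mp_deriv_sum mp_deriv_const_mult sum_distrib_right mult.assoc)
      also have "\<dots> = (\<Sum>k<n. mp_const (S $$ (t, k)) * (\<Sum>l'<n. mp_deriv l' (H $ k) * mp_deriv l (H $ l')))"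
        by (subst sum.swap) (simp add: sum_distrib_left)
      also have "\<dots> = 0" using sq that by simp
      finally show ?thesis .
    qed
    have "(\<Sum>i<n. W i t * W t i) = (\<Sum>i<n. \<Sum>l'<n. mp_const (T $$ (l', i)) * mp_deriv l' (G t) * W i t)"
      unfolding W_def[of t] by (simp add: sum_distrib_left sum_distrib_right ac_simps)
    also have "\<dots> = (\<Sum>l'<n. mp_deriv l' (G t) * (\<Sum>i<n. mp_const (T $$ (l', i)) * W i t))"
      by (subst sum.swap) (simp add: sum_distrib_left ac_simps)
    also have "\<dots> = (\<Sum>l'<n. mp_deriv l' (G t) * (\<Sum>l<n. mp_const (T $$ (l, t)) * mp_deriv l (H $ l')))"
    proof (rule sum.cong)
      fix l' assume "l' \<in> {..<n}"
      have "(\<Sum>i<n. mp_const (T $$ (l', i)) * W i t)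
          = (\<Sum>i<n. \<Sum>l<n. mp_const (T $$ (l, t)) * (mp_const (T $$ (l', i)) * mp_deriv l (G i)))"
        by (simp add: W_def sum_distrib_left ac_simps)
      also have "\<dots> = (\<Sum>l<n. mp_const (T $$ (l, t)) * mp_deriv l (\<Sum>i<n. mp_const (T $$ (l', i)) * G i))"
        by (subst sum.swap) (simp add: sum_distrib_left mp_deriv_sum mp_deriv_const_mult)
      also have "(\<Sum>i<n. mp_const (T $$ (l', i)) * G i) = H $ l'"
        using HG \<open>l' \<in> {..<n}\<close> by simp
      finally show "mp_deriv l' (G t) * (\<Sum>i<n. mp_const (T $$ (l', i)) * W i t)
          = mp_deriv l' (G t) * (\<Sum>l<n. mp_const (T $$ (l, t)) * mp_deriv l (H $ l'))" by simp
    qed simp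
    also have "\<dots> = (\<Sum>l'<n. \<Sum>l<n. mp_const (T $$ (l, t)) * (mp_deriv l' (G t) * mp_deriv l (H $ l')))"
      by (simp add: sum_distrib_left ac_simps)
    also have "\<dots> = (\<Sum>l<n. mp_const (T $$ (l, t)) * (\<Sum>l'<n. mp_deriv l' (G t) * mp_deriv l (H $ l')))"
      by (subst sum.swap) (simp add: sum_distrib_left)
    also have "\<dots> = 0" using GH by simp
    finally show ?thesis .
  qed
  have key: "(\<Sum>l<n. mp_const (T $$ (l, t)) * mp_deriv l (H $ k)) = 0 \<or> mp_deriv j (G t) = 0"
    if t: "t < n" "k < n" for t k j
  proof (cases "mp_degree (h t) = 0")
    case True
    then show ?thesis using mp_deriv_eq_0_if_degree_0[of "G t"] deg_h by simp
  next
    case False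
    have h0: "mp_deriv t (h a) = 0" if "a < n" for a
    proof (rule deriv_eq_0_of_distinct_degrees[where h = h and n = n])
      fix a b i j assume "i < n" "j < n"
      then show "mp_deriv i (h a) * mp_deriv j (h b) = mp_deriv j (h a) * mp_deriv i (h b)"
        by (simp only: deriv_h mp_subst.hom_mult[symmetric] parW)
    next
      fix t assume t: "t < n"
      have "(\<Sum>i<n. mp_deriv t (h i) * mp_deriv i (h t)) = mp_subst (lin_sub T) (\<Sum>i<n. W i t * W t i)"
        using t by (simp add: deriv_h mp_subst.hom_sum mp_subst.hom_mult)
      then show "(\<Sum>i<n. mp_deriv t (h i) * mp_deriv i (h t)) = 0" by (simp add: sqW)
    next
      fix a b assume "a < n" "b < n" "a \<noteq> b" "mp_degree (h a) = mp_degree (h b)"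
      then show "mp_degree (h a) = 0" using dist[of a b] unfolding deg_h G_def by blast
    qed (use h_in t False that in auto)
    have D_in: "(\<Sum>l<n. mp_const (T $$ (l, t)) * mp_deriv l (H $ k)) \<in> mp_in n"
      using H t(2) by (intro mp_in_sum mp_in_mult mp_in_const mp_in_deriv) auto
    have "mp_subst (lin_sub T) (\<Sum>l<n. mp_const (T $$ (l, t)) * mp_deriv l (H $ k))
        = mp_deriv t (mp_subst (lin_sub T) (H $ k))"
      using H t by (simp add: mp_deriv_subst_lin_sub[OF T])
    also have "mp_subst (lin_sub T) (H $ k) = (\<Sum>a<n. mp_const (T $$ (k, a)) * h a)"
      by (subst HG[OF t(2)]) (simp add: h_def mp_subst.hom_sum mp_subst.hom_mult)
    also have "mp_deriv t \<dots> = 0" by (simp add: mp_deriv_sum mp_deriv_const_mult h0)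
    finally have "mp_subst (lin_sub S) (mp_subst (lin_sub T) (\<Sum>l<n. mp_const (T $$ (l, t)) * mp_deriv l (H $ k))) = 0"
      by simp
    then show ?thesis unfolding mp_subst_lin_sub_inverse[OF S T inv(2) D_in] by simp
  qed
  have prod: "(\<Sum>l<n. lookup (mp_deriv l (H $ k)) m * lookup (mp_deriv j (H $ l)) m') = 0"
    if "k < n" for k j m m'
  proof -
    have "(\<Sum>l<n. lookup (mp_deriv l (H $ k)) m * lookup (mp_deriv j (H $ l)) m')
        = (\<Sum>l<n. \<Sum>t<n. T $$ (l, t) * lookup (mp_deriv l (H $ k)) m * lookup (mp_deriv j (G t)) m')"
    proof (rule sum.cong)
      fix l assume "l \<in> {..<n}"
      then have "lookup (mp_deriv j (H $ l)) m' = (\<Sum>t<n. T $$ (l, t) * lookup (mp_deriv j (G t)) m')"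
        by (simp add: HG[of l] mp_deriv_sum mp_deriv_const_mult lookup_sum lookup_mp_const_mult)
      then show "lookup (mp_deriv l (H $ k)) m * lookup (mp_deriv j (H $ l)) m'
          = (\<Sum>t<n. T $$ (l, t) * lookup (mp_deriv l (H $ k)) m * lookup (mp_deriv j (G t)) m')"
        by (simp add: sum_distrib_left ac_simps)
    qed simp
    also have "\<dots> = (\<Sum>t<n. lookup (\<Sum>l<n. mp_const (T $$ (l, t)) * mp_deriv l (H $ k)) m * lookup (mp_deriv j (G t)) m')"
      by (subst sum.swap) (simp add: lookup_sum lookup_mp_const_mult sum_distrib_right)
    also have "\<dots> = 0"
    proof (rule sum.neutral, rule ballI)
      fix t assume "t \<in> {..<n}"
      then have "t < n" by simp
      from key[OF this that, of j] show "lookup (\<Sum>l<n. mp_const (T $$ (l, t)) * mp_deriv l (H $ k)) m * lookup (mp_deriv j (G t)) m' = 0"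
        by auto
    qed
    finally show ?thesis .
  qed
  have nil: "foldr (\<lambda>m. (*\<^sub>v) (coeff_mat n H m)) ms v = 0\<^sub>v n" if ms: "length ms = 2" and v: "v \<in> carrier_vec n" for ms v
  proof -
    obtain m m' where "ms = [m, m']" using ms by (auto simp: numeral_2_eq_2 length_Suc_conv)
    have M: "coeff_mat n H m \<in> carrier_mat n n" for m by (simp add: coeff_mat_def)
    have "coeff_mat n H m * coeff_mat n H m' = 0\<^sub>m n n"
    proof (rule eq_matI)
      fix i j assume "i < dim_row (0\<^sub>m n n :: 'a mat)" "j < dim_col (0\<^sub>m n n :: 'a mat)"
      then have "i < n" "j < n" by simp_all
      then show "(coeff_mat n H m * coeff_mat n H m') $$ (i, j) = 0\<^sub>m n n $$ (i, j)"
        using prod by (simp only: index_mult_eq_sum[OF M M] index_zero_mat) (simp add: coeff_mat_def)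
    qed (simp_all add: coeff_mat_def)
    moreover have "0\<^sub>m n n *\<^sub>v v = 0\<^sub>v n" using v by (intro eq_vecI) auto
    ultimately show ?thesis
      using \<open>ms = [m, m']\<close> v assoc_mult_mat_vec[OF M[of m] M[of m'] v] by simp
  qed
  show thesis
    by (rule triangularizing_if_products_zero[where N = 2 and n = n and H = H]) (rule nil that; assumption)+
qed

section \<open>Quadratic maps\<close>

text \<open>Vectors are functions on all indices, with values cut off from \<open>n\<close> on,
  because the abstract operator lemmas treat a whole type as an additive group or vector
  space.\<close>

definition mop :: "nat \<Rightarrow> (nat \<Rightarrow> nat \<Rightarrow> 'a::comm_ring_1) \<Rightarrow> (nat \<Rightarrow> 'a) \<Rightarrow> nat \<Rightarrow> 'a" where
  "mop n A v = (\<lambda>i. if i < n then \<Sum>j<n. A i j * v j else 0)"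

definition mmul :: "nat \<Rightarrow> (nat \<Rightarrow> nat \<Rightarrow> 'a::comm_ring_1) \<Rightarrow> (nat \<Rightarrow> nat \<Rightarrow> 'a) \<Rightarrow> nat \<Rightarrow> nat \<Rightarrow> 'a" where
  "mmul n A B i j = (\<Sum>k<n. A i k * B k j)"

lemma mop_mop: "mop n A (mop n B v) = mop n (mmul n A B) v"
proof
  fix i
  have "(\<Sum>j<n. A i j * (\<Sum>k<n. B j k * v k)) = (\<Sum>k<n. \<Sum>j<n. A i j * B j k * v k)"
    by (subst sum.swap) (simp add: sum_distrib_left mult.assoc)
  then show "mop n A (mop n B v) i = mop n (mmul n A B) v i"
    by (simp add: mop_def mmul_def sum_distrib_right)
qed

lemma mop_cong: "(\<And>i j. i < n \<Longrightarrow> j < n \<Longrightarrow> A i j = B i j) \<Longrightarrow> mop n A v = mop n B v"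
  by (auto simp: mop_def)

lemma mop_zero: "(\<And>i j. i < n \<Longrightarrow> j < n \<Longrightarrow> A i j = 0) \<Longrightarrow> mop n A v = 0"
  by (auto simp: mop_def)

lemma mop_add: "mop n A (v + w) = mop n A v + mop n A w"
  by (auto simp: mop_def sum.distrib algebra_simps)

lemma mop_scale: "mop n A (\<lambda>i. c * v i) = (\<lambda>i. c * mop n A v i)"
  by (auto simp: mop_def sum_distrib_left ac_simps)

lemma mop_matrix_add: "mop n (\<lambda>i j. A i j + B i j) v = mop n A v + mop n B v"
  by (auto simp: mop_def sum.distrib algebra_simps)

lemma mop_unit: "k < n \<Longrightarrow> i < n \<Longrightarrow> mop n A (\<lambda>j. if j = k then 1 else 0) i = A i k"
  by (simp add: mop_def if_distrib sum.delta cong: if_cong)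

lemma (in comm_ring_hom) hom_mmul: "hom (mmul n A B i j) = mmul n (\<lambda>i j. hom (A i j)) (\<lambda>i j. hom (B i j)) i j"
  by (simp add: mmul_def hom_sum hom_mult)

lemma affine_form:
  fixes p :: "'a::comm_ring_1 mpol"
  assumes "p \<in> mp_in n" "mp_degree p \<le> 1"
  shows "p = mp_const (lookup p 0) + lform n (\<lambda>k. lookup p (single k 1))"
proof -
  let ?e = "\<lambda>k. single k (1::nat)"
  have inj: "inj ?e" by (rule injI) (metis lookup_single_eq lookup_single_not_eq zero_neq_one)
  have e0: "?e k \<noteq> 0" for k by (metis lookup_single_eq lookup_zero zero_neq_one)
  have sub: "keys p \<subseteq> insert 0 (?e ` {..<n})"
  proof
    fix m assume m: "m \<in> keys p"
    show "m \<in> insert 0 (?e ` {..<n})"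
    proof (cases "m = 0")
      case False
      then obtain k where k: "k \<in> keys m" using keys_eq_empty by blast
      have me: "m - ?e k + ?e k = m" using k by (intro monom_diff_add) (simp add: in_keys_iff)
      have "monom_degree m \<le> 1" using m assms(2) by (simp add: mp_degree_le_iff)
      then have "monom_degree (m - ?e k) = 0" using monom_degree_add[of "m - ?e k" "?e k"] me by simp
      then have "m = ?e k" using me by simp
      moreover have "k < n" using assms(1) m k by (auto simp: mp_in_def)
      ultimately show ?thesis by blast
    qed simp
  qed
  have "p = (\<Sum>m\<in>keys p. single m (lookup p m))" by (rule sum_single_lookup[symmetric])
  also have "\<dots> = (\<Sum>m\<in>insert 0 (?e ` {..<n}). single m (lookup p m))"
    using sub by (intro sum.mono_neutral_left) (auto simp: in_keys_iff)
  also have "\<dots> = mp_const (lookup p 0) + (\<Sum>m\<in>?e ` {..<n}. single m (lookup p m))"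
  proof -
    have "0 \<notin> ?e ` {..<n}" using e0 by force
    then show ?thesis by (simp add: mp_const_def)
  qed
  also have "(\<Sum>m\<in>?e ` {..<n}. single m (lookup p m)) = lform n (\<lambda>k. lookup p (single k 1))"
    by (subst sum.reindex[OF inj_on_subset[OF inj subset_UNIV]])
      (simp add: lform_def mp_const_def mp_var_def mult_single)
  finally show ?thesis .
qed

text \<open>The cube of L + s C is s P + s^2 Q + s^3 R, as the cube of L vanishes. Its values at s =
  1, -1, 2 determine P, Q and R up to factors 2 and 3, which the torsion hypotheses remove.\<close>

lemma cube_zero_expand:
  fixes L C Mp Mm Md :: "'v::ab_group_add \<Rightarrow> 'v"
  assumes tors2: "\<And>x :: 'v. x + x = 0 \<Longrightarrow> x = 0" and tors3: "\<And>x :: 'v. x + x + x = 0 \<Longrightarrow> x = 0"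
    and L_add: "\<And>x y. L (x + y) = L x + L y" and C_add: "\<And>x y. C (x + y) = C x + C y"
    and Mp: "\<And>v. Mp v = L v + C v" and Mm: "\<And>v. Mm v = L v - C v" and Md: "\<And>v. Md v = L v + (C v + C v)"
    and L3: "\<And>v. L (L (L v)) = 0" and Mp3: "\<And>v. Mp (Mp (Mp v)) = 0"
    and Mm3: "\<And>v. Mm (Mm (Mm v)) = 0" and Md3: "\<And>v. Md (Md (Md v)) = 0"
  shows "L (L (C v)) + L (C (L v)) + C (L (L v)) = 0 \<and>
    L (C (C v)) + C (L (C v)) + C (C (L v)) = 0 \<and> C (C (C v)) = 0"
proof -
  have L0: "L 0 = 0" and C0: "C 0 = 0" using L_add[of 0 0] C_add[of 0 0] by simp_all
  have Lm: "L (- x) = - L x" and Cm: "C (- x) = - C x" for x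
    using L_add[of x "- x"] C_add[of x "- x"] by (simp_all add: L0 C0 eq_neg_iff_add_eq_0 add.commute)
  have Ld: "L (x - y) = L x - L y" and Cd: "C (x - y) = C x - C y" for x y
    using L_add[of x "- y"] C_add[of x "- y"] by (simp_all add: Lm Cm)
  define P where "P = L (L (C v)) + L (C (L v)) + C (L (L v))"
  define Q where "Q = L (C (C v)) + C (L (C v)) + C (C (L v))"
  define R where "R = C (C (C v))"
  have p: "P + Q + R = 0"
    using Mp3[of v] by (simp add: Mp P_def Q_def R_def L_add C_add L3 algebra_simps)
  have m: "Q - P - R = 0"
    using Mm3[of v] by (simp add: Mm P_def Q_def R_def Ld Cd L_add C_add L3 algebra_simps)
  have d: "P + P + (Q + Q + Q + Q) + (R + R + R + R + R + R + R + R) = 0"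
    using Md3[of v] by (simp add: Md P_def Q_def R_def L_add C_add L3 algebra_simps)
  have "Q + Q = (P + Q + R) + (Q - P - R)" by simp
  also have "\<dots> = 0" unfolding p m by simp
  finally have Q: "Q = 0" by (rule tors2)
  then have PR: "P = - R" using p by (simp add: eq_neg_iff_add_eq_0)
  have "(R + R + R) + (R + R + R) = 0" using d by (simp add: PR Q algebra_simps)
  then have "R + R + R = 0" by (rule tors2)
  then have R: "R = 0" by (rule tors3)
  show ?thesis using PR Q R by (simp add: P_def Q_def R_def)
qed

section \<open>Quadratic maps and their affine Jacobians\<close>

locale quadratic_map =
  fixes H :: "'a::field_char_0 mpol vec" and n :: nat
  assumes H_in: "\<And>k. k < n \<Longrightarrow> H $ k \<in> mp_in n" and H_deg: "\<And>k. k < n \<Longrightarrow> mp_degree (H $ k) \<le> 2"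
begin

definition J :: "nat \<Rightarrow> nat \<Rightarrow> 'a mpol" where
  "J i j = mp_deriv j (H $ i)"

definition a :: "nat \<Rightarrow> nat \<Rightarrow> 'a" where
  "a i j = lookup (J i j) 0"

definition b :: "nat \<Rightarrow> nat \<Rightarrow> nat \<Rightarrow> 'a" where
  "b i j k = lookup (J i j) (single k 1)"

text \<open>The coefficient \<open>b i j k\<close> is a mixed second partial derivative at the
  origin.\<close>

lemma b_sym: "b i j k = b i k j"
proof -
  have "b i j k = lookup (mp_deriv k (mp_deriv j (H $ i))) 0" for j k
    unfolding lookup_mp_deriv[of k] by (simp add: b_def J_def)
  then show ?thesis using mp_deriv_commute[of k j "H $ i"] by metis
qed

lemma J_deg: "i < n \<Longrightarrow> mp_degree (J i j) \<le> 1"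
proof (rule mp_degree_leI)
  fix m assume i: "i < n" and "m \<in> keys (J i j)"
  then have "m + single j 1 \<in> keys (H $ i)" by (auto simp: J_def in_keys_iff lookup_mp_deriv)
  then have "monom_degree (m + single j 1) \<le> 2" using H_deg[OF i] by (simp add: mp_degree_le_iff)
  then show "monom_degree m \<le> 1" by (simp add: monom_degree_add)
qed

lemma J_in: "i < n \<Longrightarrow> J i j \<in> mp_in n"
  unfolding J_def by (intro mp_in_deriv H_in)

lemma J_affine: "i < n \<Longrightarrow> J i j = mp_const (a i j) + lform n (b i j)"
  using affine_form[OF J_in J_deg, of i j] by (simp add: a_def b_def[abs_def])

end

text \<open>Coefficients are transported along \<open>\<phi>\<close>: the identity of K serves for
  the coefficient matrices, the embedding of K into the fraction field of the polynomials for the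
  rank argument.\<close>

locale quadratic_map_over = quadratic_map H n + comm_ring_hom \<phi>
  for H :: "'a::field_char_0 mpol vec" and n and \<phi> :: "'a \<Rightarrow> 'b::comm_ring_1"
begin

definition L :: "(nat \<Rightarrow> 'b) \<Rightarrow> nat \<Rightarrow> 'b" where
  "L = mop n (\<lambda>i j. \<phi> (a i j))"

definition B :: "(nat \<Rightarrow> 'b) \<Rightarrow> (nat \<Rightarrow> 'b) \<Rightarrow> nat \<Rightarrow> 'b" where
  "B \<xi> = mop n (\<lambda>i j. \<Sum>k<n. \<phi> (b i j k) * \<xi> k)"

definition Jat :: "(nat \<Rightarrow> 'b) \<Rightarrow> (nat \<Rightarrow> 'b) \<Rightarrow> nat \<Rightarrow> 'b" where
  "Jat \<xi> v = L v + B \<xi> v"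

interpretation ev: comm_ring_hom "mp_eval \<phi> \<xi>" for \<xi>
  by (rule mp_eval_hom) (rule comm_ring_hom_axioms)

lemma Jat_eq_mop: "Jat \<xi> = mop n (\<lambda>i j. mp_eval \<phi> \<xi> (J i j))"
proof
  fix v
  have "Jat \<xi> v = mop n (\<lambda>i j. \<phi> (a i j) + (\<Sum>k<n. \<phi> (b i j k) * \<xi> k)) v"
    by (simp add: Jat_def L_def B_def mop_matrix_add)
  also have "\<dots> = mop n (\<lambda>i j. mp_eval \<phi> \<xi> (J i j)) v"
    by (rule mop_cong) (simp add: J_affine ev.hom_add ev.hom_sum ev.hom_mult lform_def
        mp_eval_const[OF comm_ring_hom_axioms] mp_eval_var[OF comm_ring_hom_axioms])
  finally show "Jat \<xi> v = mop n (\<lambda>i j. mp_eval \<phi> \<xi> (J i j)) v" .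
qed

lemma L_add: "L (v + w) = L v + L w"
  by (simp add: L_def mop_add)

lemma B_add: "B \<xi> (v + w) = B \<xi> v + B \<xi> w"
  by (simp add: B_def mop_add)

lemma B_sym: "B \<xi> v = B v \<xi>"
proof
  fix i
  have "(\<Sum>j<n. (\<Sum>k<n. \<phi> (b i j k) * \<xi> k) * v j) = (\<Sum>k<n. \<Sum>j<n. \<phi> (b i j k) * \<xi> k * v j)"
    by (subst sum.swap) (simp add: sum_distrib_right)
  also have "\<dots> = (\<Sum>k<n. (\<Sum>j<n. \<phi> (b i k j) * v j) * \<xi> k)"
    by (simp add: sum_distrib_right sum_distrib_left b_sym[of i] ac_simps)
  finally show "B \<xi> v i = B v \<xi> i" by (simp add: B_def mop_def)
qed

lemma B_add_left: "B (\<xi> + \<eta>) v = B \<xi> v + B \<eta> v"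
  using B_add[of v \<xi> \<eta>] by (simp only: B_sym[of v])

lemma Jat_plus: "Jat (\<xi> + \<eta>) v = Jat \<xi> v + B \<eta> v"
  by (simp add: Jat_def B_add_left add.assoc)

text \<open>The hypothesis is an identity of polynomials, so it may be evaluated at every point with
  coordinates in the target ring.\<close>

lemma cube_zero:
  assumes "\<And>i j. i < n \<Longrightarrow> j < n \<Longrightarrow> mmul n J (mmul n J J) i j = 0"
  shows "Jat \<xi> (Jat \<xi> (Jat \<xi> v)) = 0"
proof -
  have "Jat \<xi> (Jat \<xi> (Jat \<xi> v)) = mop n (\<lambda>i j. mp_eval \<phi> \<xi> (mmul n J (mmul n J J) i j)) v"
    by (simp add: Jat_eq_mop mop_mop ev.hom_mmul[abs_def])
  also have "\<dots> = 0" by (rule mop_zero) (simp add: assms)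
  finally show ?thesis .
qed

text \<open>\<open>B \<eta>\<close> is a linear combination of the coefficient matrices of the
  variables, and for each of these the hypothesis is a polynomial identity that may be
  evaluated.\<close>

lemma B_square_zero:
  assumes "\<And>i j p. i < n \<Longrightarrow> j < n \<Longrightarrow> p < n \<Longrightarrow>
      mmul n (\<lambda>i j. mp_const (b i j p)) (mmul n J J) i j = 0"
  shows "B \<eta> (Jat \<xi> (Jat \<xi> v)) = 0"
proof -
  let ?w = "Jat \<xi> (Jat \<xi> v)"
  have "mop n (\<lambda>i j. \<phi> (b i j p)) ?w = 0" if "p < n" for p
  proof -
    have "mop n (\<lambda>i j. \<phi> (b i j p)) ?w
        = mop n (\<lambda>i j. mp_eval \<phi> \<xi> (mmul n (\<lambda>i j. mp_const (b i j p)) (mmul n J J) i j)) v"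
      by (simp add: Jat_eq_mop mop_mop ev.hom_mmul[abs_def] mp_eval_const[OF comm_ring_hom_axioms])
    also have "\<dots> = 0" by (rule mop_zero) (simp add: assms that)
    finally show ?thesis .
  qed
  then have "mop n (\<lambda>i j. \<phi> (b i j p)) ?w i = 0" if "p < n" for p i
    using that by (simp only: zero_fun_def)
  then have *: "(\<Sum>j<n. \<phi> (b i j p) * ?w j) = 0" if "p < n" "i < n" for p i
    using that unfolding mop_def by presburger
  show ?thesis
  proof
    fix i
    have "(\<Sum>j<n. (\<Sum>k<n. \<phi> (b i j k) * \<eta> k) * ?w j) = (\<Sum>k<n. \<eta> k * (\<Sum>j<n. \<phi> (b i j k) * ?w j))"
      unfolding sum_distrib_right by (subst sum.swap) (simp add: sum_distrib_left ac_simps)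
    then show "B \<eta> ?w i = 0 i" using * by (simp add: B_def mop_def)
  qed
qed

end

context quadratic_map
begin

lemma triangularizing_quadratic:
  assumes cube: "\<And>i j. i < n \<Longrightarrow> j < n \<Longrightarrow> mmul n J (mmul n J J) i j = 0"
    and square: "\<And>i j p. i < n \<Longrightarrow> j < n \<Longrightarrow> p < n \<Longrightarrow>
      mmul n (\<lambda>i j. mp_const (b i j p)) (mmul n J J) i j = 0"
  obtains S T where "triangularizing n S T H"
proof -
  define \<iota> where "\<iota> x = x" for x :: 'a
  have hom: "comm_ring_hom \<iota>" by unfold_locales (simp_all add: \<iota>_def)
  interpret K: quadratic_map_over H n \<iota>
    by (rule quadratic_map_over.intro[OF quadratic_map_axioms hom])
  define pad where "pad v i = (if i < n then v $ i else 0)" for v :: "'a vec" and i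
  define O' where "O' m = mop n (\<lambda>i j. lookup (J i j) m)" for m
  have tors: "x = 0" if "x + x = 0" for x :: "nat \<Rightarrow> 'a"
    using that by (auto simp: fun_eq_iff)
  \<comment> \<open>J is affine, so its coefficient operator is L for the monomial 1, B at a unit
    vector for a variable, and otherwise zero, that is, B at 0.\<close>
  have O_in: "O' m \<in> insert K.L (range K.B)" for m
  proof -
    consider "m = 0" | k where "k < n" "m = single k 1" | "m \<noteq> 0" "\<And>k. k < n \<Longrightarrow> m \<noteq> single k 1" by blast
    then show ?thesis
    proof cases
      case 1
      then have "O' m = K.L" by (simp add: O'_def K.L_def a_def \<iota>_def)
      then show ?thesis by simp
    next
      case (2 k)
      have "O' m = K.B (\<lambda>l. if l = k then 1 else 0)"
        using 2 by (simp add: O'_def K.B_def b_def \<iota>_def if_distrib sum.delta cong: if_cong)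
      then show ?thesis by simp
    next
      case 3
      have "lookup (J i j) m = 0" if "i < n" for i j
      proof -
        have "lookup (mp_var k :: 'a mpol) m = 0" if "k < n" for k
          unfolding mp_var_def using 3(2)[OF that] by (intro lookup_single_not_eq) blast
        then have "lookup (lform n (b i j)) m = 0"
          by (simp add: lform_def lookup_sum lookup_mp_const_mult)
        moreover have "lookup (mp_const (a i j)) m = 0"
          unfolding mp_const_def using 3(1) by (intro lookup_single_not_eq) blast
        ultimately have "lookup (mp_const (a i j) + lform n (b i j)) m = 0"
          by (simp add: lookup_add)
        then show ?thesis by (simp add: J_affine[OF that])
      qed
      then have "O' m v = K.B 0 v" for v
        unfolding O'_def K.B_def by (intro mop_cong) simp
      then have "O' m = K.B 0" by blast
      then show ?thesis by simp
    qed
  qed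
  \<comment> \<open>The argument of P is a value of the square of the Jacobian at
    \<open>\<xi>\<close>. Every B kills it, and then so does L because the cube vanishes.\<close>
  have sq: "P (K.L (K.L v + K.B \<xi> v) + K.B \<xi> (K.L v + K.B \<xi> v)) = 0"
    if P: "P \<in> insert K.L (range K.B)" for P \<xi> v
  proof -
    let ?w = "K.Jat \<xi> (K.Jat \<xi> v)"
    have w: "K.L (K.L v + K.B \<xi> v) + K.B \<xi> (K.L v + K.B \<xi> v) = ?w" by (simp add: K.Jat_def)
    have B: "K.B \<eta> ?w = 0" for \<eta> by (rule K.B_square_zero) (rule square)
    have "K.L ?w + K.B \<xi> ?w = 0" using K.cube_zero[OF cube, of \<xi> v] by (simp add: K.Jat_def)
    then have "K.L ?w = 0" by (simp add: B)
    then show ?thesis unfolding w using P B by auto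
  qed
  have pad_mult: "pad (coeff_mat n H m *\<^sub>v v) = O' m (pad v)" if "v \<in> carrier_vec n" for m v
    using that by (auto simp: pad_def O'_def mop_def coeff_mat_def scalar_prod_def atLeast0LessThan J_def)
  have nil: "foldr (\<lambda>m. (*\<^sub>v) (coeff_mat n H m)) ms v = 0\<^sub>v n"
    if ms: "length ms = 4" and v: "v \<in> carrier_vec n" for ms v
  proof -
    obtain m1 m2 m3 m4 where ms4: "ms = [m1, m2, m3, m4]"
      using ms by (auto simp: numeral_eq_Suc length_Suc_conv)
    have M: "coeff_mat n H m *\<^sub>v w \<in> carrier_vec n" for m w
      by (rule carrier_vecI) (simp add: coeff_mat_def)
    have "pad (foldr (\<lambda>m. (*\<^sub>v) (coeff_mat n H m)) ms v) = O' m1 (O' m2 (O' m3 (O' m4 (pad v))))"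
      using v M by (simp add: ms4 pad_mult)
    also have "\<dots> = 0"
    proof (rule fourfold_products_zero[where L = K.L and B = K.B and P = "O' m1" and Q = "O' m2"
          and R = "O' m3" and S = "O' m4"])
      show "x = 0" if "x + x = 0" for x :: "nat \<Rightarrow> 'a" using that by (rule tors)
      show "P (K.L (K.L v + K.B \<xi> v) + K.B \<xi> (K.L v + K.B \<xi> v)) = 0"
        if "P \<in> insert K.L (range K.B)" for P \<xi> v using that by (rule sq)
    qed (rule K.L_add K.B_add K.B_sym O_in)+
    finally have "pad (foldr (\<lambda>m. (*\<^sub>v) (coeff_mat n H m)) ms v) = 0" .
    moreover have "foldr (\<lambda>m. (*\<^sub>v) (coeff_mat n H m)) ms v \<in> carrier_vec n"
      using M by (simp add: ms4)
    ultimately show ?thesis by (intro eq_vecI) (auto simp: pad_def fun_eq_iff split: if_splits)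
  qed
  show thesis
    by (rule triangularizing_if_products_zero[where N = 4 and n = n and H = H]) (rule nil that; assumption)+
qed

end

section \<open>The Jacobian over the field of fractions\<close>

abbreviation to_frac :: "'a::idom \<Rightarrow> 'a fract" where
  "to_frac p \<equiv> Fract p 1"

lemma to_frac_hom: "comm_ring_hom (to_frac :: 'a::idom \<Rightarrow> 'a fract)"
  by unfold_locales (simp_all add: One_fract_def Zero_fract_def)

interpretation to_frac: comm_ring_hom "to_frac :: 'a::idom \<Rightarrow> 'a fract"
  by (rule to_frac_hom)

lemma to_frac_eq_iff [simp]: "to_frac p = to_frac q \<longleftrightarrow> p = q"
  by (simp add: eq_fract)

lemma fract_numeral_multiple_eq_0:
  fixes x :: "'a::{idom,ring_char_0} fract"
  shows "x + x = 0 \<Longrightarrow> x = 0" and "x + x + x = 0 \<Longrightarrow> x = 0"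
proof -
  have f: "of_nat k = to_frac (of_nat k :: 'a)" for k by (simp add: to_frac.hom_of_nat)
  have nz: "(of_nat k :: 'a fract) \<noteq> 0" if "k > 0" for k
    unfolding f to_frac.hom_zero[symmetric] to_frac_eq_iff using that by simp
  show "x = 0" if "x + x = 0"
  proof -
    have "of_nat 2 * x = 0" using that by simp
    then show ?thesis using nz[of 2] by simp
  qed
  show "x = 0" if "x + x + x = 0"
  proof -
    have "of_nat 3 * x = x + x + x" by simp
    then have "of_nat 3 * x = 0" using that by simp
    then show ?thesis using nz[of 3] by (metis mult_eq_0_iff zero_less_numeral)
  qed
qed

lemma mop_matrix_index:
  assumes "M \<in> carrier_mat n n" "i < n"
  shows "mop n (\<lambda>i j. M $$ (i, j)) v i = (M *\<^sub>v vec n v) $ i"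
  using assms by (simp add: mop_def scalar_prod_def atLeast0LessThan)

lemma mop_matrix_pow:
  assumes M: "M \<in> carrier_mat n n" and i: "i < n"
  shows "(mop n (\<lambda>i j. M $$ (i, j)) ^^ k) v i = (M ^\<^sub>m k *\<^sub>v vec n v) $ i"
proof (induction k arbitrary: v)
  case 0
  then show ?case using M i by simp
next
  case (Suc k)
  let ?f = "mop n (\<lambda>i j. M $$ (i, j))"
  have "(?f ^^ Suc k) v i = (M ^\<^sub>m k *\<^sub>v vec n (?f v)) $ i"
    using Suc[of "?f v"] by (simp add: funpow_swap1)
  also have "vec n (?f v) = M *\<^sub>v vec n v"
    using M by (intro eq_vecI) (simp_all add: mop_matrix_index del: index_mult_mat_vec)
  also have "M ^\<^sub>m k *\<^sub>v (M *\<^sub>v vec n v) = M ^\<^sub>m Suc k *\<^sub>v vec n v"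
    using M by (simp add: assoc_mult_mat_vec[of _ n n _ n])
  finally show ?case .
qed

interpretation fun_vs: vector_space "\<lambda>(c :: 'f::field) (v :: nat \<Rightarrow> 'f) i. c * v i"
  by unfold_locales (auto simp: algebra_simps)

context
  fixes H :: "'a::field_char_0 mpol vec" and n :: nat
  assumes H: "H \<in> carrier_vec n"
begin

definition jac_op :: "(nat \<Rightarrow> 'a mpol fract) \<Rightarrow> nat \<Rightarrow> 'a mpol fract" where
  "jac_op = mop n (\<lambda>i j. to_frac (mp_deriv j (H $ i)))"

lemma jac_carrier: "map_mat to_frac (jacobian H) \<in> carrier_mat n n"
  using H by (simp add: jacobian_def)

lemma jac_op_eq: "jac_op = mop n (\<lambda>i j. map_mat to_frac (jacobian H) $$ (i, j))"
  unfolding jac_op_def using H by (intro ext mop_cong) (simp add: jacobian_def)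

lemma jac_op_nilpotent:
  assumes "nilpotent_mat (jacobian H)"
  obtains k where "\<forall>v. (jac_op ^^ k) v = 0"
proof -
  have J: "jacobian H \<in> carrier_mat n n" using H by (simp add: jacobian_def)
  obtain k where k: "jacobian H ^\<^sub>m k = 0\<^sub>m n n" using assms J by (auto simp: nilpotent_mat_def)
  have "map_mat to_frac (jacobian H) ^\<^sub>m k = map_mat to_frac (jacobian H ^\<^sub>m k)"
    using J by (simp add: to_frac.mat_hom_pow)
  then have k': "map_mat to_frac (jacobian H) ^\<^sub>m k = 0\<^sub>m n n" unfolding k by (intro eq_matI) auto
  have zero: "(jac_op ^^ k) v i = 0" if "i < n" for v i
    unfolding jac_op_eq mop_matrix_pow[OF jac_carrier that] k' using that by simp
  \<comment> \<open>The extra application clears the entries from \<open>n\<close> on, which matters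
    when k = 0.\<close>
  have "\<forall>v. (jac_op ^^ Suc k) v = 0"
    using zero by (auto simp: jac_op_def mop_def)
  then show thesis by (rule that)
qed

lemma jac_op_range:
  obtains S where "finite S" "card S = rk (jacobian H)"
    "\<forall>v. \<exists>c. \<forall>i. jac_op v i = (\<Sum>u\<in>S. c u * (if i < n then u $ i else 0))"
proof -
  interpret vec_space "TYPE('a mpol fract)" n .
  obtain S where S: "finite S" "card S = rank (map_mat to_frac (jacobian H))" "S \<subseteq> carrier_vec n"
    "\<And>v. v \<in> carrier_vec n \<Longrightarrow> map_mat to_frac (jacobian H) *\<^sub>v v \<in> span S"
    using rank_generators[OF jac_carrier] by metis
  show thesis
  proof (rule that[OF S(1)])
    show "card S = rk (jacobian H)" using S(2) H by (simp add: rk_def jacobian_def)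
    show "\<forall>v. \<exists>c. \<forall>i. jac_op v i = (\<Sum>u\<in>S. c u * (if i < n then u $ i else 0))"
    proof
      fix v
      have mem: "map_mat to_frac (jacobian H) *\<^sub>v vec n v \<in> span S" by (rule S(4)) simp
      obtain c where
        c: "\<And>i. i < n \<Longrightarrow> (map_mat to_frac (jacobian H) *\<^sub>v vec n v) $ i = (\<Sum>u\<in>S. c u * u $ i)"
        using span_index[OF mem S(3,1)] by blast
      have "jac_op v i = (\<Sum>u\<in>S. c u * (if i < n then u $ i else 0))" for i
      proof (cases "i < n")
        case True
        then show ?thesis using c[OF True] by (simp only: jac_op_eq mop_matrix_index[OF jac_carrier True] if_True)
      next
        case False
        then show ?thesis by (simp add: jac_op_eq mop_def)
      qed
      then show "\<exists>c. \<forall>i. jac_op v i = (\<Sum>u\<in>S. c u * (if i < n then u $ i else 0))" by blast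
    qed
  qed
qed

lemma jac_op_add: "jac_op (v + w) = jac_op v + jac_op w"
  by (simp add: jac_op_def mop_add)

lemma jac_op_scale: "jac_op (\<lambda>i. c * v i) = (\<lambda>i. c * jac_op v i)"
  by (simp add: jac_op_def mop_scale)

lemma mmul_eq_0_if_mop:
  assumes "\<And>v. mop n (\<lambda>i j. to_frac (A i j)) v = 0" "i < n" "j < n"
  shows "A i j = (0 :: 'a mpol)"
proof -
  have "to_frac (A i j) = mop n (\<lambda>i j. to_frac (A i j)) (\<lambda>k. if k = j then 1 else 0) i"
    by (rule mop_unit[OF assms(3,2), symmetric])
  also have "\<dots> = to_frac 0" by (simp only: assms(1) zero_fun_def to_frac.hom_zero)
  finally show ?thesis by (simp only: to_frac_eq_iff)
qed

text \<open>All columns of J are multiples of one vector U, so the 2x2 minors vanish; a nilpotent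
  operator of rank one has square zero.\<close>

lemma triangularizing_if_rk_1:
  assumes H_in: "\<forall>k<n. H $ k \<in> mp_in n" and nil: "nilpotent_mat (jacobian H)" and rk: "rk (jacobian H) = 1"
  obtains S T where "triangularizing n S T H"
proof -
  obtain k where "\<forall>v. (jac_op ^^ k) v = 0" by (rule jac_op_nilpotent[OF nil])
  then have k: "(jac_op ^^ k) v = 0" for v by blast
  obtain U where U: "\<exists>c. jac_op v = (\<lambda>i. c * U i)" for v
  proof -
    obtain S where S: "card S = 1"
      "\<forall>v. \<exists>c. \<forall>i. jac_op v i = (\<Sum>u\<in>S. c u * (if i < n then u $ i else 0))"
      by (rule jac_op_range[unfolded rk])
    obtain u where "S = {u}" using S(1) by (auto simp: card_1_singleton_iff)
    then have "\<exists>c. jac_op v = (\<lambda>i. c * (if i < n then u $ i else 0))" for v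
      using S(2)[rule_format, of v] \<open>S = {u}\<close> by (auto simp: fun_eq_iff)
    then show thesis by (rule that)
  qed
  have sq: "jac_op (jac_op v) = 0" for v
    using fun_vs.nilpotent_rank_1[of jac_op k U v] jac_op_scale k U by blast
  show thesis
  proof (rule triangularizing_rank_1[OF H_in])
    fix a b i j assume lt: "a < n" "b < n" "i < n" "j < n"
    obtain ci where ci: "jac_op (\<lambda>k. if k = i then 1 else 0) = (\<lambda>l. ci * U l)" using U by blast
    obtain cj where cj: "jac_op (\<lambda>k. if k = j then 1 else 0) = (\<lambda>l. cj * U l)" using U by blast
    have i: "to_frac (mp_deriv i (H $ l)) = ci * U l" if "l < n" for l
      using fun_cong[OF ci, of l] that lt unfolding jac_op_def by (simp add: mop_unit)
    have j: "to_frac (mp_deriv j (H $ l)) = cj * U l" if "l < n" for l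
      using fun_cong[OF cj, of l] that lt unfolding jac_op_def by (simp add: mop_unit)
    have "to_frac (mp_deriv i (H $ a) * mp_deriv j (H $ b)) = to_frac (mp_deriv j (H $ a) * mp_deriv i (H $ b))"
      unfolding to_frac.hom_mult using lt by (simp only: i j ac_simps)
    then show "mp_deriv i (H $ a) * mp_deriv j (H $ b) = mp_deriv j (H $ a) * mp_deriv i (H $ b)"
      by (simp only: to_frac_eq_iff)
  next
    fix a k assume lt: "a < n" "k < n"
    let ?J = "\<lambda>i j. mp_deriv j (H $ i)"
    have "mop n (\<lambda>i j. to_frac (mmul n ?J ?J i j)) v = 0" for v
      using sq[of v] by (simp add: jac_op_def mop_mop to_frac.hom_mmul)
    then have "mmul n ?J ?J a k = 0" using lt by (rule mmul_eq_0_if_mop)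
    then show "(\<Sum>j<n. mp_deriv j (H $ a) * mp_deriv k (H $ j)) = 0" by (simp add: mmul_def)
  qed (rule that)
qed

lemma triangularizing_if_rk_2:
  assumes H_in: "\<forall>k<n. H $ k \<in> mp_in n" and nil: "nilpotent_mat (jacobian H)" and rk: "rk (jacobian H) = 2"
    and deg: "\<forall>k<n. mp_degree (H $ k) \<le> 2"
  obtains S T where "triangularizing n S T H"
proof -
  interpret quadratic_map H n using H_in deg by unfold_locales auto
  have hom: "comm_ring_hom (\<lambda>c. to_frac (mp_const c) :: 'a mpol fract)"
    by unfold_locales (simp_all add: mp_const.hom_add mp_const.hom_mult to_frac.hom_add to_frac.hom_mult
        to_frac.hom_one to_frac.hom_zero mp_const.hom_one mp_const.hom_zero del: add_fract mult_fract)
  interpret F: quadratic_map_over H n "\<lambda>c. to_frac (mp_const c)"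
    by (rule quadratic_map_over.intro[OF quadratic_map_axioms hom])
  \<comment> \<open>The generic point: evaluation there returns J itself, to which the rank
    hypothesis applies.\<close>
  define X :: "nat \<Rightarrow> 'a mpol fract" where "X k = to_frac (mp_var k)" for k
  interpret ev: comm_ring_hom "mp_eval (\<lambda>c. to_frac (mp_const c)) X" by (rule mp_eval_hom[OF hom])
  have ev: "mp_eval (\<lambda>c. to_frac (mp_const c)) X p = to_frac p" for p
  proof -
    obtain m where "p \<in> mp_in m" using mp_in_exists by blast
    then show ?thesis
    proof (induction rule: mp_in_induct)
      case (const c)
      show ?case by (rule mp_eval_const[OF hom])
    next
      case (add p q)
      then show ?case by (simp only: ev.hom_add to_frac.hom_add)
    next
      case (var i p)
      have "mp_eval (\<lambda>c. to_frac (mp_const c)) X (mp_var i) = to_frac (mp_var i)"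
        unfolding mp_eval_var[OF hom] by (rule X_def)
      with var show ?case by (simp only: ev.hom_mult to_frac.hom_mult)
    qed
  qed
  have at_X: "F.Jat X = jac_op" by (simp only: F.Jat_eq_mop ev jac_op_def J_def)
  obtain k where "\<forall>v. (jac_op ^^ k) v = 0" by (rule jac_op_nilpotent[OF nil])
  then have k: "(jac_op ^^ k) v = 0" for v by blast
  obtain U U' where U: "\<exists>c d. jac_op v = (\<lambda>i. c * U i) + (\<lambda>i. d * U' i)" for v
  proof -
    obtain S where S: "card S = 2"
      "\<forall>v. \<exists>c. \<forall>i. jac_op v i = (\<Sum>u\<in>S. c u * (if i < n then u $ i else 0))"
      by (rule jac_op_range[unfolded rk])
    obtain u u' where u: "S = {u, u'}" "u \<noteq> u'" using S(1) by (auto simp: card_2_iff)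
    have "\<exists>c d. jac_op v = (\<lambda>i. c * (if i < n then u $ i else 0)) + (\<lambda>i. d * (if i < n then u' $ i else 0))" for v
    proof -
      obtain c where "\<forall>i. jac_op v i = (\<Sum>u\<in>S. c u * (if i < n then u $ i else 0))" using S(2) by blast
      then have "jac_op v = (\<lambda>i. c u * (if i < n then u $ i else 0)) + (\<lambda>i. c u' * (if i < n then u' $ i else 0))"
        using u by (auto simp: fun_eq_iff)
      then show ?thesis by blast
    qed
    then show thesis by (rule that)
  qed
  have cube_op: "jac_op (jac_op (jac_op v)) = 0" for v
    by (rule fun_vs.nilpotent_rank_2_cube[of jac_op k U U' v]) (simp_all only: jac_op_add jac_op_scale k U)
  have cube: "mmul n J (mmul n J J) i j = 0" if "i < n" "j < n" for i j
  proof -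
    have "mop n (\<lambda>i j. to_frac (mmul n J (mmul n J J) i j)) v = 0" for v
      using cube_op[of v] by (simp only: jac_op_def mop_mop to_frac.hom_mmul J_def)
    then show ?thesis using that by (rule mmul_eq_0_if_mop)
  qed
  have cube_at: "F.Jat \<xi> (F.Jat \<xi> (F.Jat \<xi> v)) = 0" for \<xi> v by (rule F.cube_zero) (rule cube)
  have tors2: "x = 0" if "x + x = 0" for x :: "nat \<Rightarrow> 'a mpol fract"
    using that fract_numeral_multiple_eq_0(1) by (auto simp: fun_eq_iff)
  have tors3: "x = 0" if "x + x + x = 0" for x :: "nat \<Rightarrow> 'a mpol fract"
    using that fract_numeral_multiple_eq_0(2) by (auto simp: fun_eq_iff)
  have B0: "F.B 0 v = 0" for v using F.B_add_left[of 0 0 v] by simp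
  have Bm: "F.B (- y) v = - F.B y v" for y v
    using F.B_add_left[of y "- y" v] by (simp add: B0 eq_neg_iff_add_eq_0 add.commute)
  \<comment> \<open>The cube of the Jacobian vanishes at X + y, X - y and X + 2 y.\<close>
  have expand: "jac_op (jac_op (F.B y v)) + jac_op (F.B y (jac_op v)) + F.B y (jac_op (jac_op v)) = 0 \<and>
    jac_op (F.B y (F.B y v)) + F.B y (jac_op (F.B y v)) + F.B y (F.B y (jac_op v)) = 0 \<and>
    F.B y (F.B y (F.B y v)) = 0" for y v
  proof (rule cube_zero_expand)
    show "F.Jat (X + y) v = jac_op v + F.B y v" for v by (simp only: F.Jat_plus at_X)
    show "F.Jat (X + - y) v = jac_op v - F.B y v" for v
      by (simp only: F.Jat_plus at_X Bm diff_conv_add_uminus)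
    show "F.Jat (X + (y + y)) v = jac_op v + (F.B y v + F.B y v)" for v
      by (simp only: F.Jat_plus at_X F.B_add_left)
  qed (erule tors2 tors3 | rule jac_op_add F.B_add cube_op cube_at)+
  then have LLB: "jac_op (jac_op (F.B y v)) + jac_op (F.B y (jac_op v)) + F.B y (jac_op (jac_op v)) = 0"
    and LBB: "jac_op (F.B y (F.B y v)) + F.B y (jac_op (F.B y v)) + F.B y (F.B y (jac_op v)) = 0"
    and B3: "F.B y (F.B y (F.B y v)) = 0" for y v by blast+
  \<comment> \<open>The same expansion with \<open>F.B x\<close> in place of J; its cube vanishes by
    \<open>B3\<close>.\<close>
  have "F.B x (F.B x (F.B y v)) + F.B x (F.B y (F.B x v)) + F.B y (F.B x (F.B x v)) = 0 \<and>
    F.B x (F.B y (F.B y v)) + F.B y (F.B x (F.B y v)) + F.B y (F.B y (F.B x v)) = 0 \<and>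
    F.B y (F.B y (F.B y v)) = 0" for x y v
  proof (rule cube_zero_expand)
    show "F.B (x + y) v = F.B x v + F.B y v" for v by (rule F.B_add_left)
    show "F.B (x + - y) v = F.B x v - F.B y v" for v
      by (simp only: F.B_add_left Bm diff_conv_add_uminus)
    show "F.B (x + (y + y)) v = F.B x v + (F.B y v + F.B y v)" for v by (simp only: F.B_add_left)
  qed (erule tors2 tors3 | rule F.B_add B3)+
  then have BBB: "F.B x (F.B x (F.B y v)) + F.B x (F.B y (F.B x v)) + F.B y (F.B x (F.B x v)) = 0" for x y v
    by blast
  have B_scale: "F.B x (\<lambda>i. c * v i) = (\<lambda>i. c * F.B x v i)" for c x v
    by (simp add: F.B_def mop_scale)
  have B_square: "F.B y (jac_op (jac_op v)) = 0" for y v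
  proof (cases "jac_op (jac_op v) = 0")
    case True
    then show ?thesis using F.B_add[of y 0 0] by simp
  next
    case False
    \<comment> \<open>Since J^2 v is nonzero, v itself can serve as the vector \<open>a\<close> of
      \<open>square_annihilated\<close>.\<close>
    have range: "\<exists>c d. jac_op y = (\<lambda>i. c * jac_op (jac_op v) i) + (\<lambda>i. d * jac_op v i)" for y
      by (rule fun_vs.nilpotent_rank_2_range[of jac_op k U U' v]) (simp_all only: jac_op_scale k U False not_False_eq_True)
    show ?thesis
      by (rule fun_vs.square_annihilated[of jac_op F.B v])
        (rule jac_op_add jac_op_scale F.B_add B_scale F.B_sym cube_op LLB LBB BBB B3 range)+
  qed
  have square: "mmul n (\<lambda>i j. mp_const (b i j p)) (mmul n J J) i j = 0"
    if lt: "i < n" "j < n" "p < n" for i j p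
  proof -
    \<comment> \<open>At the p-th unit vector, B becomes the coefficient matrix of x_p.\<close>
    let ?e = "\<lambda>k. if k = p then 1 else 0 :: 'a mpol fract"
    have "mop n (\<lambda>i j. to_frac (mmul n (\<lambda>i j. mp_const (b i j p)) (mmul n J J) i j)) v = F.B ?e (jac_op (jac_op v))" for v
      using lt(3) by (simp add: F.B_def jac_op_def mop_mop to_frac.hom_mmul J_def if_distrib sum.delta cong: if_cong)
    then have "mop n (\<lambda>i j. to_frac (mmul n (\<lambda>i j. mp_const (b i j p)) (mmul n J J) i j)) v = 0" for v
      by (simp only: B_square)
    then show ?thesis using lt(1,2) by (rule mmul_eq_0_if_mop)
  qed
  show thesis
  proof (rule triangularizing_quadratic)
    show "mmul n J (mmul n J J) i j = 0" if "i < n" "j < n" for i j using that by (rule cube)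
    show "mmul n (\<lambda>i j. mp_const (b i j p)) (mmul n J J) i j = 0" if "i < n" "j < n" "p < n" for i j p
      using that by (rule square)
  qed (rule that)
qed

end

theorem theorem3p4:
  fixes H :: "'a::field_char_0 mpol vec" and n d :: nat
  assumes "H \<in> carrier_vec n"
    and "\<forall>i<n. H $ i \<in> mp_in n"
    and "map_degree H = d"
    and "nilpotent_mat (jacobian H)"
    and "rk (jacobian H) = 1 \<or> (rk (jacobian H) = 2 \<and> d = 2)"
  shows "((\<forall>i<n. mp_eval id (\<lambda>_. 0) (H $ i) = 0) \<longrightarrow> sum_of_powers_form n d H) \<and>
    lin_triangularizable n H"
proof -
  obtain S T where ST: "triangularizing n S T H"
  proof (cases "rk (jacobian H) = 1")
    case True
    show thesis by (rule triangularizing_if_rk_1[OF assms(1,2,4) True]) (erule that)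
  next
    case False
    then have rk: "rk (jacobian H) = 2" and d: "d = 2" using assms(5) by auto
    have deg: "\<forall>k<n. mp_degree (H $ k) \<le> 2"
      using assms(1,3) d mp_degree_le_map_degree[of _ H] by auto
    show thesis by (rule triangularizing_if_rk_2[OF assms(1,2,4) rk deg]) (erule that)
  qed
  have "sum_of_powers_form n d H" if "\<forall>i<n. lookup (H $ i) 0 = 0"
    using assms(3) that by (intro sum_of_powers_if_triangularizing[OF assms(1,2) _ ST]) simp_all
  moreover have "lin_triangularizable n H"
    by (rule lin_triangularizable_if_triangularizing[OF assms(1,2) ST])
  ultimately show ?thesis unfolding mp_eval_at_0 by blast
qed

end
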